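(* Let $m>n$ be non-zero natural numbers. If $\mathcal{R}$ is a non-trivial Rogers $\Pi^1_m$-semilattice, then $\mathcal{R}$ is not isomorphic to any Rogers $\Pi^1_n$-semilattice.
   Context: All families $\mathcal{S}$ considered are countable subsets of $P(\omega)$. A numbering of $\mathcal{S}$ is a surjective map $\nu\colon\omega\to\mathcal{S}$. A numbering $\nu$ is reducible to a numbering $\mu$ ($\nu\le\mu$) if there is a total computable function $f$ with $\nu(x)=\mu(f(x))$ for all $x$; $\nu\equiv\mu$ means $\nu\le\mu$ and $\mu\le\nu$. For numberings $\nu,\mu$, the numbering $\nu\oplus\mu$ is given by $(\nu\oplus\mu)(2x)=\nu(x)$, $(\nu\oplus\mu)(2x+1)=\mu(x)$. A numbering $\nu$ is $\Pi^1_k$-computable if the set $G_\nu=\{\langle n,x\rangle : x\in\nu(n)\}$ is $\Pi^1_k$; a family is $\Pi^1_k$-computable if it has a $\Pi^1_k$-computable numbering. For a $\Pi^1_k$-computable family $\mathcal{S}$, its Rogers semilattice $\mathcal{R}^1_k(\mathcal{S})$ is the upper semilattice of $\equiv$-classes of all $\Pi^1_k$-computable numberings of $\mathcal{S}$, ordered by $\le$ with join induced by $\oplus$. An upper semilattice is a Rogers $\Pi^1_k$-semilattice if it is isomorphic to $\mathcal{R}^1_k(\mathcal{S})$ for some $\Pi^1_k$-computable family $\mathcal{S}$. A semilattice is non-trivial if it has more than one element. *)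

theory Defs
  imports "HOL-Library.Nat_Bijection" "HOL-Algebra.Lattice"
begin

section \<open>Partial recursive functions with function oracles\<close>

datatype prog =
    Zero
  | Succ
  | Proj nat
  | Oracle nat
  | Comp prog "prog list"
  | PrimRec prog prog
  | Mu prog

text \<open>
  \<open>eval F p xs y\<close>: the program \<open>p\<close> with oracles \<open>F\<close> halts on the arguments \<open>xs\<close> with
  output \<open>y\<close>. Calls of a missing oracle have no value, nor do ill-formed calls such as \<open>Succ\<close> on two arguments.
\<close>

inductive eval :: "(nat \<Rightarrow> nat) list \<Rightarrow> prog \<Rightarrow> nat list \<Rightarrow> nat \<Rightarrow> bool"
  for F :: "(nat \<Rightarrow> nat) list" where
  eval_Zero: "eval F Zero xs 0"
| eval_Succ: "eval F Succ [x] (Suc x)"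
| eval_Proj: "i < length xs \<Longrightarrow> eval F (Proj i) xs (xs ! i)"
| eval_Oracle: "i < length F \<Longrightarrow> eval F (Oracle i) [x] ((F ! i) x)"
| eval_Comp: "list_all2 (\<lambda>g z. eval F g xs z) gs zs \<Longrightarrow> eval F f zs y
    \<Longrightarrow> eval F (Comp f gs) xs y"
| eval_PrimRec_0: "eval F g xs y \<Longrightarrow> eval F (PrimRec g h) (0 # xs) y"
| eval_PrimRec_Suc: "eval F (PrimRec g h) (n # xs) r \<Longrightarrow> eval F h (n # r # xs) y
    \<Longrightarrow> eval F (PrimRec g h) (Suc n # xs) y"
| eval_Mu: "eval F f (n # xs) 0 \<Longrightarrow> (\<forall>i<n. \<exists>v. eval F f (i # xs) (Suc v))
    \<Longrightarrow> eval F (Mu f) xs n"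

lemma eval_deterministic: "eval F p xs y \<Longrightarrow> eval F p xs z \<Longrightarrow> y = z"
proof (induction arbitrary: z rule: eval.induct)
  case (eval_Comp xs gs zs f y)
  from eval_Comp.prems obtain zs' where
    zs': "list_all2 (\<lambda>g z. eval F g xs z) gs zs'" "eval F f zs' z"
    by (cases rule: eval.cases) auto
  have "zs = zs'"
    using eval_Comp.IH(1) zs'(1) by (auto simp: list_all2_conv_all_nth intro!: nth_equalityI)
  with zs' eval_Comp.IH(2) show ?case by blast
next
  case (eval_PrimRec_0 g xs y h)
  from eval_PrimRec_0.prems show ?case
    by (cases rule: eval.cases) (auto dest: eval_PrimRec_0.IH)
next
  case (eval_PrimRec_Suc g h n xs r y)
  from eval_PrimRec_Suc.prems show ?case
    by (cases rule: eval.cases) (use eval_PrimRec_Suc.IH in blast)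
next
  case (eval_Mu f n xs)
  from eval_Mu.prems have z: "eval F f (z # xs) 0" "\<forall>i<z. \<exists>v. eval F f (i # xs) (Suc v)"
    by (cases rule: eval.cases; auto)+
  show ?case
  proof (rule linorder_cases[of n z])
    assume "n < z"
    with z(2) obtain v where "eval F f (n # xs) (Suc v)" by blast
    with eval_Mu.IH(1) show ?thesis by blast
  next
    assume "z < n"
    with eval_Mu.IH(2) z(1) show ?thesis by blast
  qed
qed (erule eval.cases; auto)+

definition computable :: "(nat \<Rightarrow> nat) \<Rightarrow> bool" where
  "computable f \<longleftrightarrow> (\<exists>p. \<forall>x. eval [] p [x] (f x))"


section \<open>The analytical hierarchy\<close>

text \<open>
  A relation with \<open>p\<close> function arguments and \<open>q\<close> number arguments is a predicate on lists of
  lengths \<open>p\<close> and \<open>q\<close>; its values on lists of other lengths are irrelevant.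
\<close>

type_synonym relation = "(nat \<Rightarrow> nat) list \<Rightarrow> nat list \<Rightarrow> bool"

definition recursive_rel :: "nat \<Rightarrow> nat \<Rightarrow> relation \<Rightarrow> bool" where
  "recursive_rel p q R \<longleftrightarrow>
     (\<exists>e. \<forall>F xs. length F = p \<longrightarrow> length xs = q \<longrightarrow> eval F e xs (if R F xs then 1 else 0))"

text \<open>
  The arithmetical relations are those obtained from recursive relations by number
  quantification; universal quantifiers arise from existential ones by complementation.
\<close>

inductive arithmetical :: "nat \<Rightarrow> nat \<Rightarrow> relation \<Rightarrow> bool" where
  arithmetical_recursive: "recursive_rel p q R \<Longrightarrow> arithmetical p q R"
| arithmetical_not: "arithmetical p q R \<Longrightarrow> arithmetical p q (\<lambda>F xs. \<not> R F xs)"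
| arithmetical_ex: "arithmetical p (Suc q) Q
    \<Longrightarrow> (\<And>F xs. length F = p \<Longrightarrow> length xs = q \<Longrightarrow> R F xs \<longleftrightarrow> (\<exists>n. Q F (n # xs)))
    \<Longrightarrow> arithmetical p q R"

fun Sigma1_rel Pi1_rel :: "nat \<Rightarrow> nat \<Rightarrow> nat \<Rightarrow> relation \<Rightarrow> bool" where
  "Sigma1_rel 0 p q R \<longleftrightarrow> arithmetical p q R"
| "Sigma1_rel (Suc k) p q R \<longleftrightarrow>
     (\<exists>Q. Pi1_rel k (Suc p) q Q \<and>
        (\<forall>F xs. length F = p \<longrightarrow> length xs = q \<longrightarrow> (R F xs \<longleftrightarrow> (\<exists>f. Q (f # F) xs))))"
| "Pi1_rel 0 p q R \<longleftrightarrow> arithmetical p q R"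
| "Pi1_rel (Suc k) p q R \<longleftrightarrow>
     (\<exists>Q. Sigma1_rel k (Suc p) q Q \<and>
        (\<forall>F xs. length F = p \<longrightarrow> length xs = q \<longrightarrow> (R F xs \<longleftrightarrow> (\<forall>f. Q (f # F) xs))))"

definition Pi1_set :: "nat \<Rightarrow> nat set \<Rightarrow> bool" where
  "Pi1_set k A \<longleftrightarrow> (\<exists>R. Pi1_rel k 0 1 R \<and> A = {x. R [] [x]})"


section \<open>Numberings\<close>

type_synonym numbering = "nat \<Rightarrow> nat set"

definition numbering_of :: "nat set set \<Rightarrow> numbering \<Rightarrow> bool" where
  "numbering_of S \<nu> \<longleftrightarrow> range \<nu> = S"

definition num_reducible :: "numbering \<Rightarrow> numbering \<Rightarrow> bool" where
  "num_reducible \<nu> \<mu> \<longleftrightarrow> (\<exists>f. computable f \<and> (\<forall>x. \<nu> x = \<mu> (f x)))"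

definition num_equiv :: "numbering \<Rightarrow> numbering \<Rightarrow> bool" where
  "num_equiv \<nu> \<mu> \<longleftrightarrow> num_reducible \<nu> \<mu> \<and> num_reducible \<mu> \<nu>"

definition num_sum :: "numbering \<Rightarrow> numbering \<Rightarrow> numbering" where
  "num_sum \<nu> \<mu> x = (if even x then \<nu> (x div 2) else \<mu> (x div 2))"

lemma num_sum_simps: "num_sum \<nu> \<mu> (2 * x) = \<nu> x" "num_sum \<nu> \<mu> (2 * x + 1) = \<mu> x"
  by (simp_all add: num_sum_def)

definition num_graph :: "numbering \<Rightarrow> nat set" where
  "num_graph \<nu> = {prod_encode (n, x) | n x. x \<in> \<nu> n}"

definition Pi1_computable :: "nat \<Rightarrow> numbering \<Rightarrow> bool" where
  "Pi1_computable k \<nu> \<longleftrightarrow> Pi1_set k (num_graph \<nu>)"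

definition Pi1_numberings :: "nat \<Rightarrow> nat set set \<Rightarrow> numbering set" where
  "Pi1_numberings k S = {\<nu>. numbering_of S \<nu> \<and> Pi1_computable k \<nu>}"

text \<open>Such a family is automatically countable, being the range of a numbering.\<close>

definition Pi1_computable_family :: "nat \<Rightarrow> nat set set \<Rightarrow> bool" where
  "Pi1_computable_family k S \<longleftrightarrow> (\<exists>\<nu>. numbering_of S \<nu> \<and> Pi1_computable k \<nu>)"


section \<open>Upper semilattices and Rogers semilattices\<close>

record 'a usl = "'a gorder" +
  vee :: "'a \<Rightarrow> 'a \<Rightarrow> 'a"

definition is_usl :: "'a usl \<Rightarrow> bool" where
  "is_usl L \<longleftrightarrow> partial_order L \<and>
     (\<forall>x\<in>carrier L. \<forall>y\<in>carrier L. least L (vee L x y) (Upper L {x, y}))"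

lemma is_usl_upper_semilattice:
  assumes "is_usl L"
  shows "upper_semilattice L"
proof -
  interpret partial_order L using assms by (simp add: is_usl_def)
  show ?thesis by unfold_locales (use assms in \<open>auto simp: is_usl_def\<close>)
qed

definition usl_isomorphic :: "'a usl \<Rightarrow> 'b usl \<Rightarrow> bool" where
  "usl_isomorphic L M \<longleftrightarrow>
     (\<exists>h. bij_betw h (carrier L) (carrier M) \<and>
        (\<forall>x\<in>carrier L. \<forall>y\<in>carrier L.
           (x \<sqsubseteq>\<^bsub>L\<^esub> y \<longleftrightarrow> h x \<sqsubseteq>\<^bsub>M\<^esub> h y) \<and> h (vee L x y) = vee M (h x) (h y)))"

definition usl_nontrivial :: "'a usl \<Rightarrow> bool" where
  "usl_nontrivial L \<longleftrightarrow> (\<exists>x\<in>carrier L. \<exists>y\<in>carrier L. x \<noteq> y)"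

definition num_equiv_rel :: "nat \<Rightarrow> nat set set \<Rightarrow> (numbering \<times> numbering) set" where
  "num_equiv_rel k S =
     {(\<nu>, \<mu>). \<nu> \<in> Pi1_numberings k S \<and> \<mu> \<in> Pi1_numberings k S \<and> num_equiv \<nu> \<mu>}"

definition Rogers :: "nat \<Rightarrow> nat set set \<Rightarrow> numbering set usl" where
  "Rogers k S =
     \<lparr> carrier = Pi1_numberings k S // num_equiv_rel k S,
       eq = (=),
       le = (\<lambda>A B. \<exists>\<nu>\<in>A. \<exists>\<mu>\<in>B. num_reducible \<nu> \<mu>),
       vee = (\<lambda>A B. \<Union>\<nu>\<in>A. \<Union>\<mu>\<in>B. num_equiv_rel k S `` {num_sum \<nu> \<mu>}) \<rparr>"

definition Rogers_Pi1_semilattice :: "nat \<Rightarrow> 'a usl \<Rightarrow> bool" where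
  "Rogers_Pi1_semilattice k L \<longleftrightarrow>
     is_usl L \<and> (\<exists>S. Pi1_computable_family k S \<and> usl_isomorphic L (Rogers k S))"

end

theory Submission
  imports Defs
begin

text \<open>
  For \<open>\<Pi>\<^sup>1\<^sub>n\<close>-computable numberings \<open>\<sigma> \<le> \<tau>\<close> of the same family, every numbering between them is \<open>\<tau> \<circ> f\<close>
  with \<open>f\<close> computable, so the interval is presented by indices of computable functions, and its
  order is first-order definable from a universal \<open>\<Pi>\<^sup>1\<^sub>n\<close> relation, hence \<open>\<Delta>\<^sup>1\<^sub>m\<close> for \<open>m > n\<close>, uniformly in \<open>\<sigma>\<close> and \<open>\<tau>\<close>.

  Say that an interval codes \<open>i\<close> if some atom \<open>a\<close> over its least element \<open>0\<close> has exactly \<open>i + 1\<close> upper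
  covers \<open>b\<close> (up to equivalence) below which there are only \<open>0\<close>, \<open>a\<close> and \<open>b\<close>. By diagonalisation there is a \<open>\<Delta>\<^sup>1\<^sub>m\<close> set
  \<open>Y\<close> which is not the set of numbers coded by any interval of a \<open>\<Pi>\<^sup>1\<^sub>n\<close> Rogers semilattice. On the
  other hand, if a \<open>\<Pi>\<^sup>1\<^sub>m\<close>-computable family has two different members \<open>A\<close> and \<open>B\<close>, every \<open>\<Delta>\<^sup>1\<^sub>m\<close> set \<open>Y\<close> is the set
  of numbers coded by one of its intervals. Each \<open>i \<in> Y\<close> contributes an atom, given by a sparse set
  \<open>C\<close> of numbers coloured \<open>A\<close> in a sea of \<open>B\<close>, and \<open>i + 1\<close> covers, in which each \<open>x \<in> C\<close> is replaced by infinitely many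
  copies all coloured \<open>A\<close> except one. The elements of \<open>C\<close> and the exceptional copies are chosen in a
  decreasing sequence of infinite computable sets and outside an increasing sequence of computably
  enumerable sets which settle, for one computable function after the other, whether its range meets
  almost no element of \<open>C\<close>, only non-exceptional copies, or all relevant copies; this makes the
  elements of the interval atoms and covers. Fast growth and a diagonal choice of the exceptional
  copies prevent unwanted reductions.
\<close>

section \<open>Recursive functionals\<close>

\<comment> \<open>Intervals are compared, not whole semilattices, because an interval is fixed by
  two numbers: a code of its top and an index of a reduction of its bottom to that top. A diagonal
  over such pairs is therefore a set of numbers. On the coding side only the selector of colours has
  to be \<Delta>^1_m: composed with the given \<Pi>^1_m-computable numbering it gives a
  \<Pi>^1_m-computable one. So each step of the construction may take the least solution of a
  \<Delta>^1_1 condition on indices, and no priority argument arises. The obstacle is that nothing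
  is known about \<open>A\<close> and \<open>B\<close> except that they differ, while every
  numbering of the interval must contain the whole family. The family items have uncontrolled
  colours and could help a reduction by accident. A reduction at element number \<open>p\<close> can
  usefully reach only items at fewer than \<open>p + 1\<close> places, so \<open>p + 2\<close>
  candidates for the exceptional copy force a collision. To have that many, \<open>x\<close> starts
  with \<open>2 ^ x\<close> candidates and every requirement leaves at least a fixed fraction of
  them.\<close>
inductive_simps eval_Zero_iff: "eval F Zero xs y"
  and eval_Succ_iff: "eval F Succ xs y"
  and eval_Proj_iff: "eval F (Proj i) xs y"
  and eval_Oracle_iff: "eval F (Oracle i) xs y"
  and eval_Comp_iff: "eval F (Comp f gs) xs y"
  and eval_PrimRec_0_iff: "eval F (PrimRec g h) (0 # xs) y"
  and eval_PrimRec_Suc_iff: "eval F (PrimRec g h) (Suc n # xs) y"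
  and eval_PrimRec_Nil_iff: "eval F (PrimRec g h) [] y"
  and eval_Mu_iff: "eval F (Mu f) xs y"

lemma eval_projs:
  "set is \<subseteq> {..<length xs} \<Longrightarrow>
    list_all2 (\<lambda>g z. eval F g xs z) (map Proj is) (map (\<lambda>i. xs ! i) is)"
  by (induction "is") (auto intro: eval_Proj)

lemma map_nth_slice:
  assumes "a = length us" "b = a + length xs"
  shows "map (\<lambda>i. (us @ xs @ ws) ! i) [a..<b] = xs"
  using assms by (auto intro!: nth_equalityI simp: nth_append)

lemma eval_Comp_projs:
  assumes "eval F e (map (\<lambda>i. xs ! i) is) y" "set is \<subseteq> {..<length xs}"
  shows "eval F (Comp e (map Proj is)) xs y"
  using assms eval_projs eval_Comp by blast

text \<open>A missing oracle can only make a computation diverge, so a halting computation is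
  unaffected by additional oracles at the end of the list.\<close>

lemma eval_oracle_append: "eval F e xs y \<Longrightarrow> eval (F @ G) e xs y"
proof (induction rule: eval.induct)
  case (eval_Oracle i x)
  then show ?case
    using eval.eval_Oracle[of i "F @ G" x] by (simp add: nth_append)
next
  case (eval_Comp xs gs zs f y)
  from eval_Comp.IH(1) have "list_all2 (\<lambda>g z. eval (F @ G) g xs z) gs zs"
    by (rule list_all2_mono) simp
  with eval_Comp.IH(2) show ?case by (blast intro: eval.eval_Comp)
next
  case (eval_Mu f n xs)
  then show ?case by (blast intro: eval.eval_Mu)
qed (blast intro: eval.intros)+

text \<open>
  Relativised substitution: the \<open>p0\<close> oracles of \<open>e\<close> are themselves computed from other oracles
  and from \<open>Q\<close> number parameters, which are passed in front of the arguments.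
\<close>

lemma eval_subst_oracles:
  assumes \<theta>: "\<And>i. i < p0 \<Longrightarrow> \<exists>e. \<forall>\<Phi> \<rho> x. eval (map \<Phi> [0..<P]) e (x # map \<rho> [0..<Q]) (\<theta> \<Phi> \<rho> i x)"
  shows "\<exists>e'. \<forall>\<Phi> \<rho> ys y. length ys = r \<longrightarrow> eval (map (\<theta> \<Phi> \<rho>) [0..<p0]) e ys y \<longrightarrow>
    eval (map \<Phi> [0..<P]) e' (map \<rho> [0..<Q] @ ys) y"
proof (induction e arbitrary: r)
  case Zero
  show ?case by (rule exI[of _ Zero]) (simp add: eval_Zero_iff)
next
  case Succ
  have "eval F (Comp Succ [Proj Q]) (map \<rho> [0..<Q] @ [x]) (Suc x)" for F :: "(nat \<Rightarrow> nat) list" and \<rho> x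
  proof -
    have "eval F (Proj Q) (map \<rho> [0..<Q] @ [x]) x"
      using eval_Proj[of Q "map \<rho> [0..<Q] @ [x]" F] by (simp add: nth_append)
    then show ?thesis by (auto simp: eval_Comp_iff eval_Succ_iff intro!: exI[of _ "[x]"])
  qed
  then show ?case by (auto simp: eval_Succ_iff intro!: exI[of _ "Comp Succ [Proj Q]"])
next
  case (Proj i)
  show ?case by (rule exI[of _ "Proj (Q + i)"]) (auto simp: eval_Proj_iff nth_append)
next
  case (Oracle i)
  show ?case
  proof (cases "i < p0")
    case True
    then obtain e where e: "\<And>\<Phi> \<rho> x. eval (map \<Phi> [0..<P]) e (x # map \<rho> [0..<Q]) (\<theta> \<Phi> \<rho> i x)"
      using \<theta> by blast
    have "eval (map \<Phi> [0..<P]) (Comp e (map Proj (Q # [0..<Q]))) (map \<rho> [0..<Q] @ [x]) (\<theta> \<Phi> \<rho> i x)"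
      for \<Phi> \<rho> x
    proof (rule eval_Comp_projs)
      have "map (\<lambda>i. (map \<rho> [0..<Q] @ [x]) ! i) (Q # [0..<Q]) = x # map \<rho> [0..<Q]"
        by (auto simp: nth_append)
      then show "eval (map \<Phi> [0..<P]) e (map (\<lambda>i. (map \<rho> [0..<Q] @ [x]) ! i) (Q # [0..<Q])) (\<theta> \<Phi> \<rho> i x)"
        using e by (simp only:)
    qed auto
    then show ?thesis
      by (intro exI[of _ "Comp e (map Proj (Q # [0..<Q]))"]) (auto simp: eval_Oracle_iff)
  qed (auto simp: eval_Oracle_iff)
next
  case (Comp f gs)
  have "\<forall>g\<in>set gs. \<exists>e'. \<forall>\<Phi> \<rho> ys y. length ys = r \<longrightarrow> eval (map (\<theta> \<Phi> \<rho>) [0..<p0]) g ys y \<longrightarrow>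
    eval (map \<Phi> [0..<P]) e' (map \<rho> [0..<Q] @ ys) y"
    using Comp.IH(2) by blast
  then obtain T where T: "\<And>g \<Phi> \<rho> ys y. g \<in> set gs \<Longrightarrow> length ys = r \<Longrightarrow>
      eval (map (\<theta> \<Phi> \<rho>) [0..<p0]) g ys y \<Longrightarrow> eval (map \<Phi> [0..<P]) (T g) (map \<rho> [0..<Q] @ ys) y"
    unfolding bchoice_iff by blast
  obtain f' where f': "\<And>\<Phi> \<rho> ys y. length ys = length gs \<Longrightarrow> eval (map (\<theta> \<Phi> \<rho>) [0..<p0]) f ys y \<Longrightarrow>
      eval (map \<Phi> [0..<P]) f' (map \<rho> [0..<Q] @ ys) y"
    using Comp.IH(1)[of "length gs"] by blast
  show ?case
  proof (intro exI[of _ "Comp f' (map Proj [0..<Q] @ map T gs)"] allI impI)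
    fix \<Phi> \<rho> ys y
    assume len: "length ys = r" and "eval (map (\<theta> \<Phi> \<rho>) [0..<p0]) (Comp f gs) ys y"
    then obtain zs where zs: "list_all2 (\<lambda>g z. eval (map (\<theta> \<Phi> \<rho>) [0..<p0]) g ys z) gs zs"
        "eval (map (\<theta> \<Phi> \<rho>) [0..<p0]) f zs y"
      by (auto simp: eval_Comp_iff)
    have "list_all2 (\<lambda>g z. eval (map \<Phi> [0..<P]) g (map \<rho> [0..<Q] @ ys) z) (map T gs) zs"
      using zs(1) T[OF _ len] by (auto simp: list_all2_conv_all_nth)
    moreover have "list_all2 (\<lambda>g z. eval (map \<Phi> [0..<P]) g (map \<rho> [0..<Q] @ ys) z)
        (map Proj [0..<Q]) (map \<rho> [0..<Q])"
      by (auto simp: list_all2_conv_all_nth eval_Proj_iff nth_append)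
    ultimately have "list_all2 (\<lambda>g z. eval (map \<Phi> [0..<P]) g (map \<rho> [0..<Q] @ ys) z)
        (map Proj [0..<Q] @ map T gs) (map \<rho> [0..<Q] @ zs)"
      by (rule list_all2_appendI[rotated])
    moreover have "eval (map \<Phi> [0..<P]) f' (map \<rho> [0..<Q] @ zs) y"
      using f'[OF _ zs(2)] list_all2_lengthD[OF zs(1)] by simp
    ultimately show "eval (map \<Phi> [0..<P]) (Comp f' (map Proj [0..<Q] @ map T gs)) (map \<rho> [0..<Q] @ ys) y"
      by (rule eval_Comp)
  qed
next
  case (PrimRec g h)
  show ?case
  proof (cases r)
    case 0
    then show ?thesis by (auto simp: eval_PrimRec_Nil_iff)
  next
    case (Suc s)
    obtain g' where g': "\<And>\<Phi> \<rho> ys y. length ys = s \<Longrightarrow> eval (map (\<theta> \<Phi> \<rho>) [0..<p0]) g ys y \<Longrightarrow>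
      eval (map \<Phi> [0..<P]) g' (map \<rho> [0..<Q] @ ys) y"
      using PrimRec.IH(1)[of s] by blast
    obtain h' where h': "\<And>\<Phi> \<rho> ys y. length ys = Suc (Suc s) \<Longrightarrow>
        eval (map (\<theta> \<Phi> \<rho>) [0..<p0]) h ys y \<Longrightarrow> eval (map \<Phi> [0..<P]) h' (map \<rho> [0..<Q] @ ys) y"
      using PrimRec.IH(2)[of "Suc (Suc s)"] by blast
    \<comment> \<open>\<open>PrimRec\<close> puts the recursion argument and the previous value in
      front, whereas the translated programs expect the parameters first; \<open>h2\<close> and
      \<open>e'\<close> only permute arguments.\<close>
    define h2 where "h2 = Comp h' (map Proj ([2..<Q+2] @ [0,1] @ [Q+2..<Q+2+s]))"
    define e' where "e' = Comp (PrimRec g' h2) (map Proj (Q # [0..<Q] @ [Suc Q..<Suc Q+s]))"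
    have rec: "eval (map \<Phi> [0..<P]) (PrimRec g' h2) (n # map \<rho> [0..<Q] @ ys) y"
      if "length ys = s" "eval (map (\<theta> \<Phi> \<rho>) [0..<p0]) (PrimRec g h) (n # ys) y" for \<Phi> \<rho> n ys y
      using that(2)
    proof (induction n arbitrary: y)
      case 0
      then show ?case using g' that(1) by (auto simp: eval_PrimRec_0_iff)
    next
      case (Suc n)
      then obtain z where z: "eval (map (\<theta> \<Phi> \<rho>) [0..<p0]) (PrimRec g h) (n # ys) z"
        "eval (map (\<theta> \<Phi> \<rho>) [0..<p0]) h (n # z # ys) y"
        by (auto simp: eval_PrimRec_Suc_iff)
      have "eval (map \<Phi> [0..<P]) h2 (n # z # map \<rho> [0..<Q] @ ys) y"
        unfolding h2_def
      proof (rule eval_Comp_projs)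
        have "map (\<lambda>i. (n # z # map \<rho> [0..<Q] @ ys) ! i) ([2..<Q + 2] @ [0, 1] @ [Q + 2..<Q + 2 + s])
           = map \<rho> [0..<Q] @ n # z # ys"
          using map_nth_slice[of 2 "[n, z]" "Q + 2" "map \<rho> [0..<Q]" ys]
            map_nth_slice[of "Q + 2" "[n, z] @ map \<rho> [0..<Q]" "Q + 2 + s" ys "[]"] that(1)
          by simp
        then show "eval (map \<Phi> [0..<P]) h' (map (\<lambda>i. (n # z # map \<rho> [0..<Q] @ ys) ! i)
            ([2..<Q + 2] @ [0, 1] @ [Q + 2..<Q + 2 + s])) y"
          using h'[OF _ z(2)] that(1) by (simp only: length_Cons)
      qed (use that(1) in auto)
      with Suc.IH[OF z(1)] show ?case by (auto simp: eval_PrimRec_Suc_iff)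
    qed
    show ?thesis
    proof (intro exI[of _ e'] allI impI)
      fix \<Phi> \<rho> ys y
      assume "length ys = r" and ev: "eval (map (\<theta> \<Phi> \<rho>) [0..<p0]) (PrimRec g h) ys y"
      then obtain n zs where ys: "ys = n # zs" "length zs = s"
        using Suc by (cases ys) auto
      have "map (\<lambda>i. (map \<rho> [0..<Q] @ n # zs) ! i) (Q # [0..<Q] @ [Suc Q..<Suc Q+s])
         = n # map \<rho> [0..<Q] @ zs"
        using map_nth_slice[of 0 "[]" Q "map \<rho> [0..<Q]" "n # zs"]
          map_nth_slice[of "Suc Q" "map \<rho> [0..<Q] @ [n]" "Suc Q + s" zs "[]"] ys(2)
        by (simp add: nth_append)
      then show "eval (map \<Phi> [0..<P]) e' (map \<rho> [0..<Q] @ ys) y"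
        unfolding e'_def ys(1) using rec[OF ys(2)] ev ys
        by (intro eval_Comp_projs) (simp only:, auto)
    qed
  qed
next
  case (Mu f)
  obtain f' where f': "\<And>\<Phi> \<rho> ys y. length ys = Suc r \<Longrightarrow> eval (map (\<theta> \<Phi> \<rho>) [0..<p0]) f ys y \<Longrightarrow>
      eval (map \<Phi> [0..<P]) f' (map \<rho> [0..<Q] @ ys) y"
    using Mu.IH[of "Suc r"] by blast
  define f2 where "f2 = Comp f' (map Proj ([1..<Suc Q] @ [0] @ [Suc Q..<Suc Q + r]))"
  have f2: "eval (map \<Phi> [0..<P]) f2 (n # map \<rho> [0..<Q] @ ys) y"
    if "length ys = r" "eval (map (\<theta> \<Phi> \<rho>) [0..<p0]) f (n # ys) y" for \<Phi> \<rho> n ys y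
    unfolding f2_def
  proof (rule eval_Comp_projs)
    have "map (\<lambda>i. (n # map \<rho> [0..<Q] @ ys) ! i) ([1..<Suc Q] @ [0] @ [Suc Q..<Suc Q + r])
       = map \<rho> [0..<Q] @ n # ys"
      using map_nth_slice[of 1 "[n]" "Suc Q" "map \<rho> [0..<Q]" ys]
        map_nth_slice[of "Suc Q" "[n] @ map \<rho> [0..<Q]" "Suc Q + r" ys "[]"] that(1)
      by simp
    then show "eval (map \<Phi> [0..<P]) f' (map (\<lambda>i. (n # map \<rho> [0..<Q] @ ys) ! i)
         ([1..<Suc Q] @ [0] @ [Suc Q..<Suc Q + r])) y"
      using f'[OF _ that(2)] that(1) by (simp only: length_Cons)
  qed (use that(1) in auto)
  show ?case
  proof (intro exI[of _ "Mu f2"] allI impI)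
    fix \<Phi> \<rho> ys y
    assume len: "length ys = r" and "eval (map (\<theta> \<Phi> \<rho>) [0..<p0]) (Mu f) ys y"
    then have y: "eval (map (\<theta> \<Phi> \<rho>) [0..<p0]) f (y # ys) 0"
      "\<forall>i<y. \<exists>v. eval (map (\<theta> \<Phi> \<rho>) [0..<p0]) f (i # ys) (Suc v)"
      by (auto simp: eval_Mu_iff)
    then show "eval (map \<Phi> [0..<P]) (Mu f2) (map \<rho> [0..<Q] @ ys) y"
      using f2[OF len] by (intro eval_Mu) blast+
  qed
qed

text \<open>
  Relations are handled as predicates of an environment: \<open>\<Phi> i\<close> is the \<open>i\<close>-th function variable and
  \<open>\<rho> i\<close> the \<open>i\<close>-th number variable; a quantifier binds variable \<open>0\<close> and shifts the others.
\<close>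

definition recfun :: "((nat \<Rightarrow> nat \<Rightarrow> nat) \<Rightarrow> (nat \<Rightarrow> nat) \<Rightarrow> nat) \<Rightarrow> bool" where
  "recfun t \<longleftrightarrow> (\<exists>p q e. \<forall>\<Phi> \<rho>. eval (map \<Phi> [0..<p]) e (map \<rho> [0..<q]) (t \<Phi> \<rho>))"

lemma recfunI: "(\<And>\<Phi> \<rho>. eval (map \<Phi> [0..<p]) e (map \<rho> [0..<q]) (t \<Phi> \<rho>)) \<Longrightarrow> recfun t"
  unfolding recfun_def by blast

text \<open>Programs have fixed arities; functionals that use different numbers of variables can be
  combined only after padding them to common arities.\<close>

lemma recfun_arity:
  assumes "recfun t"
  shows "\<exists>p q. \<forall>p'\<ge>p. \<forall>q'\<ge>q. \<exists>e. \<forall>\<Phi> \<rho>. eval (map \<Phi> [0..<p']) e (map \<rho> [0..<q']) (t \<Phi> \<rho>)"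
proof -
  from assms obtain p q e where e: "\<And>\<Phi> \<rho>. eval (map \<Phi> [0..<p]) e (map \<rho> [0..<q]) (t \<Phi> \<rho>)"
    unfolding recfun_def by blast
  have "eval (map \<Phi> [0..<p']) (Comp e (map Proj [0..<q])) (map \<rho> [0..<q']) (t \<Phi> \<rho>)"
    if "p' \<ge> p" "q' \<ge> q" for p' q' \<Phi> \<rho>
  proof (rule eval_Comp_projs)
    have *: "map (\<lambda>i. map \<rho> [0..<q'] ! i) [0..<q] = map \<rho> [0..<q]"
      using that by auto
    have "[0..<p'] = [0..<p] @ [p..<p']"
      using that(1) upt_add_eq_append[of 0 p "p' - p"] by simp
    then have "eval (map \<Phi> [0..<p']) e (map \<rho> [0..<q]) (t \<Phi> \<rho>)"
      using eval_oracle_append[OF e] by simp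
    with * show "eval (map \<Phi> [0..<p']) e (map (\<lambda>i. map \<rho> [0..<q'] ! i) [0..<q]) (t \<Phi> \<rho>)"
      by (simp only:)
  qed (use that in auto)
  then show ?thesis by blast
qed

lemma recfun_arity_uniform:
  fixes n :: nat
  assumes "\<And>i. i < n \<Longrightarrow> recfun (t i)"
  shows "\<exists>p q. \<forall>p'\<ge>p. \<forall>q'\<ge>q. \<forall>i<n. \<exists>e. \<forall>\<Phi> \<rho>.
    eval (map \<Phi> [0..<p']) e (map \<rho> [0..<q']) (t i \<Phi> \<rho>)"
  using assms
proof (induction n)
  case (Suc n)
  then obtain p q where 1: "\<forall>p'\<ge>p. \<forall>q'\<ge>q. \<forall>i<n. \<exists>e. \<forall>\<Phi> \<rho>.
    eval (map \<Phi> [0..<p']) e (map \<rho> [0..<q']) (t i \<Phi> \<rho>)" by (metis less_Suc_eq)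
  from recfun_arity[OF Suc.prems[of n]] obtain p2 q2 where 2: "\<forall>p'\<ge>p2. \<forall>q'\<ge>q2. \<exists>e. \<forall>\<Phi> \<rho>.
    eval (map \<Phi> [0..<p']) e (map \<rho> [0..<q']) (t n \<Phi> \<rho>)" by auto
  show ?case
    by (rule exI[of _ "max p p2"], rule exI[of _ "max q q2"]) (use 1 2 in \<open>simp add: less_Suc_eq\<close>)
qed simp

text \<open>A substituted function \<open>\<theta> \<Phi> \<rho> i\<close> is presented with its own
  argument as number variable 0 and the surrounding variables shifted by one.\<close>

lemma recfun_subst:
  assumes t: "recfun t"
    and \<tau>: "\<And>i. recfun (\<lambda>\<Phi> \<rho>. \<tau> \<Phi> \<rho> i)"
    and \<theta>: "\<And>i. recfun (\<lambda>\<Phi> \<rho>. \<theta> \<Phi> (\<lambda>i. \<rho> (Suc i)) i (\<rho> 0))"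
  shows "recfun (\<lambda>\<Phi> \<rho>. t (\<theta> \<Phi> \<rho>) (\<tau> \<Phi> \<rho>))"
proof -
  from t obtain p0 q0 e where e: "\<And>\<Phi> \<rho>. eval (map \<Phi> [0..<p0]) e (map \<rho> [0..<q0]) (t \<Phi> \<rho>)"
    unfolding recfun_def by blast
  from recfun_arity_uniform[of q0 "\<lambda>i \<Phi> \<rho>. \<tau> \<Phi> \<rho> i", OF \<tau>] obtain p1 q1 where
    1: "\<forall>p'\<ge>p1. \<forall>q'\<ge>q1. \<forall>i<q0. \<exists>e. \<forall>\<Phi> \<rho>. eval (map \<Phi> [0..<p']) e (map \<rho> [0..<q']) (\<tau> \<Phi> \<rho> i)"
    by blast
  from recfun_arity_uniform[of p0 "\<lambda>i \<Phi> \<rho>. \<theta> \<Phi> (\<lambda>i. \<rho> (Suc i)) i (\<rho> 0)", OF \<theta>] obtain p2 q2 where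
    2: "\<forall>p'\<ge>p2. \<forall>q'\<ge>q2. \<forall>i<p0. \<exists>e. \<forall>\<Phi> \<rho>.
      eval (map \<Phi> [0..<p']) e (map \<rho> [0..<q']) (\<theta> \<Phi> (\<lambda>i. \<rho> (Suc i)) i (\<rho> 0))"
    by blast
  define P where "P = max p1 p2"
  define Q where "Q = max q1 q2"
  have "\<exists>e. \<forall>\<Phi> \<rho> x. eval (map \<Phi> [0..<P]) e (x # map \<rho> [0..<Q]) (\<theta> \<Phi> \<rho> i x)" if "i < p0" for i
  proof -
    from 2[rule_format, of P "Suc Q", OF _ _ that] obtain e where
      e: "\<And>\<Phi> \<rho>. eval (map \<Phi> [0..<P]) e (map \<rho> [0..<Suc Q]) (\<theta> \<Phi> (\<lambda>i. \<rho> (Suc i)) i (\<rho> 0))"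
      unfolding P_def Q_def by (auto simp: le_max_iff_disj le_SucI)
    have "eval (map \<Phi> [0..<P]) e (x # map \<rho> [0..<Q]) (\<theta> \<Phi> \<rho> i x)" for \<Phi> \<rho> x
      using e[of \<Phi> "case_nat x \<rho>"] by (simp add: map_upt_Suc del: upt_Suc)
    then show ?thesis by blast
  qed
  from eval_subst_oracles[of p0 P Q \<theta> q0 e, OF this] obtain e' where
    e': "\<And>\<Phi> \<rho> ys y. length ys = q0 \<Longrightarrow> eval (map (\<theta> \<Phi> \<rho>) [0..<p0]) e ys y \<Longrightarrow>
      eval (map \<Phi> [0..<P]) e' (map \<rho> [0..<Q] @ ys) y" by blast
  from 1[rule_format, of P Q] have "\<forall>i\<in>{..<q0}. \<exists>e. \<forall>\<Phi> \<rho>.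
      eval (map \<Phi> [0..<P]) e (map \<rho> [0..<Q]) (\<tau> \<Phi> \<rho> i)"
    unfolding P_def Q_def by auto
  then obtain T where T: "\<And>i \<Phi> \<rho>. i < q0 \<Longrightarrow> eval (map \<Phi> [0..<P]) (T i) (map \<rho> [0..<Q]) (\<tau> \<Phi> \<rho> i)"
    unfolding bchoice_iff by blast
  show ?thesis
  proof (rule recfunI)
    fix \<Phi> \<rho>
    have "list_all2 (\<lambda>g z. eval (map \<Phi> [0..<P]) g (map \<rho> [0..<Q]) z)
        (map Proj [0..<Q] @ map T [0..<q0]) (map \<rho> [0..<Q] @ map (\<tau> \<Phi> \<rho>) [0..<q0])"
      by (rule list_all2_appendI) (auto simp: list_all2_conv_all_nth eval_Proj_iff T)
    then show "eval (map \<Phi> [0..<P]) (Comp e' (map Proj [0..<Q] @ map T [0..<q0])) (map \<rho> [0..<Q])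
        (t (\<theta> \<Phi> \<rho>) (\<tau> \<Phi> \<rho>))"
      using e'[of "map (\<tau> \<Phi> \<rho>) [0..<q0]" \<Phi> \<rho>, OF _ e] by (intro eval_Comp) auto
  qed
qed

text \<open>The way back from environments to lists: variables past the end of a list read 0, which
  a program realises by \<open>Zero\<close> in place of a projection or an oracle call.\<close>

lemma eval_padded:
  assumes "recfun t"
  shows "\<exists>e. \<forall>F xs. length F = p \<longrightarrow> length xs = q \<longrightarrow>
    eval F e xs (t (\<lambda>i. if i < length F then F ! i else (\<lambda>_. 0)) (\<lambda>i. if i < length xs then xs ! i else 0))"
proof -
  from assms obtain p0 q0 e where e: "\<And>\<Phi> \<rho>. eval (map \<Phi> [0..<p0]) e (map \<rho> [0..<q0]) (t \<Phi> \<rho>)"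
    unfolding recfun_def by blast
  define \<theta> :: "(nat \<Rightarrow> nat \<Rightarrow> nat) \<Rightarrow> (nat \<Rightarrow> nat) \<Rightarrow> nat \<Rightarrow> nat \<Rightarrow> nat"
    where "\<theta> = (\<lambda>\<Phi> \<rho> i. if i < p then \<Phi> i else (\<lambda>_. 0))"
  have "\<exists>e. \<forall>\<Phi> \<rho> x. eval (map \<Phi> [0..<p]) e (x # map \<rho> [0..<0]) (\<theta> \<Phi> \<rho> i x)" for i
    by (rule exI[of _ "if i < p then Oracle i else Zero"])
      (simp add: \<theta>_def eval_Oracle_iff eval_Zero_iff)
  from eval_subst_oracles[of p0 p 0 \<theta> q0 e, OF this] obtain e' where
    e': "\<And>\<Phi> \<rho> ys y. length ys = q0 \<Longrightarrow> eval (map (\<theta> \<Phi> \<rho>) [0..<p0]) e ys y \<Longrightarrow>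
      eval (map \<Phi> [0..<p]) e' ys y" by (simp, blast)
  define gs where "gs = map (\<lambda>i. if i < q then Proj i else Zero) [0..<q0]"
  have "eval F (Comp e' gs) xs
      (t (\<lambda>i. if i < length F then F ! i else (\<lambda>_. 0)) (\<lambda>i. if i < length xs then xs ! i else 0))"
    if len: "length F = p" "length xs = q" for F xs
  proof (rule eval_Comp)
    let ?\<Phi> = "\<lambda>i. if i < length F then F ! i else (\<lambda>_. 0)"
    let ?\<rho> = "\<lambda>i. if i < length xs then xs ! i else 0"
    show "list_all2 (\<lambda>g z. eval F g xs z) gs (map ?\<rho> [0..<q0])"
      using len by (auto simp: gs_def list_all2_conv_all_nth eval_Proj_iff eval_Zero_iff)
    have "map ?\<Phi> [0..<p] = F" using len by (auto intro: nth_equalityI)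
    moreover have "\<theta> ?\<Phi> (\<lambda>_. 0) = ?\<Phi>" using len by (auto simp: \<theta>_def)
    ultimately show "eval F e' (map ?\<rho> [0..<q0]) (t ?\<Phi> ?\<rho>)"
      using e'[of "map ?\<rho> [0..<q0]" ?\<Phi> "\<lambda>_. 0" "t ?\<Phi> ?\<rho>"] e[of ?\<Phi> ?\<rho>] by simp
  qed
  then show ?thesis by blast
qed

lemma computable_iff_recfun: "computable f \<longleftrightarrow> recfun (\<lambda>\<Phi> \<rho>. f (\<rho> 0))"
proof
  assume "computable f"
  then obtain e where "\<And>x. eval [] e [x] (f x)" unfolding computable_def by blast
  then show "recfun (\<lambda>\<Phi> \<rho>. f (\<rho> 0))"
    by (intro recfunI[of 0 e 1]) simp
next
  assume "recfun (\<lambda>\<Phi> \<rho>. f (\<rho> 0))"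
  from eval_padded[OF this, of 0 1] obtain e where
    "\<And>F xs. length F = 0 \<Longrightarrow> length xs = 1 \<Longrightarrow> eval F e xs (f (if 0 < length xs then xs ! 0 else 0))"
    by auto
  from this[of "[]" "[_]"] show "computable f" unfolding computable_def by auto
qed

lemma recfun_var: "recfun (\<lambda>\<Phi> \<rho>. \<rho> i)"
  by (rule recfunI[of 0 "Proj i" "Suc i"]) (auto simp: eval_Proj_iff simp del: upt_Suc)

lemma recfun_oracle_var: "recfun (\<lambda>\<Phi> \<rho>. \<Phi> i (\<rho> 0))"
  by (rule recfunI[of "Suc i" "Oracle i" 1])
    (auto simp: eval_Oracle_iff nth_append)

lemma recfun_subst_num:
  assumes "recfun (\<lambda>\<Phi> \<rho>. t \<Phi> \<rho>)" "\<And>i. recfun (\<lambda>\<Phi> \<rho>. \<tau> \<Phi> \<rho> i)"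
  shows "recfun (\<lambda>\<Phi> \<rho>. t \<Phi> (\<tau> \<Phi> \<rho>))"
  using recfun_subst[OF assms, of "\<lambda>\<Phi> \<rho>. \<Phi>"] recfun_oracle_var by simp

lemma recfun_let:
  assumes "recfun (\<lambda>\<Phi> \<rho>. t \<Phi> (\<rho> 0) (\<lambda>i. \<rho> (Suc i)))" "recfun s"
  shows "recfun (\<lambda>\<Phi> \<rho>. t \<Phi> (s \<Phi> \<rho>) \<rho>)"
proof -
  have "recfun (\<lambda>\<Phi> \<rho>. (case_nat (s \<Phi> \<rho>) \<rho>) i)" for i
    using assms(2) by (cases i) (simp_all add: recfun_var)
  from recfun_subst_num[OF assms(1), of "\<lambda>\<Phi> \<rho>. case_nat (s \<Phi> \<rho>) \<rho>", OF this]
  show ?thesis by simp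
qed

lemma recfun_comp1:
  assumes "recfun (\<lambda>\<Phi> \<rho>. f (\<rho> 0))" "recfun s"
  shows "recfun (\<lambda>\<Phi> \<rho>. f (s \<Phi> \<rho>))"
  using assms by (rule recfun_let)

lemma recfun_comp2:
  assumes "recfun (\<lambda>\<Phi> \<rho>. f (\<rho> 0) (\<rho> 1))" "recfun s" "recfun t"
  shows "recfun (\<lambda>\<Phi> \<rho>. f (s \<Phi> \<rho>) (t \<Phi> \<rho>))"
proof -
  have "recfun (\<lambda>\<Phi> \<rho>. (case_nat (s \<Phi> \<rho>) (\<lambda>_. t \<Phi> \<rho>)) i)" for i
    using assms(2,3) by (cases i) simp_all
  from recfun_subst_num[OF assms(1), of "\<lambda>\<Phi> \<rho>. case_nat (s \<Phi> \<rho>) (\<lambda>_. t \<Phi> \<rho>)", OF this]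
  show ?thesis by simp
qed

lemma recfun_computable: "computable f \<Longrightarrow> recfun s \<Longrightarrow> recfun (\<lambda>\<Phi> \<rho>. f (s \<Phi> \<rho>))"
  unfolding computable_iff_recfun by (rule recfun_comp1)

lemma recfun_shift: "recfun t \<Longrightarrow> recfun (\<lambda>\<Phi> \<rho>. t \<Phi> (\<lambda>i. \<rho> (Suc i)))"
  using recfun_subst_num[of t "\<lambda>\<Phi> \<rho> i. \<rho> (Suc i)"] by (simp add: recfun_var)

lemma recfun_oracle: "recfun s \<Longrightarrow> recfun (\<lambda>\<Phi> \<rho>. \<Phi> i (s \<Phi> \<rho>))"
  using recfun_let[of "\<lambda>\<Phi> x \<rho>. \<Phi> i x"] recfun_oracle_var by blast

lemma recfun_Suc: "recfun s \<Longrightarrow> recfun (\<lambda>\<Phi> \<rho>. Suc (s \<Phi> \<rho>))"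
  by (rule recfun_comp1[of Suc], rule recfunI[of 0 Succ 1]) (auto simp: eval_Succ_iff)

lemma recfun_const: "recfun (\<lambda>\<Phi> \<rho>. c)"
proof (induction c)
  case 0
  show ?case by (rule recfunI[of 0 Zero 0]) (simp add: eval_Zero_iff)
qed (rule recfun_Suc)

lemma recfun_rec:
  assumes "recfun b" "recfun (\<lambda>\<Phi> \<rho>. s \<Phi> (\<rho> 0) (\<rho> 1) (\<lambda>i. \<rho> (Suc (Suc i))))" "recfun t"
  shows "recfun (\<lambda>\<Phi> \<rho>. rec_nat (b \<Phi> \<rho>) (\<lambda>k r. s \<Phi> k r \<rho>) (t \<Phi> \<rho>))"
proof -
  from recfun_arity[OF assms(1)] recfun_arity[OF assms(2)] obtain p1 q1 p2 q2 where
    1: "\<forall>p'\<ge>p1. \<forall>q'\<ge>q1. \<exists>e. \<forall>\<Phi> \<rho>. eval (map \<Phi> [0..<p']) e (map \<rho> [0..<q']) (b \<Phi> \<rho>)" and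
    2: "\<forall>p'\<ge>p2. \<forall>q'\<ge>q2. \<exists>e. \<forall>\<Phi> \<rho>. eval (map \<Phi> [0..<p']) e (map \<rho> [0..<q'])
      (s \<Phi> (\<rho> 0) (\<rho> 1) (\<lambda>i. \<rho> (Suc (Suc i))))" by blast
  define P where "P = max p1 p2"
  define Q where "Q = max q1 q2"
  obtain g where g: "\<And>\<Phi> \<rho>. eval (map \<Phi> [0..<P]) g (map \<rho> [0..<Q]) (b \<Phi> \<rho>)"
    using 1[rule_format, of P Q] by (auto simp: P_def Q_def)
  obtain h where h: "\<And>\<Phi> \<rho>. eval (map \<Phi> [0..<P]) h (map \<rho> [0..<Suc (Suc Q)])
      (s \<Phi> (\<rho> 0) (\<rho> 1) (\<lambda>i. \<rho> (Suc (Suc i))))"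
    using 2[rule_format, of P "Suc (Suc Q)"] unfolding P_def Q_def
    by (meson le_SucI max.cobounded2)
  have h': "eval (map \<Phi> [0..<P]) h (k # r # map \<rho> [0..<Q]) (s \<Phi> k r \<rho>)" for \<Phi> k r \<rho>
    using h[of \<Phi> "case_nat k (case_nat r \<rho>)"] by (simp add: map_upt_Suc del: upt_Suc)
  have "eval (map \<Phi> [0..<P]) (PrimRec g h) (k # map \<rho> [0..<Q]) (rec_nat (b \<Phi> \<rho>) (\<lambda>k r. s \<Phi> k r \<rho>) k)"
    for \<Phi> \<rho> k
    by (induction k) (auto intro: eval_PrimRec_0 eval_PrimRec_Suc g h')
  then have "recfun (\<lambda>\<Phi> \<rho>. rec_nat (b \<Phi> (\<lambda>i. \<rho> (Suc i))) (\<lambda>k r. s \<Phi> k r (\<lambda>i. \<rho> (Suc i))) (\<rho> 0))"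
    by (intro recfunI[of P "PrimRec g h" "Suc Q"]) (simp add: map_upt_Suc del: upt_Suc)
  from recfun_let[OF this assms(3)] show ?thesis by simp
qed

lemma recfun_mu:
  assumes "recfun (\<lambda>\<Phi> \<rho>. t \<Phi> (\<rho> 0) (\<lambda>i. \<rho> (Suc i)))" and ex: "\<And>\<Phi> \<rho>. \<exists>z. t \<Phi> z \<rho> = 0"
  shows "recfun (\<lambda>\<Phi> \<rho>. LEAST z. t \<Phi> z \<rho> = 0)"
proof -
  from recfun_arity[OF assms(1)] obtain p q e where
    e: "\<And>\<Phi> \<rho>. eval (map \<Phi> [0..<p]) e (map \<rho> [0..<Suc q]) (t \<Phi> (\<rho> 0) (\<lambda>i. \<rho> (Suc i)))"
    by (meson le_SucI order_refl)
  have e': "eval (map \<Phi> [0..<p]) e (z # map \<rho> [0..<q]) (t \<Phi> z \<rho>)" for \<Phi> z \<rho>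
    using e[of \<Phi> "case_nat z \<rho>"] by (simp add: map_upt_Suc del: upt_Suc)
  show ?thesis
  proof (rule recfunI[of p "Mu e" q], rule eval_Mu)
    fix \<Phi> \<rho>
    let ?n = "LEAST z. t \<Phi> z \<rho> = 0"
    have "t \<Phi> ?n \<rho> = 0" using ex by (rule LeastI_ex)
    then show "eval (map \<Phi> [0..<p]) e (?n # map \<rho> [0..<q]) 0" using e'[of \<Phi> ?n \<rho>] by simp
    show "\<forall>i<?n. \<exists>v. eval (map \<Phi> [0..<p]) e (i # map \<rho> [0..<q]) (Suc v)"
    proof (intro allI impI)
      fix i assume "i < ?n"
      then have "t \<Phi> i \<rho> \<noteq> 0" by (rule not_less_Least)
      then show "\<exists>v. eval (map \<Phi> [0..<p]) e (i # map \<rho> [0..<q]) (Suc v)"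
        using e'[of \<Phi> i \<rho>] by (metis not0_implies_Suc)
    qed
  qed
qed

section \<open>Decidable predicates and closure of the recursive functionals\<close>

definition recpred :: "((nat \<Rightarrow> nat \<Rightarrow> nat) \<Rightarrow> (nat \<Rightarrow> nat) \<Rightarrow> bool) \<Rightarrow> bool" where
  "recpred P \<longleftrightarrow> recfun (\<lambda>\<Phi> \<rho>. of_bool (P \<Phi> \<rho>))"

lemma recfun_plus:
  assumes "recfun s" "recfun t"
  shows "recfun (\<lambda>\<Phi> \<rho>. s \<Phi> \<rho> + t \<Phi> \<rho>)"
proof -
  have "recfun (\<lambda>\<Phi> \<rho>. rec_nat (s \<Phi> \<rho>) (\<lambda>_ r. Suc r) (t \<Phi> \<rho>))"
    by (intro recfun_rec recfun_Suc recfun_var assms)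
  moreover have "rec_nat a (\<lambda>_ r. Suc r) b = a + b" for a b by (induction b) auto
  ultimately show ?thesis by simp
qed

lemma recfun_mult:
  assumes "recfun s" "recfun t"
  shows "recfun (\<lambda>\<Phi> \<rho>. s \<Phi> \<rho> * t \<Phi> \<rho>)"
proof -
  have "recfun (\<lambda>\<Phi> \<rho>. rec_nat 0 (\<lambda>_ r. r + s \<Phi> \<rho>) (t \<Phi> \<rho>))"
    by (intro recfun_rec recfun_plus recfun_var recfun_const assms recfun_shift[OF recfun_shift])
  moreover have "rec_nat 0 (\<lambda>_ r. r + a) b = a * b" for a b :: nat by (induction b) auto
  ultimately show ?thesis by simp
qed

lemma recfun_pred: "recfun r \<Longrightarrow> recfun (\<lambda>\<Phi> \<rho>. r \<Phi> \<rho> - Suc 0)"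
proof -
  assume "recfun r"
  then have "recfun (\<lambda>\<Phi> \<rho>. rec_nat 0 (\<lambda>k _. k) (r \<Phi> \<rho>))"
    by (intro recfun_rec recfun_var recfun_const)
  moreover have "rec_nat 0 (\<lambda>k _. k) a = a - Suc 0" for a by (cases a) auto
  ultimately show ?thesis by simp
qed

lemma recfun_diff:
  assumes "recfun s" "recfun t"
  shows "recfun (\<lambda>\<Phi> \<rho>. s \<Phi> \<rho> - t \<Phi> \<rho>)"
proof -
  have "recfun (\<lambda>\<Phi> \<rho>. rec_nat (s \<Phi> \<rho>) (\<lambda>_ r. r - Suc 0) (t \<Phi> \<rho>))"
    by (intro recfun_rec recfun_pred recfun_var assms)
  moreover have "rec_nat a (\<lambda>_ r. r - Suc 0) b = a - b" for a b by (induction b) auto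
  ultimately show ?thesis by simp
qed

lemma recfun_power:
  assumes "recfun s" "recfun t"
  shows "recfun (\<lambda>\<Phi> \<rho>. s \<Phi> \<rho> ^ t \<Phi> \<rho>)"
proof -
  have "recfun (\<lambda>\<Phi> \<rho>. rec_nat 1 (\<lambda>_ r. r * s \<Phi> \<rho>) (t \<Phi> \<rho>))"
    by (intro recfun_rec recfun_mult recfun_var recfun_const assms recfun_shift[OF recfun_shift])
  moreover have "rec_nat 1 (\<lambda>_ r. r * a) b = a ^ b" for a b :: nat by (induction b) auto
  ultimately show ?thesis by simp
qed

lemma recpred_not: "recpred P \<Longrightarrow> recpred (\<lambda>\<Phi> \<rho>. \<not> P \<Phi> \<rho>)"
proof -
  assume "recpred P"
  moreover have "of_bool (\<not> b) = (1::nat) - of_bool b" for b by simp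
  ultimately show ?thesis unfolding recpred_def by (simp only:, intro recfun_diff recfun_const)
qed

lemma recpred_conj: "recpred P \<Longrightarrow> recpred Q \<Longrightarrow> recpred (\<lambda>\<Phi> \<rho>. P \<Phi> \<rho> \<and> Q \<Phi> \<rho>)"
  unfolding recpred_def of_bool_conj by (rule recfun_mult)

lemma recpred_disj: "recpred P \<Longrightarrow> recpred Q \<Longrightarrow> recpred (\<lambda>\<Phi> \<rho>. P \<Phi> \<rho> \<or> Q \<Phi> \<rho>)"
  using recpred_not[OF recpred_conj[OF recpred_not recpred_not], of P Q] by simp

lemma recpred_imp: "recpred P \<Longrightarrow> recpred Q \<Longrightarrow> recpred (\<lambda>\<Phi> \<rho>. P \<Phi> \<rho> \<longrightarrow> Q \<Phi> \<rho>)"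
  unfolding imp_conv_disj by (intro recpred_disj recpred_not)

lemma recpred_le:
  assumes "recfun s" "recfun t"
  shows "recpred (\<lambda>\<Phi> \<rho>. s \<Phi> \<rho> \<le> t \<Phi> \<rho>)"
proof -
  have "recfun (\<lambda>\<Phi> \<rho>. 1 - (s \<Phi> \<rho> - t \<Phi> \<rho>))"
    by (intro recfun_diff recfun_const assms)
  moreover have "1 - (a - b) = of_bool (a \<le> b)" for a b :: nat by auto
  ultimately show ?thesis by (simp add: recpred_def)
qed

lemma recpred_less: "recfun s \<Longrightarrow> recfun t \<Longrightarrow> recpred (\<lambda>\<Phi> \<rho>. s \<Phi> \<rho> < t \<Phi> \<rho>)"
  unfolding less_eq_Suc_le by (intro recpred_le recfun_Suc)

lemma recpred_eq: "recfun s \<Longrightarrow> recfun t \<Longrightarrow> recpred (\<lambda>\<Phi> \<rho>. s \<Phi> \<rho> = t \<Phi> \<rho>)"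
  using recpred_conj[OF recpred_le[of s t] recpred_le[of t s]] by (simp add: order_eq_iff)

lemma recfun_if:
  assumes "recpred P" "recfun s" "recfun t"
  shows "recfun (\<lambda>\<Phi> \<rho>. if P \<Phi> \<rho> then s \<Phi> \<rho> else t \<Phi> \<rho>)"
proof -
  have "recfun (\<lambda>\<Phi> \<rho>. of_bool (P \<Phi> \<rho>) * s \<Phi> \<rho> + (1 - of_bool (P \<Phi> \<rho>)) * t \<Phi> \<rho>)"
    by (intro recfun_plus recfun_mult recfun_diff recfun_const assms[unfolded recpred_def])
  moreover have "of_bool b * x + (1 - of_bool b) * y = (if b then x else y)" for b and x y :: nat
    by auto
  ultimately show ?thesis by simp
qed

lemma recpred_subst_num:
  assumes "recpred (\<lambda>\<Phi> \<rho>. P \<Phi> \<rho>)" "\<And>i. recfun (\<lambda>\<Phi> \<rho>. \<tau> \<Phi> \<rho> i)"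
  shows "recpred (\<lambda>\<Phi> \<rho>. P \<Phi> (\<tau> \<Phi> \<rho>))"
  using assms unfolding recpred_def by (rule recfun_subst_num)

lemma recpred_ex_less:
  assumes "recpred (\<lambda>\<Phi> \<rho>. P \<Phi> (\<rho> 0) (\<lambda>i. \<rho> (Suc i)))" "recfun t"
  shows "recpred (\<lambda>\<Phi> \<rho>. \<exists>z<t \<Phi> \<rho>. P \<Phi> z \<rho>)"
proof -
  have "recfun (\<lambda>\<Phi> \<rho>. case_nat (\<rho> 0) (\<lambda>i. \<rho> (Suc (Suc i))) i)" for i
    by (cases i) (simp_all add: recfun_var)
  from recpred_subst_num[OF assms(1), of "\<lambda>\<Phi> \<rho>. case_nat (\<rho> 0) (\<lambda>i. \<rho> (Suc (Suc i)))", OF this]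
  have "recpred (\<lambda>\<Phi> \<rho>. P \<Phi> (\<rho> 0) (\<lambda>i. \<rho> (Suc (Suc i))))" by simp
  then have "recfun (\<lambda>\<Phi> \<rho>. rec_nat 0 (\<lambda>k r. if P \<Phi> k \<rho> then 1 else r) (t \<Phi> \<rho>))"
    by (intro recfun_rec recfun_if recfun_const recfun_var assms(2))
  moreover have "rec_nat (0::nat) (\<lambda>k r. if P \<Phi> k \<rho> then 1 else r) n = of_bool (\<exists>z<n. P \<Phi> z \<rho>)" for \<Phi> \<rho> n
    by (induction n) (auto simp: less_Suc_eq)
  ultimately show ?thesis by (simp add: recpred_def)
qed

lemma recpred_all_less:
  assumes "recpred (\<lambda>\<Phi> \<rho>. P \<Phi> (\<rho> 0) (\<lambda>i. \<rho> (Suc i)))" "recfun t"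
  shows "recpred (\<lambda>\<Phi> \<rho>. \<forall>z<t \<Phi> \<rho>. P \<Phi> z \<rho>)"
  using recpred_not[OF recpred_ex_less[OF recpred_not[OF assms(1)] assms(2)]] by simp

lemma recfun_Least:
  assumes "recpred (\<lambda>\<Phi> \<rho>. P \<Phi> (\<rho> 0) (\<lambda>i. \<rho> (Suc i)))" "\<And>\<Phi> \<rho>. \<exists>z. P \<Phi> z \<rho>"
  shows "recfun (\<lambda>\<Phi> \<rho>. LEAST z. P \<Phi> z \<rho>)"
proof -
  have "recfun (\<lambda>\<Phi> \<rho>. LEAST z. (of_bool (\<not> P \<Phi> z \<rho>) :: nat) = 0)"
    by (rule recfun_mu) (use recpred_not[OF assms(1)] assms(2) in \<open>auto simp: recpred_def\<close>)
  then show ?thesis by simp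
qed

section \<open>Pairing\<close>

abbreviation pr :: "nat \<Rightarrow> nat \<Rightarrow> nat" where "pr x y \<equiv> prod_encode (x, y)"
definition pfst :: "nat \<Rightarrow> nat" where "pfst z = fst (prod_decode z)"
definition psnd :: "nat \<Rightarrow> nat" where "psnd z = snd (prod_decode z)"

lemma pfst_pr [simp]: "pfst (pr x y) = x" and psnd_pr [simp]: "psnd (pr x y) = y"
  and pr_pfst_psnd [simp]: "pr (pfst z) (psnd z) = z"
  by (simp_all add: pfst_def psnd_def)

lemma pr_cases: obtains x y where "z = pr x y"
  by (metis pr_pfst_psnd)

lemma triangle_mono: "m \<le> n \<Longrightarrow> triangle m \<le> triangle n"
  by (induction n) (auto simp: le_Suc_eq)

lemma pr_mono: "a \<le> c \<Longrightarrow> b \<le> d \<Longrightarrow> pr a b \<le> pr c d"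
  unfolding prod_encode_def using triangle_mono[of "a + b" "c + d"] by simp

lemma pfst_le: "pfst z \<le> z" and psnd_le: "psnd z \<le> z"
  by (metis le_prod_encode_1 pr_pfst_psnd, metis le_prod_encode_2 pr_pfst_psnd)

lemma recfun_pr: "recfun s \<Longrightarrow> recfun t \<Longrightarrow> recfun (\<lambda>\<Phi> \<rho>. pr (s \<Phi> \<rho>) (t \<Phi> \<rho>))"
proof -
  assume "recfun s" "recfun t"
  then have "recfun (\<lambda>\<Phi> \<rho>. rec_nat 0 (\<lambda>k r. r + Suc k) (s \<Phi> \<rho> + t \<Phi> \<rho>) + s \<Phi> \<rho>)"
    by (intro recfun_rec recfun_plus recfun_Suc recfun_var recfun_const)
  moreover have "rec_nat 0 (\<lambda>k r. r + Suc k) n = triangle n" for n by (induction n) auto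
  ultimately show ?thesis by (simp add: prod_encode_def)
qed

lemma recfun_pfst: "recfun s \<Longrightarrow> recfun (\<lambda>\<Phi> \<rho>. pfst (s \<Phi> \<rho>))"
proof (rule recfun_comp1[of pfst])
  have ex: "\<exists>x. \<exists>y<Suc z. pr x y = z" for z
    by (metis le_imp_less_Suc pr_pfst_psnd psnd_le)
  have "recfun (\<lambda>\<Phi> \<rho>. LEAST x. \<exists>y<Suc (\<rho> 0). pr x y = \<rho> 0)"
    by (intro recfun_Least recpred_ex_less recpred_eq recfun_pr recfun_var recfun_Suc ex)
  moreover have "(LEAST x. \<exists>y<Suc z. pr x y = z) = pfst z" for z
    by (rule Least_equality) (auto intro!: exI[of _ "psnd z"] simp: le_imp_less_Suc psnd_le)
  ultimately show "recfun (\<lambda>\<Phi> \<rho>. pfst (\<rho> 0))" by (simp only:)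
qed

lemma recfun_psnd: "recfun s \<Longrightarrow> recfun (\<lambda>\<Phi> \<rho>. psnd (s \<Phi> \<rho>))"
proof (rule recfun_comp1[of psnd])
  have ex: "\<exists>y. pr (pfst z) y = z" for z
    by (metis pr_pfst_psnd)
  have "recfun (\<lambda>\<Phi> \<rho>. LEAST y. pr (pfst (\<rho> 0)) y = \<rho> 0)"
    by (intro recfun_Least recpred_eq recfun_pr recfun_pfst recfun_var ex)
  moreover have "(LEAST y. pr (pfst z) y = z) = psnd z" for z
    by (rule Least_equality) (simp, metis order_refl psnd_pr)
  ultimately show "recfun (\<lambda>\<Phi> \<rho>. psnd (\<rho> 0))" by (simp only:)
qed

lemma recfun_half: "recfun s \<Longrightarrow> recfun (\<lambda>\<Phi> \<rho>. s \<Phi> \<rho> div 2)"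
proof (rule recfun_comp1[of "\<lambda>n. n div 2"])
  have ex: "\<exists>k. n < 2 * Suc k" for n :: nat by (rule exI[of _ n]) simp
  have "recfun (\<lambda>\<Phi> \<rho>. LEAST k. \<rho> 0 < 2 * Suc k)"
    by (intro recfun_Least recpred_less recfun_mult recfun_const recfun_Suc recfun_var ex)
  moreover have "(LEAST k. n < 2 * Suc k) = n div 2" for n :: nat
    by (rule Least_equality) auto
  ultimately show "recfun (\<lambda>\<Phi> \<rho>. \<rho> 0 div 2)" by (simp only:)
qed

lemma recpred_even: "recfun s \<Longrightarrow> recpred (\<lambda>\<Phi> \<rho>. even (s \<Phi> \<rho>))"
proof -
  assume "recfun s"
  then have "recpred (\<lambda>\<Phi> \<rho>. 2 * (s \<Phi> \<rho> div 2) = s \<Phi> \<rho>)"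
    by (intro recpred_eq recfun_mult recfun_const recfun_half)
  moreover have "2 * (n div 2) = n \<longleftrightarrow> even n" for n :: nat by presburger
  ultimately show ?thesis by (simp only:)
qed

lemmas rec_intros = recfun_var recfun_const recfun_oracle recfun_Suc recfun_plus recfun_mult
  recfun_diff recfun_power recfun_if recfun_pr recfun_pfst recfun_psnd recfun_half
  recpred_not recpred_conj recpred_disj recpred_imp recpred_le recpred_less recpred_eq
  recpred_ex_less recpred_all_less recpred_even

lemma computable_comp: "computable f \<Longrightarrow> computable g \<Longrightarrow> computable (\<lambda>x. f (g x))"
  unfolding computable_iff_recfun by (rule recfun_comp1)

section \<open>The analytical hierarchy for environment predicates\<close>

type_synonym epred = "(nat \<Rightarrow> nat \<Rightarrow> nat) \<Rightarrow> (nat \<Rightarrow> nat) \<Rightarrow> bool"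

lemma recpred_subst:
  assumes "recpred P" "\<And>i. recfun (\<lambda>\<Phi> \<rho>. \<tau> \<Phi> \<rho> i)"
    "\<And>i. recfun (\<lambda>\<Phi> \<rho>. \<theta> \<Phi> (\<lambda>i. \<rho> (Suc i)) i (\<rho> 0))"
  shows "recpred (\<lambda>\<Phi> \<rho>. P (\<theta> \<Phi> \<rho>) (\<tau> \<Phi> \<rho>))"
  using recfun_subst[OF assms(1)[unfolded recpred_def], of \<tau> \<theta>] assms(2,3) by (simp add: recpred_def)

lemma recfun_case_nat:
  "recfun s \<Longrightarrow> (\<And>i. recfun (\<lambda>\<Phi> \<rho>. \<tau> \<Phi> \<rho> i)) \<Longrightarrow> recfun (\<lambda>\<Phi> \<rho>. case_nat (s \<Phi> \<rho>) (\<tau> \<Phi> \<rho>) i)"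
  by (cases i) simp_all

lemma recfun_shift_fun: "recfun t \<Longrightarrow> recfun (\<lambda>\<Phi> \<rho>. t (\<lambda>i. \<Phi> (Suc i)) \<rho>)"
  using recfun_subst[of t "\<lambda>\<Phi> \<rho>. \<rho>" "\<lambda>\<Phi> \<rho> i. \<Phi> (Suc i)"] by (simp add: recfun_var recfun_oracle)

lemma recfun_skip_one: "recfun (\<lambda>\<Phi> \<rho>. t \<Phi> (\<lambda>i. \<rho> (Suc i)) (\<rho> 0)) \<Longrightarrow>
    recfun (\<lambda>\<Phi> \<rho>. t \<Phi> (\<lambda>i. \<rho> (Suc (Suc i))) (\<rho> 0))"
  using recfun_subst_num[of "\<lambda>\<Phi> \<rho>. t \<Phi> (\<lambda>i. \<rho> (Suc i)) (\<rho> 0)"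
      "\<lambda>\<Phi> \<rho>. case_nat (\<rho> 0) (\<lambda>i. \<rho> (Suc (Suc i)))"]
  by (simp add: recfun_case_nat recfun_var)

text \<open>
  The operations below are named so that inductions over classes of predicates only meet
  first-order unification problems.
\<close>

definition esubst ::
    "epred \<Rightarrow> ((nat \<Rightarrow> nat \<Rightarrow> nat) \<Rightarrow> (nat \<Rightarrow> nat) \<Rightarrow> nat \<Rightarrow> nat \<Rightarrow> nat) \<Rightarrow>
      ((nat \<Rightarrow> nat \<Rightarrow> nat) \<Rightarrow> (nat \<Rightarrow> nat) \<Rightarrow> nat \<Rightarrow> nat) \<Rightarrow> epred" where
  "esubst P \<theta> \<tau> = (\<lambda>\<Phi> \<rho>. P (\<theta> \<Phi> \<rho>) (\<tau> \<Phi> \<rho>))"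

definition rec_subst ::
    "((nat \<Rightarrow> nat \<Rightarrow> nat) \<Rightarrow> (nat \<Rightarrow> nat) \<Rightarrow> nat \<Rightarrow> nat \<Rightarrow> nat) \<Rightarrow>
      ((nat \<Rightarrow> nat \<Rightarrow> nat) \<Rightarrow> (nat \<Rightarrow> nat) \<Rightarrow> nat \<Rightarrow> nat) \<Rightarrow> bool" where
  "rec_subst \<theta> \<tau> \<longleftrightarrow> (\<forall>i. recfun (\<lambda>\<Phi> \<rho>. \<tau> \<Phi> \<rho> i)) \<and>
    (\<forall>i. recfun (\<lambda>\<Phi> \<rho>. \<theta> \<Phi> (\<lambda>i. \<rho> (Suc i)) i (\<rho> 0)))"

definition eex :: "epred \<Rightarrow> epred" where "eex P = (\<lambda>\<Phi> \<rho>. \<exists>n. P \<Phi> (case_nat n \<rho>))"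
definition eall :: "epred \<Rightarrow> epred" where "eall P = (\<lambda>\<Phi> \<rho>. \<forall>n. P \<Phi> (case_nat n \<rho>))"
definition eexf :: "epred \<Rightarrow> epred" where "eexf P = (\<lambda>\<Phi> \<rho>. \<exists>f. P (case_nat f \<Phi>) \<rho>)"
definition eallf :: "epred \<Rightarrow> epred" where "eallf P = (\<lambda>\<Phi> \<rho>. \<forall>f. P (case_nat f \<Phi>) \<rho>)"
definition enot :: "epred \<Rightarrow> epred" where "enot P = (\<lambda>\<Phi> \<rho>. \<not> P \<Phi> \<rho>)"
definition econj :: "epred \<Rightarrow> epred \<Rightarrow> epred" where "econj P Q = (\<lambda>\<Phi> \<rho>. P \<Phi> \<rho> \<and> Q \<Phi> \<rho>)"
definition edisj :: "epred \<Rightarrow> epred \<Rightarrow> epred" where "edisj P Q = (\<lambda>\<Phi> \<rho>. P \<Phi> \<rho> \<or> Q \<Phi> \<rho>)"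

lemmas eop_defs = esubst_def eex_def eall_def eexf_def eallf_def enot_def econj_def edisj_def

lemma enot_enot [simp]: "enot (enot P) = P"
  and enot_econj: "enot (econj P Q) = edisj (enot P) (enot Q)"
  and enot_edisj: "enot (edisj P Q) = econj (enot P) (enot Q)"
  and enot_eex: "enot (eex P) = eall (enot P)"
  and enot_eall: "enot (eall P) = eex (enot P)"
  and enot_eexf: "enot (eexf P) = eallf (enot P)"
  and enot_eallf: "enot (eallf P) = eexf (enot P)"
  by (auto simp: eop_defs fun_eq_iff)

lemma esubst_eex: "esubst (eex P) \<theta> \<tau> =
    eex (esubst P (\<lambda>\<Phi> \<rho>. \<theta> \<Phi> (\<lambda>i. \<rho> (Suc i))) (\<lambda>\<Phi> \<rho>. case_nat (\<rho> 0) (\<tau> \<Phi> (\<lambda>i. \<rho> (Suc i)))))"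
  and esubst_eexf: "esubst (eexf P) \<theta> \<tau> =
    eexf (esubst P (\<lambda>\<Phi> \<rho>. case_nat (\<Phi> 0) (\<theta> (\<lambda>i. \<Phi> (Suc i)) \<rho>)) (\<lambda>\<Phi>. \<tau> (\<lambda>i. \<Phi> (Suc i))))"
  and esubst_eallf: "esubst (eallf P) \<theta> \<tau> =
    eallf (esubst P (\<lambda>\<Phi> \<rho>. case_nat (\<Phi> 0) (\<theta> (\<lambda>i. \<Phi> (Suc i)) \<rho>)) (\<lambda>\<Phi>. \<tau> (\<lambda>i. \<Phi> (Suc i))))"
  and esubst_enot: "esubst (enot P) \<theta> \<tau> = enot (esubst P \<theta> \<tau>)"
  by (simp_all add: eop_defs)

lemma rec_subst_lift:
  assumes "rec_subst \<theta> \<tau>"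
  shows "rec_subst (\<lambda>\<Phi> \<rho>. \<theta> \<Phi> (\<lambda>i. \<rho> (Suc i))) (\<lambda>\<Phi> \<rho>. case_nat (\<rho> 0) (\<tau> \<Phi> (\<lambda>i. \<rho> (Suc i))))"
    and "rec_subst (\<lambda>\<Phi> \<rho>. case_nat (\<Phi> 0) (\<theta> (\<lambda>i. \<Phi> (Suc i)) \<rho>)) (\<lambda>\<Phi>. \<tau> (\<lambda>i. \<Phi> (Suc i)))"
proof -
  have \<tau>: "recfun (\<lambda>\<Phi> \<rho>. \<tau> \<Phi> \<rho> i)" and \<theta>: "recfun (\<lambda>\<Phi> \<rho>. \<theta> \<Phi> (\<lambda>i. \<rho> (Suc i)) i (\<rho> 0))" for i
    using assms by (simp_all add: rec_subst_def)
  have 1: "recfun (\<lambda>\<Phi> \<rho>. case_nat (\<rho> 0) (\<tau> \<Phi> (\<lambda>i. \<rho> (Suc i))) i)" for i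
    using recfun_shift[OF \<tau>] by (cases i) (simp_all add: recfun_var)
  have 2: "recfun (\<lambda>\<Phi> \<rho>. \<theta> \<Phi> (\<lambda>i. \<rho> (Suc (Suc i))) i (\<rho> 0))" for i
    using recfun_skip_one[of "\<lambda>\<Phi> \<rho>. \<theta> \<Phi> \<rho> i", OF \<theta>] .
  have 3: "recfun (\<lambda>\<Phi> \<rho>. \<tau> (\<lambda>i. \<Phi> (Suc i)) \<rho> i)" for i
    by (rule recfun_shift_fun[of "\<lambda>\<Phi> \<rho>. \<tau> \<Phi> \<rho> i", OF \<tau>])
  have 4: "recfun (\<lambda>\<Phi> \<rho>. case_nat (\<Phi> 0) (\<theta> (\<lambda>i. \<Phi> (Suc i)) (\<lambda>i. \<rho> (Suc i))) i (\<rho> 0))" for i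
    using recfun_shift_fun[of "\<lambda>\<Phi> \<rho>. \<theta> \<Phi> (\<lambda>i. \<rho> (Suc i)) (i - 1) (\<rho> 0)", OF \<theta>]
    by (cases i) (simp_all add: recfun_oracle recfun_var)
  show "rec_subst (\<lambda>\<Phi> \<rho>. \<theta> \<Phi> (\<lambda>i. \<rho> (Suc i))) (\<lambda>\<Phi> \<rho>. case_nat (\<rho> 0) (\<tau> \<Phi> (\<lambda>i. \<rho> (Suc i))))"
    using 1 2 by (simp add: rec_subst_def)
  show "rec_subst (\<lambda>\<Phi> \<rho>. case_nat (\<Phi> 0) (\<theta> (\<lambda>i. \<Phi> (Suc i)) \<rho>)) (\<lambda>\<Phi>. \<tau> (\<lambda>i. \<Phi> (Suc i)))"
    using 3 4 by (simp add: rec_subst_def)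
qed

definition eshift :: "epred \<Rightarrow> epred" where "eshift P = (\<lambda>\<Phi> \<rho>. P \<Phi> (\<lambda>i. \<rho> (Suc i)))"
definition eshiftf :: "epred \<Rightarrow> epred" where "eshiftf P = (\<lambda>\<Phi> \<rho>. P (\<lambda>i. \<Phi> (Suc i)) \<rho>)"

lemma eshift_esubst: "eshift P = esubst P (\<lambda>\<Phi> \<rho>. \<Phi>) (\<lambda>\<Phi> \<rho> i. \<rho> (Suc i))"
  and eshiftf_esubst: "eshiftf P = esubst P (\<lambda>\<Phi> \<rho> i. \<Phi> (Suc i)) (\<lambda>\<Phi> \<rho>. \<rho>)"
  by (simp_all add: eshift_def eshiftf_def esubst_def)

lemma rec_subst_shift: "rec_subst (\<lambda>\<Phi> \<rho>. \<Phi>) (\<lambda>\<Phi> \<rho> i. \<rho> (Suc i))"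
  "rec_subst (\<lambda>\<Phi> \<rho> i. \<Phi> (Suc i)) (\<lambda>\<Phi> \<rho>. \<rho>)"
  by (simp_all add: rec_subst_def recfun_var recfun_oracle)

lemma recpred_esubst: "recpred P \<Longrightarrow> rec_subst \<theta> \<tau> \<Longrightarrow> recpred (esubst P \<theta> \<tau>)"
  unfolding esubst_def by (rule recpred_subst[of P \<tau> \<theta>]) (simp_all add: rec_subst_def)

lemma recpred_eop: "recpred P \<Longrightarrow> recpred (enot P)" "recpred P \<Longrightarrow> recpred Q \<Longrightarrow> recpred (econj P Q)"
  "recpred P \<Longrightarrow> recpred Q \<Longrightarrow> recpred (edisj P Q)"
  unfolding eop_defs by (rule recpred_not recpred_conj recpred_disj; assumption)+

lemma eex_econj_eshift: "eex (econj P (eshift Q)) = econj (eex P) Q" "eex (econj (eshift Q) P) = econj Q (eex P)"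
  and eex_edisj_eshift: "eex (edisj P (eshift Q)) = edisj (eex P) Q" "eex (edisj (eshift Q) P) = edisj Q (eex P)"
  by (auto simp: eop_defs eshift_def fun_eq_iff)

section \<open>Arithmetical predicates of environments\<close>

inductive arith :: "epred \<Rightarrow> bool" where
  arith_recpred: "recpred P \<Longrightarrow> arith P"
| arith_not: "arith P \<Longrightarrow> arith (enot P)"
| arith_ex: "arith P \<Longrightarrow> arith (eex P)"

lemma arith_subst: "arith P \<Longrightarrow> rec_subst \<theta> \<tau> \<Longrightarrow> arith (esubst P \<theta> \<tau>)"
proof (induction arbitrary: \<tau> \<theta> rule: arith.induct)
  case (arith_recpred P)
  then show ?case by (intro arith.arith_recpred recpred_esubst)
next
  case (arith_not P)
  then show ?case by (simp add: esubst_enot arith.arith_not)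
next
  case (arith_ex P)
  then show ?case by (simp add: esubst_eex arith.arith_ex rec_subst_lift)
qed

lemma arith_shift: "arith P \<Longrightarrow> arith (eshift P)"
  unfolding eshift_esubst by (rule arith_subst[OF _ rec_subst_shift(1)])

text \<open>Conjunction and disjunction go together because negation exchanges them. The case of a
  recursive \<open>P\<close> is split off as the base of the induction in
  \<open>arith_conj_disj\<close>; this avoids prenex forms.\<close>

lemma arith_recpred_conj_disj:
  "arith Q \<Longrightarrow> recpred P \<Longrightarrow> arith (econj P Q) \<and> arith (edisj P Q)"
proof (induction arbitrary: P rule: arith.induct)
  case (arith_recpred Q)
  then show ?case by (auto intro: arith.arith_recpred recpred_eop)
next
  case (arith_not Q)
  from arith_not.IH[OF recpred_eop(1)[OF arith_not.prems]]
  have "arith (enot (econj (enot P) Q))" "arith (enot (edisj (enot P) Q))"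
    by (auto intro: arith.arith_not)
  then show ?case by (simp add: enot_econj enot_edisj)
next
  case (arith_ex Q)
  have "recpred (eshift P)"
    unfolding eshift_esubst by (rule recpred_esubst[OF arith_ex.prems rec_subst_shift(1)])
  from arith_ex.IH[OF this]
  have "arith (eex (econj (eshift P) Q))" "arith (eex (edisj (eshift P) Q))"
    by (auto intro: arith.arith_ex)
  then show ?case by (simp add: eex_econj_eshift eex_edisj_eshift)
qed

lemma arith_conj_disj: "arith P \<Longrightarrow> arith Q \<Longrightarrow> arith (econj P Q) \<and> arith (edisj P Q)"
proof (induction arbitrary: Q rule: arith.induct)
  case (arith_recpred P)
  then show ?case by (simp add: arith_recpred_conj_disj)
next
  case (arith_not P)
  from arith_not.IH[OF arith.arith_not[OF arith_not.prems]]
  have "arith (enot (econj P (enot Q)))" "arith (enot (edisj P (enot Q)))"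
    by (auto intro: arith.arith_not)
  then show ?case by (simp add: enot_econj enot_edisj)
next
  case (arith_ex P)
  from arith_ex.IH[OF arith_shift[OF arith_ex.prems]]
  have "arith (eex (econj P (eshift Q)))" "arith (eex (edisj P (eshift Q)))"
    by (auto intro: arith.arith_ex)
  then show ?case by (simp add: eex_econj_eshift eex_edisj_eshift)
qed

section \<open>Levels of the analytical hierarchy\<close>

fun is_Sigma is_Pi :: "nat \<Rightarrow> epred \<Rightarrow> bool" where
  "is_Sigma 0 P \<longleftrightarrow> arith P"
| "is_Sigma (Suc k) P \<longleftrightarrow> (\<exists>Q. is_Pi k Q \<and> P = eexf Q)"
| "is_Pi 0 P \<longleftrightarrow> arith P"
| "is_Pi (Suc k) P \<longleftrightarrow> (\<exists>Q. is_Sigma k Q \<and> P = eallf Q)"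

lemma is_Sigma_Pi_not: "is_Sigma k P \<Longrightarrow> is_Pi k (enot P)" "is_Pi k P \<Longrightarrow> is_Sigma k (enot P)"
proof (induction k arbitrary: P)
  case (Suc k)
  {
    case 1
    then show ?case using Suc.IH(2) by (simp add: enot_eexf) (metis enot_eexf)
  next
    case 2
    then show ?case using Suc.IH(1) by (simp add: enot_eallf) (metis enot_eallf)
  }
qed (auto intro: arith_not)

lemma is_Pi_iff: "is_Pi k P \<longleftrightarrow> is_Sigma k (enot P)"
  using is_Sigma_Pi_not(1)[of k "enot P"] is_Sigma_Pi_not(2)[of k P] by auto

definition subst_closed :: "(epred \<Rightarrow> bool) \<Rightarrow> bool" where
  "subst_closed C \<longleftrightarrow> (\<forall>P \<theta> \<tau>. rec_subst \<theta> \<tau> \<longrightarrow> C P \<longrightarrow> C (esubst P \<theta> \<tau>))"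

lemma subst_closedD: "subst_closed C \<Longrightarrow> C P \<Longrightarrow> rec_subst \<theta> \<tau> \<Longrightarrow> C (esubst P \<theta> \<tau>)"
  by (simp add: subst_closed_def)

lemma subst_closed_step:
  assumes "subst_closed C"
  shows "subst_closed (\<lambda>P. \<exists>Q. C Q \<and> P = eexf Q)" "subst_closed (\<lambda>P. \<exists>Q. C Q \<and> P = eallf Q)"
  unfolding subst_closed_def
proof safe
  fix P \<theta> \<tau> Q
  assume "rec_subst \<theta> \<tau>" and Q: "C Q"
  note C = subst_closedD[of C Q, OF assms Q rec_subst_lift(2)[OF this(1)]]
  show "\<exists>Q'. C Q' \<and> esubst (eexf Q) \<theta> \<tau> = eexf Q'"
    by (rule exI, rule conjI, rule C, rule esubst_eexf)
  show "\<exists>Q'. C Q' \<and> esubst (eallf Q) \<theta> \<tau> = eallf Q'"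
    by (rule exI, rule conjI, rule C, rule esubst_eallf)
qed

lemma is_Sigma_Suc_eq: "is_Sigma (Suc k) = (\<lambda>P. \<exists>Q. is_Pi k Q \<and> P = eexf Q)"
  and is_Pi_Suc_eq: "is_Pi (Suc k) = (\<lambda>P. \<exists>Q. is_Sigma k Q \<and> P = eallf Q)"
  by (simp_all add: fun_eq_iff)

lemma subst_closed_is_Sigma_Pi: "subst_closed (is_Sigma k) \<and> subst_closed (is_Pi k)"
proof (induction k)
  case 0
  show ?case by (simp add: subst_closed_def arith_subst)
next
  case (Suc k)
  then show ?case by (simp only: is_Sigma_Suc_eq is_Pi_Suc_eq subst_closed_step)
qed

lemma is_Sigma_Pi_esubst:
  "is_Sigma k P \<Longrightarrow> rec_subst \<theta> \<tau> \<Longrightarrow> is_Sigma k (esubst P \<theta> \<tau>)"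
  "is_Pi k P \<Longrightarrow> rec_subst \<theta> \<tau> \<Longrightarrow> is_Pi k (esubst P \<theta> \<tau>)"
  using subst_closed_is_Sigma_Pi[of k] subst_closedD[of "is_Sigma k" P \<theta> \<tau>] subst_closedD[of "is_Pi k" P \<theta> \<tau>]
  by simp_all

text \<open>These substitutions read \<open>\<Phi> 0\<close> as a code of two functions, or of a
  sequence of functions whose member \<open>n\<close> is its section at \<open>n\<close>; they serve
  to contract quantifiers.\<close>

lemma rec_subst_split:
  "rec_subst (\<lambda>\<Phi> \<rho>. case_nat (\<lambda>x. pfst (\<Phi> 0 x)) (\<lambda>i. \<Phi> (Suc i))) (\<lambda>\<Phi> \<rho>. \<rho>)"
  "rec_subst (\<lambda>\<Phi> \<rho>. case_nat (\<lambda>x. psnd (\<Phi> 0 x)) (\<lambda>i. \<Phi> (Suc i))) (\<lambda>\<Phi> \<rho>. \<rho>)"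
  "rec_subst (\<lambda>\<Phi> \<rho>. case_nat (\<lambda>x. psnd (\<Phi> 0 x)) (case_nat (\<lambda>x. pfst (\<Phi> 0 x)) (\<lambda>i. \<Phi> (Suc i)))) (\<lambda>\<Phi> \<rho>. \<rho>)"
  "rec_subst (\<lambda>\<Phi> \<rho>. case_nat (\<lambda>x. \<Phi> 0 (pr (\<rho> 0) x)) (\<lambda>i. \<Phi> (Suc i))) (\<lambda>\<Phi> \<rho>. \<rho>)"
proof -
  have all_nat: "(\<forall>i. P i) \<longleftrightarrow> P 0 \<and> (\<forall>i. P (Suc i))" for P :: "nat \<Rightarrow> bool"
    by (metis not0_implies_Suc)
  show "rec_subst (\<lambda>\<Phi> \<rho>. case_nat (\<lambda>x. pfst (\<Phi> 0 x)) (\<lambda>i. \<Phi> (Suc i))) (\<lambda>\<Phi> \<rho>. \<rho>)"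
    "rec_subst (\<lambda>\<Phi> \<rho>. case_nat (\<lambda>x. psnd (\<Phi> 0 x)) (\<lambda>i. \<Phi> (Suc i))) (\<lambda>\<Phi> \<rho>. \<rho>)"
    "rec_subst (\<lambda>\<Phi> \<rho>. case_nat (\<lambda>x. \<Phi> 0 (pr (\<rho> 0) x)) (\<lambda>i. \<Phi> (Suc i))) (\<lambda>\<Phi> \<rho>. \<rho>)"
    unfolding rec_subst_def
    by (subst (2) all_nat; simp add: recfun_pfst recfun_psnd recfun_oracle recfun_var recfun_pr)+
  show "rec_subst (\<lambda>\<Phi> \<rho>. case_nat (\<lambda>x. psnd (\<Phi> 0 x)) (case_nat (\<lambda>x. pfst (\<Phi> 0 x)) (\<lambda>i. \<Phi> (Suc i)))) (\<lambda>\<Phi> \<rho>. \<rho>)"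
    unfolding rec_subst_def
    by (subst (2) all_nat, subst (2) all_nat) (simp add: recfun_pfst recfun_psnd recfun_oracle recfun_var)
qed

lemma eexf_econj: "econj (eexf P) (eexf Q) = eexf (econj
    (esubst P (\<lambda>\<Phi> \<rho>. case_nat (\<lambda>x. pfst (\<Phi> 0 x)) (\<lambda>i. \<Phi> (Suc i))) (\<lambda>\<Phi> \<rho>. \<rho>))
    (esubst Q (\<lambda>\<Phi> \<rho>. case_nat (\<lambda>x. psnd (\<Phi> 0 x)) (\<lambda>i. \<Phi> (Suc i))) (\<lambda>\<Phi> \<rho>. \<rho>)))"
proof (intro ext iffI)
  fix \<Phi> \<rho>
  assume "econj (eexf P) (eexf Q) \<Phi> \<rho>"
  then obtain f g where "P (case_nat f \<Phi>) \<rho>" "Q (case_nat g \<Phi>) \<rho>" by (auto simp: eop_defs)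
  then show "eexf (econj
    (esubst P (\<lambda>\<Phi> \<rho>. case_nat (\<lambda>x. pfst (\<Phi> 0 x)) (\<lambda>i. \<Phi> (Suc i))) (\<lambda>\<Phi> \<rho>. \<rho>))
    (esubst Q (\<lambda>\<Phi> \<rho>. case_nat (\<lambda>x. psnd (\<Phi> 0 x)) (\<lambda>i. \<Phi> (Suc i))) (\<lambda>\<Phi> \<rho>. \<rho>))) \<Phi> \<rho>"
    by (auto simp: eop_defs intro!: exI[of _ "\<lambda>x. pr (f x) (g x)"])
qed (auto simp: eop_defs)

lemma eexf_eexf: "eexf (eexf P) = eexf (esubst P
    (\<lambda>\<Phi> \<rho>. case_nat (\<lambda>x. psnd (\<Phi> 0 x)) (case_nat (\<lambda>x. pfst (\<Phi> 0 x)) (\<lambda>i. \<Phi> (Suc i)))) (\<lambda>\<Phi> \<rho>. \<rho>))"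
proof (intro ext iffI)
  fix \<Phi> \<rho>
  assume "eexf (eexf P) \<Phi> \<rho>"
  then obtain f g where "P (case_nat g (case_nat f \<Phi>)) \<rho>" by (auto simp: eop_defs)
  then show "eexf (esubst P
    (\<lambda>\<Phi> \<rho>. case_nat (\<lambda>x. psnd (\<Phi> 0 x)) (case_nat (\<lambda>x. pfst (\<Phi> 0 x)) (\<lambda>i. \<Phi> (Suc i)))) (\<lambda>\<Phi> \<rho>. \<rho>)) \<Phi> \<rho>"
    by (auto simp: eop_defs intro!: exI[of _ "\<lambda>x. pr (f x) (g x)"])
qed (auto simp: eop_defs)

text \<open>Countable choice: witnesses for all \<open>n\<close> are joined into one function, whose
  section at \<open>n\<close> is the witness for \<open>n\<close>.\<close>

lemma eall_eexf: "eall (eexf P) = eexf (eall (esubst P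
    (\<lambda>\<Phi> \<rho>. case_nat (\<lambda>x. \<Phi> 0 (pr (\<rho> 0) x)) (\<lambda>i. \<Phi> (Suc i))) (\<lambda>\<Phi> \<rho>. \<rho>)))"
proof (intro ext iffI)
  fix \<Phi> \<rho>
  assume "eall (eexf P) \<Phi> \<rho>"
  then obtain F where "\<And>n. P (case_nat (F n) \<Phi>) (case_nat n \<rho>)" unfolding eop_defs by metis
  then show "eexf (eall (esubst P
    (\<lambda>\<Phi> \<rho>. case_nat (\<lambda>x. \<Phi> 0 (pr (\<rho> 0) x)) (\<lambda>i. \<Phi> (Suc i))) (\<lambda>\<Phi> \<rho>. \<rho>))) \<Phi> \<rho>"
    by (auto simp: eop_defs intro!: exI[of _ "\<lambda>z. F (pfst z) (psnd z)"])
qed (auto simp: eop_defs)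

lemma eexf_edisj: "edisj (eexf P) (eexf Q) = eexf (edisj P Q)"
  and eex_eexf: "eex (eexf P) = eexf (eex P)"
  by (auto simp: eop_defs fun_eq_iff)

text \<open>All four closures must climb together: \<open>eex\<close> at level \<open>Suc k\<close>
  needs \<open>eex\<close> for \<open>is_Pi k\<close>, which by complement is \<open>eall\<close>
  for \<open>is_Sigma k\<close>, and conversely; likewise conjunction and disjunction.\<close>

lemma is_Sigma_closed:
  "is_Sigma k P \<Longrightarrow> is_Sigma k Q \<Longrightarrow> is_Sigma k (econj P Q)"
  "is_Sigma k P \<Longrightarrow> is_Sigma k Q \<Longrightarrow> is_Sigma k (edisj P Q)"
  "is_Sigma k P \<Longrightarrow> is_Sigma k (eex P)"
  "is_Sigma k P \<Longrightarrow> is_Sigma k (eall P)"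
proof (induction k arbitrary: P Q)
  case 0
  {
    case 1 then show ?case by (simp add: arith_conj_disj)
  next
    case 2 then show ?case by (simp add: arith_conj_disj)
  next
    case 3 then show ?case by (simp add: arith_ex)
  next
    case 4
    then have "arith (enot (eex (enot P)))" by (simp add: arith_ex arith_not)
    then show ?case by (simp add: enot_eex)
  }
next
  case (Suc k)
  have conj: "is_Pi k A \<Longrightarrow> is_Pi k B \<Longrightarrow> is_Pi k (econj A B)" for A B
    using Suc.IH(2)[of "enot A" "enot B"] by (simp add: is_Pi_iff enot_econj)
  have disj: "is_Pi k A \<Longrightarrow> is_Pi k B \<Longrightarrow> is_Pi k (edisj A B)" for A B
    using Suc.IH(1)[of "enot A" "enot B"] by (simp add: is_Pi_iff enot_edisj)
  have ex: "is_Pi k A \<Longrightarrow> is_Pi k (eex A)" for A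
    using Suc.IH(4)[of "enot A"] by (simp add: is_Pi_iff enot_eex)
  have all: "is_Pi k A \<Longrightarrow> is_Pi k (eall A)" for A
    using Suc.IH(3)[of "enot A"] by (simp add: is_Pi_iff enot_eall)
  {
    case 1
    then obtain A B where "is_Pi k A" "is_Pi k B" "P = eexf A" "Q = eexf B" by auto
    then show ?case unfolding is_Sigma.simps
      by (simp only:) (rule exI, rule conjI[OF _ eexf_econj], intro conj is_Sigma_Pi_esubst(2) rec_subst_split)
  next
    case 2
    then obtain A B where "is_Pi k A" "is_Pi k B" "P = eexf A" "Q = eexf B" by auto
    then show ?case unfolding is_Sigma.simps
      by (simp only:) (rule exI, rule conjI[OF _ eexf_edisj], intro disj)
  next
    case 3
    then obtain A where "is_Pi k A" "P = eexf A" by auto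
    then show ?case unfolding is_Sigma.simps
      by (simp only:) (rule exI, rule conjI[OF _ eex_eexf], intro ex)
  next
    case 4
    then obtain A where "is_Pi k A" "P = eexf A" by auto
    then show ?case unfolding is_Sigma.simps
      by (simp only:) (rule exI, rule conjI[OF _ eall_eexf], intro all is_Sigma_Pi_esubst(2) rec_subst_split)
  }
qed

lemma is_Pi_closed:
  "is_Pi k P \<Longrightarrow> is_Pi k Q \<Longrightarrow> is_Pi k (econj P Q)"
  "is_Pi k P \<Longrightarrow> is_Pi k Q \<Longrightarrow> is_Pi k (edisj P Q)"
  "is_Pi k P \<Longrightarrow> is_Pi k (eex P)"
  "is_Pi k P \<Longrightarrow> is_Pi k (eall P)"
  using is_Sigma_closed[of k "enot P"]
  by (simp_all add: is_Pi_iff enot_econj enot_edisj enot_eex enot_eall)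

lemma is_Sigma_eexf: "is_Sigma (Suc k) P \<Longrightarrow> is_Sigma (Suc k) (eexf P)"
proof -
  assume "is_Sigma (Suc k) P"
  then obtain A where A: "is_Pi k A" "P = eexf A" by auto
  show ?thesis unfolding is_Sigma.simps A(2)
    by (rule exI, rule conjI[OF _ eexf_eexf]) (intro A is_Sigma_Pi_esubst(2) rec_subst_split)
qed

lemma is_Pi_eallf: "is_Pi (Suc k) P \<Longrightarrow> is_Pi (Suc k) (eallf P)"
  using is_Sigma_eexf[of k "enot P"] by (simp add: is_Pi_iff enot_eallf del: is_Sigma.simps is_Pi.simps)

lemma is_Sigma_Pi_Suc: "is_Sigma k P \<Longrightarrow> is_Pi (Suc k) P" "is_Pi k P \<Longrightarrow> is_Sigma (Suc k) P"
proof -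
  have *: "P = eallf (eshiftf P)" "P = eexf (eshiftf P)" by (simp_all add: eop_defs eshiftf_def)
  show "is_Sigma k P \<Longrightarrow> is_Pi (Suc k) P" unfolding is_Pi.simps
    by (rule exI, rule conjI[OF _ *(1)])
      (simp add: eshiftf_esubst is_Sigma_Pi_esubst(1) rec_subst_shift(2))
  show "is_Pi k P \<Longrightarrow> is_Sigma (Suc k) P" unfolding is_Sigma.simps
    by (rule exI, rule conjI[OF _ *(2)])
      (simp add: eshiftf_esubst is_Sigma_Pi_esubst(2) rec_subst_shift(2))
qed

lemma is_Sigma_Pi_mono1: "is_Sigma k P \<Longrightarrow> is_Sigma (Suc k) P" "is_Pi k P \<Longrightarrow> is_Pi (Suc k) P"
proof (induction k arbitrary: P)
  case 0
  { case 1 then show ?case using is_Sigma_Pi_Suc(2)[of 0] by simp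
  next case 2 then show ?case using is_Sigma_Pi_Suc(1)[of 0] by simp }
next
  case (Suc k)
  { case 1 then show ?case using Suc.IH(2) by (metis is_Sigma.simps(2))
  next case 2 then show ?case using Suc.IH(1) by (metis is_Pi.simps(2)) }
qed

declare is_Sigma.simps [simp del] is_Pi.simps [simp del]

lemma is_Pi_conj: "is_Pi k P \<Longrightarrow> is_Pi k Q \<Longrightarrow> is_Pi k (\<lambda>\<Phi> \<rho>. P \<Phi> \<rho> \<and> Q \<Phi> \<rho>)"
  and is_Pi_disj: "is_Pi k P \<Longrightarrow> is_Pi k Q \<Longrightarrow> is_Pi k (\<lambda>\<Phi> \<rho>. P \<Phi> \<rho> \<or> Q \<Phi> \<rho>)"
  and is_Sigma_conj: "is_Sigma k P \<Longrightarrow> is_Sigma k Q \<Longrightarrow> is_Sigma k (\<lambda>\<Phi> \<rho>. P \<Phi> \<rho> \<and> Q \<Phi> \<rho>)"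
  and is_Sigma_disj: "is_Sigma k P \<Longrightarrow> is_Sigma k Q \<Longrightarrow> is_Sigma k (\<lambda>\<Phi> \<rho>. P \<Phi> \<rho> \<or> Q \<Phi> \<rho>)"
  using is_Pi_closed(1,2)[of k P Q] is_Sigma_closed(1,2)[of k P Q] by (simp_all add: econj_def edisj_def)

lemma is_Pi_all: "is_Pi k (\<lambda>\<Phi> \<rho>. R \<Phi> (\<rho> 0) (\<lambda>i. \<rho> (Suc i))) \<Longrightarrow> is_Pi k (\<lambda>\<Phi> \<rho>. \<forall>n. R \<Phi> n \<rho>)"
  and is_Pi_ex: "is_Pi k (\<lambda>\<Phi> \<rho>. R \<Phi> (\<rho> 0) (\<lambda>i. \<rho> (Suc i))) \<Longrightarrow> is_Pi k (\<lambda>\<Phi> \<rho>. \<exists>n. R \<Phi> n \<rho>)"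
  using is_Pi_closed(3,4)[of k "\<lambda>\<Phi> \<rho>. R \<Phi> (\<rho> 0) (\<lambda>i. \<rho> (Suc i))"] by (simp_all add: eall_def eex_def)

lemma is_Sigma_all: "is_Sigma k (\<lambda>\<Phi> \<rho>. R \<Phi> (\<rho> 0) (\<lambda>i. \<rho> (Suc i))) \<Longrightarrow> is_Sigma k (\<lambda>\<Phi> \<rho>. \<forall>n. R \<Phi> n \<rho>)"
  and is_Sigma_ex: "is_Sigma k (\<lambda>\<Phi> \<rho>. R \<Phi> (\<rho> 0) (\<lambda>i. \<rho> (Suc i))) \<Longrightarrow> is_Sigma k (\<lambda>\<Phi> \<rho>. \<exists>n. R \<Phi> n \<rho>)"
  using is_Sigma_closed(3,4)[of k "\<lambda>\<Phi> \<rho>. R \<Phi> (\<rho> 0) (\<lambda>i. \<rho> (Suc i))"] by (simp_all add: eall_def eex_def)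

lemma is_Sigma_exfun: "is_Sigma (Suc k) (\<lambda>\<Phi> \<rho>. P (\<Phi> 0) (\<lambda>i. \<Phi> (Suc i)) \<rho>) \<Longrightarrow>
    is_Sigma (Suc k) (\<lambda>\<Phi> \<rho>. \<exists>f. P f \<Phi> \<rho>)"
  using is_Sigma_eexf[of k "\<lambda>\<Phi> \<rho>. P (\<Phi> 0) (\<lambda>i. \<Phi> (Suc i)) \<rho>"] by (simp add: eexf_def)

lemma is_Pi_allfun: "is_Pi (Suc k) (\<lambda>\<Phi> \<rho>. P (\<Phi> 0) (\<lambda>i. \<Phi> (Suc i)) \<rho>) \<Longrightarrow>
    is_Pi (Suc k) (\<lambda>\<Phi> \<rho>. \<forall>f. P f \<Phi> \<rho>)"
  using is_Pi_eallf[of k "\<lambda>\<Phi> \<rho>. P (\<Phi> 0) (\<lambda>i. \<Phi> (Suc i)) \<rho>"] by (simp add: eallf_def)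

lemma is_Sigma_Pi_subst_num:
  assumes "\<And>i. recfun (\<lambda>\<Phi> \<rho>. \<tau> \<rho> i)"
  shows "is_Sigma k (\<lambda>\<Phi> \<rho>. P \<Phi> \<rho>) \<Longrightarrow> is_Sigma k (\<lambda>\<Phi> \<rho>. P \<Phi> (\<tau> \<rho>))"
    and "is_Pi k (\<lambda>\<Phi> \<rho>. P \<Phi> \<rho>) \<Longrightarrow> is_Pi k (\<lambda>\<Phi> \<rho>. P \<Phi> (\<tau> \<rho>))"
proof -
  have "rec_subst (\<lambda>\<Phi> \<rho>. \<Phi>) (\<lambda>\<Phi> \<rho>. \<tau> \<rho>)"
    using assms by (simp add: rec_subst_def recfun_oracle recfun_var)
  from is_Sigma_Pi_esubst[OF _ this, of k P]
  show "is_Sigma k (\<lambda>\<Phi> \<rho>. P \<Phi> \<rho>) \<Longrightarrow> is_Sigma k (\<lambda>\<Phi> \<rho>. P \<Phi> (\<tau> \<rho>))"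
    "is_Pi k (\<lambda>\<Phi> \<rho>. P \<Phi> \<rho>) \<Longrightarrow> is_Pi k (\<lambda>\<Phi> \<rho>. P \<Phi> (\<tau> \<rho>))" by (simp_all add: esubst_def)
qed

lemma is_Sigma_Pi_arith: "arith P \<Longrightarrow> is_Sigma k P \<and> is_Pi k P"
  by (induction k) (simp_all add: is_Sigma_Pi_mono1 is_Sigma.simps(1) is_Pi.simps(1))

section \<open>Delta predicates and functions with a Delta graph\<close>

definition Delta :: "nat \<Rightarrow> epred \<Rightarrow> bool" where
  "Delta k P \<longleftrightarrow> is_Sigma k P \<and> is_Pi k P"

definition Dfun :: "nat \<Rightarrow> ((nat \<Rightarrow> nat \<Rightarrow> nat) \<Rightarrow> (nat \<Rightarrow> nat) \<Rightarrow> nat) \<Rightarrow> bool" where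
  "Dfun k t \<longleftrightarrow> Delta k (\<lambda>\<Phi> \<rho>. \<rho> 0 = t \<Phi> (\<lambda>i. \<rho> (Suc i)))"

lemma Delta_recpred: "recpred P \<Longrightarrow> Delta k P"
  by (simp add: Delta_def is_Sigma_Pi_arith arith_recpred)

lemma Delta_Suc: "is_Pi k P \<Longrightarrow> Delta (Suc k) P"
  by (simp add: Delta_def is_Sigma_Pi_Suc is_Sigma_Pi_mono1)

lemma Delta_mono: "k \<le> l \<Longrightarrow> Delta k P \<Longrightarrow> Delta l P"
  by (induction rule: dec_induct) (simp_all add: Delta_def is_Sigma_Pi_mono1)

lemma Dfun_mono: "k \<le> l \<Longrightarrow> Dfun k t \<Longrightarrow> Dfun l t"
  unfolding Dfun_def by (rule Delta_mono)

lemma Delta_subst_num: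
  "(\<And>i. recfun (\<lambda>\<Phi> \<rho>. \<tau> \<rho> i)) \<Longrightarrow> Delta k (\<lambda>\<Phi> \<rho>. P \<Phi> \<rho>) \<Longrightarrow> Delta k (\<lambda>\<Phi> \<rho>. P \<Phi> (\<tau> \<rho>))"
  using is_Sigma_Pi_subst_num[of \<tau> k P] by (simp add: Delta_def)

lemma Delta_not: "Delta k P \<Longrightarrow> Delta k (\<lambda>\<Phi> \<rho>. \<not> P \<Phi> \<rho>)"
  using is_Sigma_Pi_not[of k P] by (simp add: Delta_def enot_def)

lemma Delta_conj: "Delta k P \<Longrightarrow> Delta k Q \<Longrightarrow> Delta k (\<lambda>\<Phi> \<rho>. P \<Phi> \<rho> \<and> Q \<Phi> \<rho>)"
  and Delta_disj: "Delta k P \<Longrightarrow> Delta k Q \<Longrightarrow> Delta k (\<lambda>\<Phi> \<rho>. P \<Phi> \<rho> \<or> Q \<Phi> \<rho>)"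
  by (simp_all add: Delta_def is_Pi_conj is_Pi_disj is_Sigma_conj is_Sigma_disj)

lemma Delta_imp: "Delta k P \<Longrightarrow> Delta k Q \<Longrightarrow> Delta k (\<lambda>\<Phi> \<rho>. P \<Phi> \<rho> \<longrightarrow> Q \<Phi> \<rho>)"
  unfolding imp_conv_disj by (intro Delta_disj Delta_not)

lemma Delta_iff: "Delta k P \<Longrightarrow> Delta k Q \<Longrightarrow> Delta k (\<lambda>\<Phi> \<rho>. P \<Phi> \<rho> \<longleftrightarrow> Q \<Phi> \<rho>)"
  unfolding iff_conv_conj_imp by (intro Delta_conj Delta_imp)

lemma Delta_ex: "Delta k (\<lambda>\<Phi> \<rho>. R \<Phi> (\<rho> 0) (\<lambda>i. \<rho> (Suc i))) \<Longrightarrow> Delta k (\<lambda>\<Phi> \<rho>. \<exists>n. R \<Phi> n \<rho>)"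
  and Delta_all: "Delta k (\<lambda>\<Phi> \<rho>. R \<Phi> (\<rho> 0) (\<lambda>i. \<rho> (Suc i))) \<Longrightarrow> Delta k (\<lambda>\<Phi> \<rho>. \<forall>n. R \<Phi> n \<rho>)"
  by (simp_all add: Delta_def is_Pi_all is_Pi_ex is_Sigma_all is_Sigma_ex)

lemma Delta_skip_one: "Delta k (\<lambda>\<Phi> \<rho>. P \<Phi> (\<rho> 0) (\<lambda>i. \<rho> (Suc i))) \<Longrightarrow>
    Delta k (\<lambda>\<Phi> \<rho>. P \<Phi> (\<rho> 0) (\<lambda>i. \<rho> (Suc (Suc i))))"
  using Delta_subst_num[of "\<lambda>\<rho>. case_nat (\<rho> 0) (\<lambda>i. \<rho> (Suc (Suc i)))" k "\<lambda>\<Phi> \<rho>. P \<Phi> (\<rho> 0) (\<lambda>i. \<rho> (Suc i))"]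
  by (simp add: recfun_case_nat recfun_var)

lemma Delta_swap: "Delta k (\<lambda>\<Phi> \<rho>. P \<Phi> (\<rho> 0) (\<rho> 1) (\<lambda>i. \<rho> (Suc (Suc i)))) \<Longrightarrow>
    Delta k (\<lambda>\<Phi> \<rho>. P \<Phi> (\<rho> 1) (\<rho> 0) (\<lambda>i. \<rho> (Suc (Suc i))))"
  using Delta_subst_num[of "\<lambda>\<rho>. case_nat (\<rho> 1) (case_nat (\<rho> 0) (\<lambda>i. \<rho> (Suc (Suc i))))" k
      "\<lambda>\<Phi> \<rho>. P \<Phi> (\<rho> 0) (\<rho> 1) (\<lambda>i. \<rho> (Suc (Suc i)))"]
  by (simp add: recfun_case_nat recfun_var)

text \<open>Only the graph of \<open>s\<close> is available, so its value is substituted by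
  quantifying over it; number quantifiers do not leave the class.\<close>

lemma Delta_let:
  assumes "Delta k (\<lambda>\<Phi> \<rho>. P \<Phi> (\<rho> 0) (\<lambda>i. \<rho> (Suc i)))" "Dfun k s"
  shows "Delta k (\<lambda>\<Phi> \<rho>. P \<Phi> (s \<Phi> \<rho>) \<rho>)"
proof -
  have "Delta k (\<lambda>\<Phi> \<rho>. \<exists>z. z = s \<Phi> \<rho> \<and> P \<Phi> z \<rho>)"
    by (rule Delta_ex, rule Delta_conj) (use assms in \<open>simp_all add: Dfun_def\<close>)
  then show ?thesis by simp
qed

lemma Dfun_shift: "Dfun k s \<Longrightarrow> Dfun k (\<lambda>\<Phi> \<rho>. s \<Phi> (\<lambda>i. \<rho> (Suc i)))"
  unfolding Dfun_def using Delta_skip_one[of k "\<lambda>\<Phi> x \<rho>. x = s \<Phi> \<rho>"] by simp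

lemma Dfun_let:
  assumes "Dfun k (\<lambda>\<Phi> \<rho>. t \<Phi> (\<rho> 0) (\<lambda>i. \<rho> (Suc i)))" "Dfun k s"
  shows "Dfun k (\<lambda>\<Phi> \<rho>. t \<Phi> (s \<Phi> \<rho>) \<rho>)"
proof -
  have "Delta k (\<lambda>\<Phi> \<rho>. \<rho> 1 = t \<Phi> (\<rho> 0) (\<lambda>i. \<rho> (Suc (Suc i))))"
    using Delta_swap[of k "\<lambda>\<Phi> x y \<rho>. x = t \<Phi> y \<rho>"] assms(1) by (simp add: Dfun_def)
  then show ?thesis
    using Delta_let[of k "\<lambda>\<Phi> z \<rho>. \<rho> 0 = t \<Phi> z (\<lambda>i. \<rho> (Suc i))", OF _ Dfun_shift[OF assms(2)]]
    by (simp add: Dfun_def)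
qed

lemma Dfun_recfun: "recfun t \<Longrightarrow> Dfun k t"
  unfolding Dfun_def by (intro Delta_recpred recpred_eq recfun_var recfun_shift)

lemma Dfun_comp1: "Dfun k (\<lambda>\<Phi> \<rho>. f (\<rho> 0)) \<Longrightarrow> Dfun k s \<Longrightarrow> Dfun k (\<lambda>\<Phi> \<rho>. f (s \<Phi> \<rho>))"
  by (rule Dfun_let[of k "\<lambda>\<Phi> x \<rho>. f x"])

lemma Delta_comp1: "Delta k (\<lambda>\<Phi> \<rho>. R (\<rho> 0)) \<Longrightarrow> Dfun k s \<Longrightarrow> Delta k (\<lambda>\<Phi> \<rho>. R (s \<Phi> \<rho>))"
  by (rule Delta_let[of k "\<lambda>\<Phi> x \<rho>. R x"])

lemma Delta_comp2:
  assumes "Delta k (\<lambda>\<Phi> \<rho>. R (\<rho> 0) (\<rho> 1))" "Dfun k s" "Dfun k t"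
  shows "Delta k (\<lambda>\<Phi> \<rho>. R (s \<Phi> \<rho>) (t \<Phi> \<rho>))"
proof -
  have "Delta k (\<lambda>\<Phi> \<rho>. R (\<rho> 1) (\<rho> 0))"
    using Delta_swap[of k "\<lambda>\<Phi> x y \<rho>. R x y", OF assms(1)] by simp
  from Delta_let[of k "\<lambda>\<Phi> y \<rho>. R (\<rho> 0) y", OF _ Dfun_shift[OF assms(3)]] this
  have "Delta k (\<lambda>\<Phi> \<rho>. R (\<rho> 0) (t \<Phi> (\<lambda>i. \<rho> (Suc i))))" by simp
  from Delta_let[of k "\<lambda>\<Phi> x \<rho>. R x (t \<Phi> \<rho>)", OF this assms(2)] show ?thesis .
qed

lemma Dfun_comp2:
  assumes "Dfun k (\<lambda>\<Phi> \<rho>. f (\<rho> 0) (\<rho> 1))" "Dfun k s" "Dfun k t"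
  shows "Dfun k (\<lambda>\<Phi> \<rho>. f (s \<Phi> \<rho>) (t \<Phi> \<rho>))"
proof -
  have "Delta k (\<lambda>\<Phi> \<rho>. \<rho> 0 = f (\<rho> 2) (\<rho> 1))"
    using Delta_subst_num[of "\<lambda>\<rho>. case_nat (\<rho> 0) (case_nat (\<rho> 2) (\<lambda>_. \<rho> 1))" k "\<lambda>\<Phi> \<rho>. \<rho> 0 = f (\<rho> 1) (\<rho> 2)"] assms(1)
    by (simp add: Dfun_def recfun_case_nat recfun_var numeral_2_eq_2)
  then have "Dfun k (\<lambda>\<Phi> \<rho>. f (\<rho> 1) (\<rho> 0))" by (simp add: Dfun_def numeral_2_eq_2)
  from Dfun_let[of k "\<lambda>\<Phi> y \<rho>. f (\<rho> 0) y", OF _ Dfun_shift[OF assms(3)]] this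
  have "Dfun k (\<lambda>\<Phi> \<rho>. f (\<rho> 0) (t \<Phi> (\<lambda>i. \<rho> (Suc i))))" by simp
  from Dfun_let[of k "\<lambda>\<Phi> x \<rho>. f x (t \<Phi> \<rho>)", OF this assms(2)] show ?thesis .
qed

lemma Dfun_var: "Dfun k (\<lambda>\<Phi> \<rho>. \<rho> i)" and Dfun_const: "Dfun k (\<lambda>\<Phi> \<rho>. c)"
  by (rule Dfun_recfun, rule rec_intros)+

lemma Dfun_oracle: "Dfun k s \<Longrightarrow> Dfun k (\<lambda>\<Phi> \<rho>. \<Phi> i (s \<Phi> \<rho>))"
  by (rule Dfun_let[of k "\<lambda>\<Phi> x \<rho>. \<Phi> i x"], rule Dfun_recfun, intro rec_intros)

lemma Dfun_Suc: "Dfun k s \<Longrightarrow> Dfun k (\<lambda>\<Phi> \<rho>. Suc (s \<Phi> \<rho>))"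
  and Dfun_pfst: "Dfun k s \<Longrightarrow> Dfun k (\<lambda>\<Phi> \<rho>. pfst (s \<Phi> \<rho>))"
  and Dfun_psnd: "Dfun k s \<Longrightarrow> Dfun k (\<lambda>\<Phi> \<rho>. psnd (s \<Phi> \<rho>))"
  by (rule Dfun_comp1[of k Suc] Dfun_comp1[of k pfst] Dfun_comp1[of k psnd],
      rule Dfun_recfun, intro rec_intros, assumption)+

lemma Dfun_pr: "Dfun k s \<Longrightarrow> Dfun k t \<Longrightarrow> Dfun k (\<lambda>\<Phi> \<rho>. pr (s \<Phi> \<rho>) (t \<Phi> \<rho>))"
  and Dfun_plus: "Dfun k s \<Longrightarrow> Dfun k t \<Longrightarrow> Dfun k (\<lambda>\<Phi> \<rho>. s \<Phi> \<rho> + t \<Phi> \<rho>)"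
  and Dfun_mult: "Dfun k s \<Longrightarrow> Dfun k t \<Longrightarrow> Dfun k (\<lambda>\<Phi> \<rho>. s \<Phi> \<rho> * t \<Phi> \<rho>)"
  and Dfun_diff: "Dfun k s \<Longrightarrow> Dfun k t \<Longrightarrow> Dfun k (\<lambda>\<Phi> \<rho>. s \<Phi> \<rho> - t \<Phi> \<rho>)"
  and Dfun_power: "Dfun k s \<Longrightarrow> Dfun k t \<Longrightarrow> Dfun k (\<lambda>\<Phi> \<rho>. s \<Phi> \<rho> ^ t \<Phi> \<rho>)"
  by (rule Dfun_comp2[of k pr] Dfun_comp2[of k "(+)"] Dfun_comp2[of k "(*)"] Dfun_comp2[of k "(-)"] Dfun_comp2[of k "(^)"],
      rule Dfun_recfun, intro rec_intros, assumption, assumption)+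

lemma Delta_eq: "Dfun k s \<Longrightarrow> Dfun k t \<Longrightarrow> Delta k (\<lambda>\<Phi> \<rho>. s \<Phi> \<rho> = t \<Phi> \<rho>)"
  and Delta_le: "Dfun k s \<Longrightarrow> Dfun k t \<Longrightarrow> Delta k (\<lambda>\<Phi> \<rho>. s \<Phi> \<rho> \<le> t \<Phi> \<rho>)"
  and Delta_less: "Dfun k s \<Longrightarrow> Dfun k t \<Longrightarrow> Delta k (\<lambda>\<Phi> \<rho>. s \<Phi> \<rho> < t \<Phi> \<rho>)"
  by (rule Delta_comp2[of k "(=)"] Delta_comp2[of k "(\<le>)"] Delta_comp2[of k "(<)"],
      rule Delta_recpred, intro rec_intros, assumption, assumption)+

lemma Dfun_if:
  assumes "Delta k P" "Dfun k s" "Dfun k t"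
  shows "Dfun k (\<lambda>\<Phi> \<rho>. if P \<Phi> \<rho> then s \<Phi> \<rho> else t \<Phi> \<rho>)"
proof -
  have P: "Delta k (\<lambda>\<Phi> \<rho>. P \<Phi> (\<lambda>i. \<rho> (Suc i)))"
    using Delta_subst_num[of "\<lambda>\<rho> i. \<rho> (Suc i)" k P] assms(1) by (simp add: recfun_var)
  have "Delta k (\<lambda>\<Phi> \<rho>. P \<Phi> (\<lambda>i. \<rho> (Suc i)) \<and> \<rho> 0 = s \<Phi> (\<lambda>i. \<rho> (Suc i)) \<or>
      \<not> P \<Phi> (\<lambda>i. \<rho> (Suc i)) \<and> \<rho> 0 = t \<Phi> (\<lambda>i. \<rho> (Suc i)))"
    by (intro Delta_disj Delta_conj Delta_not P assms(2,3)[unfolded Dfun_def])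
  then show ?thesis unfolding Dfun_def by (rule back_subst[of "Delta k"]) (auto simp: fun_eq_iff)
qed

lemma Dfun_Least:
  assumes "Delta k (\<lambda>\<Phi> \<rho>. P \<Phi> (\<rho> 0) (\<lambda>i. \<rho> (Suc i)))" and ex: "\<And>\<Phi> \<rho>. \<exists>z. P \<Phi> z \<rho>"
  shows "Dfun k (\<lambda>\<Phi> \<rho>. LEAST z. P \<Phi> z \<rho>)"
proof -
  have "Delta k (\<lambda>\<Phi> \<rho>. P \<Phi> (\<rho> 0) (\<lambda>i. \<rho> (Suc i)) \<and> (\<forall>z. z < \<rho> 0 \<longrightarrow> \<not> P \<Phi> z (\<lambda>i. \<rho> (Suc i))))"
    by (intro Delta_conj Delta_all Delta_imp Delta_not Delta_less Dfun_var assms(1) Delta_skip_one[OF assms(1)])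
  moreover have "n = (LEAST z. P \<Phi> z \<rho>) \<longleftrightarrow> P \<Phi> n \<rho> \<and> (\<forall>z. z < n \<longrightarrow> \<not> P \<Phi> z \<rho>)" for \<Phi> n \<rho>
    by (metis LeastI_ex ex linorder_neqE_nat not_less_Least)
  ultimately show ?thesis unfolding Dfun_def by simp
qed

lemmas D_intros = Dfun_var Dfun_const Dfun_oracle Dfun_Suc Dfun_pfst Dfun_psnd Dfun_pr Dfun_plus
  Dfun_mult Dfun_diff Dfun_power Dfun_if
  Delta_not Delta_conj Delta_disj Delta_imp Delta_iff Delta_ex Delta_all Delta_eq Delta_le Delta_less

text \<open>
  A function that is the only solution of a \<open>\<Delta>\<close> condition is itself \<open>\<Delta>\<close>: quantify over all
  solutions, existentially or universally. This covers all recursive definitions below.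
\<close>

lemma Dfun_unique_solution:
  assumes K: "Delta (Suc k) (\<lambda>\<Phi> \<rho>. K (\<Phi> 0) (\<lambda>i. \<Phi> (Suc i)))"
    and G: "\<And>\<Phi>. K (G \<Phi>) \<Phi>" and unique: "\<And>h \<Phi>. K h \<Phi> \<Longrightarrow> h = G \<Phi>"
  shows "Dfun (Suc k) (\<lambda>\<Phi> \<rho>. G \<Phi> (\<rho> 0))"
proof -
  have e: "Delta (Suc k) (\<lambda>\<Phi> \<rho>. \<rho> 0 = \<Phi> 0 (\<rho> (Suc 0)))" by (intro D_intros)
  have "is_Sigma (Suc k) (\<lambda>\<Phi> \<rho>. \<exists>h. K h \<Phi> \<and> \<rho> 0 = h (\<rho> (Suc 0)))"
    using K e by (intro is_Sigma_exfun is_Sigma_conj) (simp_all add: Delta_def)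
  moreover have "is_Pi (Suc k) (\<lambda>\<Phi> \<rho>. \<forall>h. \<not> K h \<Phi> \<or> \<rho> 0 = h (\<rho> (Suc 0)))"
    using Delta_not[OF K] e by (intro is_Pi_allfun is_Pi_disj) (simp_all add: Delta_def)
  moreover have "(\<exists>h. K h \<Phi> \<and> x = h y) \<longleftrightarrow> x = G \<Phi> y" "(\<forall>h. \<not> K h \<Phi> \<or> x = h y) \<longleftrightarrow> x = G \<Phi> y" for \<Phi> x y
    using G unique by blast+
  ultimately show ?thesis by (simp add: Dfun_def Delta_def)
qed

section \<open>Agreement with the hierarchy of list relations\<close>

definition fpad :: "(nat \<Rightarrow> nat) list \<Rightarrow> nat \<Rightarrow> nat \<Rightarrow> nat" where
  "fpad F i = (if i < length F then F ! i else (\<lambda>_. 0))"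
definition npad :: "nat list \<Rightarrow> nat \<Rightarrow> nat" where
  "npad xs i = (if i < length xs then xs ! i else 0)"

lemma fpad_Cons: "fpad (f # F) = case_nat f (fpad F)"
  and npad_Cons: "npad (x # xs) = case_nat x (npad xs)"
  by (auto simp: fun_eq_iff fpad_def npad_def split: nat.split)

definition toLists :: "epred \<Rightarrow> relation" where "toLists P = (\<lambda>F xs. P (fpad F) (npad xs))"

lemma arithmetical_toLists: "arith P \<Longrightarrow> arithmetical p q (toLists P)"
proof (induction arbitrary: q rule: arith.induct)
  case (arith_recpred P)
  from eval_padded[OF this[unfolded recpred_def], of p q] have "recursive_rel p q (toLists P)"
    by (simp add: recursive_rel_def toLists_def fpad_def[abs_def] npad_def[abs_def] of_bool_def)
  then show ?case by (rule arithmetical_recursive)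
next
  case (arith_not P)
  from arithmetical_not[OF arith_not.IH] show ?case by (simp add: toLists_def enot_def)
next
  case (arith_ex P)
  show ?case by (rule arithmetical_ex[OF arith_ex.IH]) (simp add: toLists_def eex_def npad_Cons)
qed

lemma Sigma1_Pi1_rel_toLists:
  "is_Sigma k P \<Longrightarrow> Sigma1_rel k p q (toLists P)" "is_Pi k P \<Longrightarrow> Pi1_rel k p q (toLists P)"
proof (induction k arbitrary: P p)
  case 0
  { case 1 then show ?case by (simp add: is_Sigma.simps arithmetical_toLists)
  next case 2 then show ?case by (simp add: is_Pi.simps arithmetical_toLists) }
next
  case (Suc k)
  { case 1
    then obtain Q where "is_Pi k Q" "P = eexf Q" by (auto simp: is_Sigma.simps)
    then show ?case using Suc.IH(2)[of Q "Suc p"]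
      by (auto simp: toLists_def eexf_def fpad_Cons intro!: exI[of _ "toLists Q"])
  next
    case 2
    then obtain Q where "is_Sigma k Q" "P = eallf Q" by (auto simp: is_Pi.simps)
    then show ?case using Suc.IH(1)[of Q "Suc p"]
      by (auto simp: toLists_def eallf_def fpad_Cons intro!: exI[of _ "toLists Q"]) }
qed

definition fromLists :: "nat \<Rightarrow> nat \<Rightarrow> relation \<Rightarrow> epred" where
  "fromLists p q R = (\<lambda>\<Phi> \<rho>. R (map \<Phi> [0..<p]) (map \<rho> [0..<q]))"

lemma arith_fromLists: "arithmetical p q R \<Longrightarrow> arith (fromLists p q R)"
proof (induction rule: arithmetical.induct)
  case (arithmetical_recursive p q R)
  then obtain e where "\<And>F xs. length F = p \<Longrightarrow> length xs = q \<Longrightarrow> eval F e xs (if R F xs then 1 else 0)"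
    unfolding recursive_rel_def by blast
  then have "recpred (fromLists p q R)"
    unfolding recpred_def by (intro recfunI[of p e q]) (simp add: fromLists_def of_bool_def)
  then show ?case by (rule arith_recpred)
next
  case (arithmetical_not p q R)
  from arith_not[OF arithmetical_not.IH] show ?case by (simp add: fromLists_def enot_def)
next
  case (arithmetical_ex p q Q R)
  have "fromLists p q R = eex (fromLists p (Suc q) Q)"
    using arithmetical_ex.hyps(2) by (simp add: fromLists_def eex_def map_upt_Suc del: upt_Suc)
  then show ?case using arith_ex[OF arithmetical_ex.IH] by simp
qed

lemma is_Sigma_Pi_fromLists:
  "Sigma1_rel k p q R \<Longrightarrow> is_Sigma k (fromLists p q R)" "Pi1_rel k p q R \<Longrightarrow> is_Pi k (fromLists p q R)"
proof (induction k arbitrary: R p)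
  case 0
  { case 1 then show ?case by (simp add: is_Sigma.simps arith_fromLists)
  next case 2 then show ?case by (simp add: is_Pi.simps arith_fromLists) }
next
  case (Suc k)
  { case 1
    then obtain Q where Q: "Pi1_rel k (Suc p) q Q"
      "\<And>F xs. length F = p \<Longrightarrow> length xs = q \<Longrightarrow> R F xs \<longleftrightarrow> (\<exists>f. Q (f # F) xs)" by auto
    have "fromLists p q R = eexf (fromLists (Suc p) q Q)"
      using Q(2) by (simp add: fromLists_def eexf_def map_upt_Suc del: upt_Suc)
    then show ?case using Suc.IH(2)[OF Q(1)] by (auto simp: is_Sigma.simps)
  next
    case 2
    then obtain Q where Q: "Sigma1_rel k (Suc p) q Q"
      "\<And>F xs. length F = p \<Longrightarrow> length xs = q \<Longrightarrow> R F xs \<longleftrightarrow> (\<forall>f. Q (f # F) xs)" by auto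
    have "fromLists p q R = eallf (fromLists (Suc p) q Q)"
      using Q(2) by (simp add: fromLists_def eallf_def map_upt_Suc del: upt_Suc)
    then show ?case using Suc.IH(1)[OF Q(1)] by (auto simp: is_Pi.simps) }
qed

lemma Pi1_set_iff: "Pi1_set k A \<longleftrightarrow> is_Pi k (\<lambda>\<Phi> \<rho>. \<rho> 0 \<in> A)"
proof
  assume "Pi1_set k A"
  then obtain R where "Pi1_rel k 0 1 R" "A = {x. R [] [x]}" by (auto simp: Pi1_set_def)
  then show "is_Pi k (\<lambda>\<Phi> \<rho>. \<rho> 0 \<in> A)" using is_Sigma_Pi_fromLists(2)[of k 0 1 R] by (simp add: fromLists_def)
next
  assume "is_Pi k (\<lambda>\<Phi> \<rho>. \<rho> 0 \<in> A)"
  from Sigma1_Pi1_rel_toLists(2)[OF this, of 0 1] show "Pi1_set k A"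
    by (auto simp: Pi1_set_def toLists_def npad_def intro!: exI[of _ "toLists (\<lambda>\<Phi> \<rho>. \<rho> 0 \<in> A)"])
qed

lemma Pi1_computable_iff: "Pi1_computable k \<nu> \<longleftrightarrow> is_Pi k (\<lambda>\<Phi> \<rho>. \<rho> 1 \<in> \<nu> (\<rho> 0))"
proof -
  have *: "z \<in> num_graph \<nu> \<longleftrightarrow> psnd z \<in> \<nu> (pfst z)" for z
    unfolding num_graph_def by (cases z rule: pr_cases) auto
  have 1: "is_Pi k (\<lambda>\<Phi> \<rho>. psnd (\<rho> 0) \<in> \<nu> (pfst (\<rho> 0))) \<Longrightarrow> is_Pi k (\<lambda>\<Phi> \<rho>. \<rho> 1 \<in> \<nu> (\<rho> 0))"
    using is_Sigma_Pi_subst_num(2)[of "\<lambda>\<rho> _. pr (\<rho> 0) (\<rho> 1)" k "\<lambda>\<Phi> \<rho>. psnd (\<rho> 0) \<in> \<nu> (pfst (\<rho> 0))"]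
    by (simp add: rec_intros)
  have 2: "is_Pi k (\<lambda>\<Phi> \<rho>. \<rho> 1 \<in> \<nu> (\<rho> 0)) \<Longrightarrow> is_Pi k (\<lambda>\<Phi> \<rho>. psnd (\<rho> 0) \<in> \<nu> (pfst (\<rho> 0)))"
    using is_Sigma_Pi_subst_num(2)[of "\<lambda>\<rho>. case_nat (pfst (\<rho> 0)) (\<lambda>_. psnd (\<rho> 0))" k "\<lambda>\<Phi> \<rho>. \<rho> 1 \<in> \<nu> (\<rho> 0)"]
    by (simp add: recfun_case_nat rec_intros)
  show ?thesis unfolding Pi1_computable_def Pi1_set_iff * using 1 2 by blast
qed

section \<open>Universal relations\<close>

text \<open>Arithmetic on the codes of \<open>list_encode\<close>. The empty list has code 0, and
  \<open>psnd (0 - 1) = 0\<close> makes it its own tail, so \<open>ldrop\<close> may run past the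
  end.\<close>

definition lcons :: "nat \<Rightarrow> nat \<Rightarrow> nat" where "lcons x l = Suc (pr x l)"
definition ldrop :: "nat \<Rightarrow> nat \<Rightarrow> nat" where "ldrop l k = rec_nat l (\<lambda>_ r. psnd (r - 1)) k"
definition lnth :: "nat \<Rightarrow> nat \<Rightarrow> nat" where "lnth l k = pfst (ldrop l k - 1)"
definition llen :: "nat \<Rightarrow> nat" where "llen l = (LEAST k. ldrop l k = 0)"

lemma list_decode_lcons [simp]: "list_decode (lcons x l) = x # list_decode l"
  by (simp add: lcons_def)

lemma lcons_eq_iff [simp]: "lcons x l = lcons x' l' \<longleftrightarrow> x = x' \<and> l = l'" "lcons x l \<noteq> 0"
  by (simp_all add: lcons_def)

lemma list_code_cases: obtains "l = 0" | x l' where "l = lcons x l'"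
  by (metis lcons_def not0_implies_Suc pr_pfst_psnd)

lemma list_decode_eq_Nil_iff: "list_decode l = [] \<longleftrightarrow> l = 0"
  by (cases l rule: list_code_cases) simp_all

lemma list_decode_eq_iff: "list_decode l = list_decode l' \<longleftrightarrow> l = l'"
  by (rule list_decode_eq)

lemma list_decode_ldrop: "list_decode (ldrop l k) = drop k (list_decode l)"
proof (induction k)
  case (Suc k)
  have "list_decode (psnd (r - 1)) = tl (list_decode r)" for r
  proof (cases r rule: list_code_cases)
    case 1
    have "psnd 0 = 0" using psnd_le[of 0] by simp
    with 1 show ?thesis by simp
  qed (simp add: lcons_def)
  with Suc show ?case by (simp add: ldrop_def drop_Suc tl_drop)
qed (simp add: ldrop_def)

lemma llen_eq: "llen l = length (list_decode l)"
  unfolding llen_def by (rule Least_equality) (simp_all add: list_decode_eq_Nil_iff[symmetric] list_decode_ldrop)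

lemma lnth_eq:
  assumes "k < length (list_decode l)"
  shows "lnth l k = list_decode l ! k"
proof -
  from assms obtain x l' where "ldrop l k = lcons x l'"
    by (cases "ldrop l k" rule: list_code_cases) (use list_decode_ldrop[of l k] in auto)
  with list_decode_ldrop[of l k] assms show ?thesis
    by (simp add: lnth_def lcons_def) (metis hd_drop_conv_nth list.sel(1))
qed

lemma Dfun_lcons: "Dfun k s \<Longrightarrow> Dfun k t \<Longrightarrow> Dfun k (\<lambda>\<Phi> \<rho>. lcons (s \<Phi> \<rho>) (t \<Phi> \<rho>))"
  unfolding lcons_def by (intro D_intros)

lemma recfun_ldrop: "recfun s \<Longrightarrow> recfun t \<Longrightarrow> recfun (\<lambda>\<Phi> \<rho>. ldrop (s \<Phi> \<rho>) (t \<Phi> \<rho>))"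
  unfolding ldrop_def by (intro recfun_rec rec_intros)

lemma Dfun_lnth: "Dfun k s \<Longrightarrow> Dfun k t \<Longrightarrow> Dfun k (\<lambda>\<Phi> \<rho>. lnth (s \<Phi> \<rho>) (t \<Phi> \<rho>))"
  by (rule Dfun_comp2[of k lnth]) (auto simp: lnth_def intro!: Dfun_recfun recfun_ldrop rec_intros)

lemma Dfun_llen: "Dfun k s \<Longrightarrow> Dfun k (\<lambda>\<Phi> \<rho>. llen (s \<Phi> \<rho>))"
proof (rule Dfun_comp1[of k llen])
  have "\<exists>z. ldrop l z = 0" for l
    by (rule exI[of _ "length (list_decode l)"]) (simp add: list_decode_eq_Nil_iff[symmetric] list_decode_ldrop)
  then show "Dfun k (\<lambda>\<Phi> \<rho>. llen (\<rho> 0))"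
    unfolding llen_def by (intro Dfun_recfun recfun_Least recfun_ldrop rec_intros)
qed

lemma psnd_less: "0 < pfst c \<Longrightarrow> psnd c < c"
proof (cases c rule: pr_cases)
  case (1 x y)
  assume "0 < pfst c"
  with 1 have "0 < x" by simp
  then have "y < pr x y"
    using triangle_mono[of y "x + y"] le_prod_encode_2[of y 0] by (simp add: prod_encode_def)
  with 1 show ?thesis by simp
qed

lemma list_decode_le: "x \<in> set (list_decode l) \<Longrightarrow> x \<le> l"
proof (induction l arbitrary: x rule: less_induct)
  case (less l)
  show ?case
  proof (cases l rule: list_code_cases)
    case (2 y l')
    then have "l' < l" "y \<le> l" using le_prod_encode_2[of l' y] le_prod_encode_1[of y l'] by (auto simp: lcons_def)
    with less 2 show ?thesis by fastforce
  qed (use less in simp)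
qed

lemma pfst_psnd_less: "0 < pfst c \<Longrightarrow> pfst (psnd c) < c"
  and psnd_psnd_less: "0 < pfst c \<Longrightarrow> psnd (psnd c) < c"
  using psnd_less[of c] pfst_le[of "psnd c"] psnd_le[of "psnd c"] by linarith+

lemma list_elem_less: "x \<in> set (list_decode (psnd (psnd c))) \<Longrightarrow> 0 < pfst c \<Longrightarrow> x < c"
  using list_decode_le[of x "psnd (psnd c)"] psnd_psnd_less[of c] by linarith

text \<open>Every number codes a program; tags above 5 all stand for minimisation.\<close>

function dec :: "nat \<Rightarrow> prog" where
  "dec c =
    (if pfst c = 0 then Zero
     else if pfst c = 1 then Succ
     else if pfst c = 2 then Proj (psnd c)
     else if pfst c = 3 then Oracle (psnd c)
     else if pfst c = 4 then Comp (dec (pfst (psnd c))) (map dec (list_decode (psnd (psnd c))))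
     else if pfst c = 5 then PrimRec (dec (pfst (psnd c))) (dec (psnd (psnd c)))
     else Mu (dec (psnd c)))"
  by auto
termination
  by (relation "measure id") (auto intro: psnd_less pfst_psnd_less psnd_psnd_less list_elem_less)

declare dec.simps [simp del]

lemma dec_surj: "\<exists>c. dec c = e"
proof (induction e)
  case Zero
  show ?case by (rule exI[of _ "pr 0 0"]) (simp add: dec.simps)
next
  case Succ
  show ?case by (rule exI[of _ "pr 1 0"]) (simp add: dec.simps)
next
  case (Proj i)
  show ?case by (rule exI[of _ "pr 2 i"]) (simp add: dec.simps)
next
  case (Oracle i)
  show ?case by (rule exI[of _ "pr 3 i"]) (simp add: dec.simps)
next
  case (Comp f gs)
  then obtain cf where "dec cf = f" by blast
  moreover have "\<exists>cs. map dec cs = gs"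
    using Comp.IH(2)
  proof (induction gs)
    case (Cons g gs)
    then obtain c cs where "dec c = g" "map dec cs = gs" by fastforce
    then show ?case by (intro exI[of _ "c # cs"]) simp
  qed simp
  then obtain cs where "map dec cs = gs" by blast
  ultimately show ?case by (intro exI[of _ "pr 4 (pr cf (list_encode cs))"]) (simp add: dec.simps)
next
  case (PrimRec g h)
  then obtain cg ch where "dec cg = g" "dec ch = h" by blast
  then show ?case by (intro exI[of _ "pr 5 (pr cg ch)"]) (simp add: dec.simps)
next
  case (Mu f)
  then obtain cf where "dec cf = f" by blast
  then show ?case by (intro exI[of _ "pr 6 cf"]) (simp add: dec.simps)
qed

lemma if_one_iff [simp]: "(if b then 1 else 0) = Suc 0 \<longleftrightarrow> b"
  by simp

definition orc :: "nat \<Rightarrow> (nat \<Rightarrow> nat \<Rightarrow> nat) \<Rightarrow> nat \<Rightarrow> nat \<Rightarrow> nat \<Rightarrow> bool" where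
  "orc p \<Phi> d x y \<longleftrightarrow> d < p \<and> y = \<Phi> d x"

text \<open>The number of the oracle is a number variable here, whereas a predicate can mention only
  fixed function variables. As \<open>p\<close> is fixed, a finite disjunction over the oracles does
  the job.\<close>

lemma Delta_orc:
  assumes "Dfun k s" "Dfun k t" "Dfun k u"
  shows "Delta k (\<lambda>\<Phi> \<rho>. orc p (\<lambda>i. \<Phi> (Suc i)) (s \<Phi> \<rho>) (t \<Phi> \<rho>) (u \<Phi> \<rho>))"
proof (induction p)
  case 0
  have "Delta k (\<lambda>\<Phi> \<rho>. 0 = (1::nat))" by (intro D_intros)
  then show ?case by (simp add: orc_def)
next
  case (Suc p)
  have "Delta k (\<lambda>\<Phi> \<rho>. orc p (\<lambda>i. \<Phi> (Suc i)) (s \<Phi> \<rho>) (t \<Phi> \<rho>) (u \<Phi> \<rho>) \<or>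
      s \<Phi> \<rho> = p \<and> u \<Phi> \<rho> = \<Phi> (Suc p) (t \<Phi> \<rho>))"
    by (intro Suc D_intros assms)
  then show ?case by (rule back_subst[of "Delta k"]) (auto simp: orc_def fun_eq_iff less_Suc_eq)
qed

text \<open>
  The recursion equations of \<^const>\<open>eval\<close> on codes \<open>\<langle>c, \<langle>l, y\<rangle>\<rangle>\<close>. Every premise of an evaluation rule
  concerns a smaller program or a smaller recursion argument, so the equations have a single solution.
\<close>

definition eval_clause :: "nat \<Rightarrow> (nat \<Rightarrow> nat) \<Rightarrow> (nat \<Rightarrow> nat \<Rightarrow> nat) \<Rightarrow> nat \<Rightarrow> nat \<Rightarrow> nat \<Rightarrow> bool" where
  "eval_clause p h \<Phi> c l y \<longleftrightarrow>
     pfst c = 0 \<and> y = 0 \<or>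
     pfst c = 1 \<and> (\<exists>x. l = lcons x 0 \<and> y = Suc x) \<or>
     pfst c = 2 \<and> psnd c < llen l \<and> y = lnth l (psnd c) \<or>
     pfst c = 3 \<and> (\<exists>x. l = lcons x 0 \<and> orc p \<Phi> (psnd c) x y) \<or>
     pfst c = 4 \<and> (\<exists>zs. llen zs = llen (psnd (psnd c)) \<and>
        (\<forall>k. k < llen zs \<longrightarrow> h (pr (lnth (psnd (psnd c)) k) (pr l (lnth zs k))) = 1) \<and>
        h (pr (pfst (psnd c)) (pr zs y)) = 1) \<or>
     pfst c = 5 \<and> (\<exists>xs. l = lcons 0 xs \<and> h (pr (pfst (psnd c)) (pr xs y)) = 1 \<or>
        (\<exists>n r. l = lcons (Suc n) xs \<and> h (pr c (pr (lcons n xs) r)) = 1 \<and>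
          h (pr (psnd (psnd c)) (pr (lcons n (lcons r xs)) y)) = 1)) \<or>
     5 < pfst c \<and> h (pr (psnd c) (pr (lcons y l) 0)) = 1 \<and>
        (\<forall>i. i < y \<longrightarrow> (\<exists>v. h (pr (psnd c) (pr (lcons i l) (Suc v))) = 1))"

definition eval_eqs :: "nat \<Rightarrow> (nat \<Rightarrow> nat) \<Rightarrow> (nat \<Rightarrow> nat \<Rightarrow> nat) \<Rightarrow> bool" where
  "eval_eqs p h \<Phi> \<longleftrightarrow> (\<forall>z. h z = (if eval_clause p h \<Phi> (pfst z) (pfst (psnd z)) (psnd (psnd z)) then 1 else 0))"

definition eval_fun :: "nat \<Rightarrow> (nat \<Rightarrow> nat \<Rightarrow> nat) \<Rightarrow> nat \<Rightarrow> nat" where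
  "eval_fun p \<Phi> z =
     (if eval (map \<Phi> [0..<p]) (dec (pfst z)) (list_decode (pfst (psnd z))) (psnd (psnd z)) then 1 else 0)"

lemma Delta_eval_eqs: "Delta k (\<lambda>\<Phi> \<rho>. eval_eqs p (\<Phi> 0) (\<lambda>i. \<Phi> (Suc i)))"
  unfolding eval_eqs_def eval_clause_def
  by (intro D_intros Delta_orc Dfun_lcons Dfun_lnth Dfun_llen)

lemma eval_eqsD: "eval_eqs p h \<Phi> \<Longrightarrow> h (pr c (pr l y)) = (if eval_clause p h \<Phi> c l y then 1 else 0)"
  unfolding eval_eqs_def by (metis pfst_pr psnd_pr)

lemma eval_eqs_eval_fun: "eval_eqs p (eval_fun p \<Phi>) \<Phi>"
proof -
  let ?F = "map \<Phi> [0..<p]"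
  have h: "eval_fun p \<Phi> (pr c (pr l y)) = Suc 0 \<longleftrightarrow> eval ?F (dec c) (list_decode l) y" for c l y
    by (simp add: eval_fun_def)
  have ex_list: "(\<exists>xs. P xs) \<longleftrightarrow> (\<exists>l. P (list_decode l))" for P :: "nat list \<Rightarrow> bool"
    by (metis list_encode_inverse)
  have "eval ?F (dec c) (list_decode l) y \<longleftrightarrow> eval_clause p (eval_fun p \<Phi>) \<Phi> c l y" for c l y
  proof -
    have one: "list_decode l = [x] \<longleftrightarrow> l = lcons x 0" for x
      by (metis list_decode_lcons list_decode.simps(1) list_decode_eq_iff)
    consider "pfst c = 0" | "pfst c = 1" | "pfst c = 2" | "pfst c = 3" | "pfst c = 4" | "pfst c = 5" | "5 < pfst c"
      by linarith
    then show ?thesis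
    proof cases
      case 1 then show ?thesis by (simp add: dec.simps[of c] eval_clause_def eval_Zero_iff)
    next
      case 2 then show ?thesis by (simp add: dec.simps[of c] eval_clause_def eval_Succ_iff one)
    next
      case 3 then show ?thesis by (auto simp add: dec.simps[of c] eval_clause_def eval_Proj_iff llen_eq lnth_eq)
    next
      case 4 then show ?thesis by (auto simp add: dec.simps[of c] eval_clause_def eval_Oracle_iff one orc_def)
    next
      case 5
      have "eval ?F (dec c) (list_decode l) y \<longleftrightarrow>
        (\<exists>zs. list_all2 (\<lambda>g z. eval ?F g (list_decode l) z) (map dec (list_decode (psnd (psnd c)))) zs \<and>
          eval ?F (dec (pfst (psnd c))) zs y)"
        using 5 by (simp add: dec.simps[of c] eval_Comp_iff)
      also have "\<dots> \<longleftrightarrow> (\<exists>zs. llen zs = llen (psnd (psnd c)) \<and>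
          (\<forall>k. k < llen zs \<longrightarrow> eval ?F (dec (lnth (psnd (psnd c)) k)) (list_decode l) (lnth zs k)) \<and>
          eval ?F (dec (pfst (psnd c))) (list_decode zs) y)"
        by (subst ex_list, rule iff_exI) (auto simp: list_all2_conv_all_nth llen_eq lnth_eq)
      finally show ?thesis using 5 by (simp add: eval_clause_def h)
    next
      case 6
      then show ?thesis
      proof (cases l rule: list_code_cases)
        case 1
        with 6 show ?thesis
          by (simp add: dec.simps[of c] eval_clause_def h eval_PrimRec_Nil_iff)
      next
        case (2 n xs)
        show ?thesis
        proof (cases n)
          case 0
          with 2 6 show ?thesis by (simp add: dec.simps[of c] eval_clause_def h eval_PrimRec_0_iff)
        next
          case (Suc m)
          from 6 have "dec c = PrimRec (dec (pfst (psnd c))) (dec (psnd (psnd c)))"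
            by (simp add: dec.simps[of c])
          with 2 6 Suc show ?thesis by (simp add: eval_clause_def h eval_PrimRec_Suc_iff)
        qed
      qed
    next
      case 7 then show ?thesis by (simp add: dec.simps[of c] eval_clause_def h eval_Mu_iff)
    qed
  qed
  then show ?thesis by (simp add: eval_eqs_def eval_fun_def)
qed

lemma eval_eqs_unique:
  assumes g: "eval_eqs p g \<Phi>" and h: "eval_eqs p h \<Phi>"
  shows "g = h"
proof -
  have "g (pr c (pr l y)) = h (pr c (pr l y))" for c l y
  proof (induction c arbitrary: l y rule: less_induct)
    case (less c)
    have sub: "psnd c < c" "pfst (psnd c) < c" "psnd (psnd c) < c"
      "\<And>k. k < llen (psnd (psnd c)) \<Longrightarrow> lnth (psnd (psnd c)) k < c" if "0 < pfst c"
    proof -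
      show c: "psnd c < c" using that by (rule psnd_less)
      then show "pfst (psnd c) < c" "psnd (psnd c) < c"
        using pfst_le[of "psnd c"] psnd_le[of "psnd c"] by linarith+
      fix k assume "k < llen (psnd (psnd c))"
      then have "lnth (psnd (psnd c)) k \<le> psnd (psnd c)"
        by (intro list_decode_le) (simp add: llen_eq lnth_eq)
      then show "lnth (psnd (psnd c)) k < c" using \<open>psnd (psnd c) < c\<close> by simp
    qed
    have clause: "eval_clause p g \<Phi> c l y \<longleftrightarrow> eval_clause p h \<Phi> c l y" if "pfst c \<noteq> 5" for l y
    proof (cases "pfst c = 0")
      case False
      then have "0 < pfst c" by simp
      note s = sub[OF this]
      have IH: "g (pr (psnd c) (pr l y)) = h (pr (psnd c) (pr l y))"
        "g (pr (pfst (psnd c)) (pr l y)) = h (pr (pfst (psnd c)) (pr l y))"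
        "\<And>k. k < llen (psnd (psnd c)) \<Longrightarrow>
          g (pr (lnth (psnd (psnd c)) k) (pr l y)) = h (pr (lnth (psnd (psnd c)) k) (pr l y))" for l y
        by (rule less.IH[OF s(1)], rule less.IH[OF s(2)], rule less.IH[OF s(4)])
      have "(\<forall>k. k < llen zs \<longrightarrow> g (pr (lnth (psnd (psnd c)) k) (pr l (lnth zs k))) = 1) \<longleftrightarrow>
          (\<forall>k. k < llen zs \<longrightarrow> h (pr (lnth (psnd (psnd c)) k) (pr l (lnth zs k))) = 1)"
        if "llen zs = llen (psnd (psnd c))" for zs
        using IH(3) that by simp
      then show ?thesis using that unfolding eval_clause_def by (simp add: IH(1,2) cong: conj_cong)
    qed (simp add: eval_clause_def)
    show ?case
    proof (cases "pfst c = 5")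
      case True
      then have "0 < pfst c" by simp
      note s = sub[OF this]
      have IH: "g (pr (pfst (psnd c)) (pr l y)) = h (pr (pfst (psnd c)) (pr l y))"
        "g (pr (psnd (psnd c)) (pr l y)) = h (pr (psnd (psnd c)) (pr l y))" for l y
        by (rule less.IH[OF s(2)], rule less.IH[OF s(3)])
      \<comment> \<open>Primitive recursion is the only clause that consults \<open>c\<close>
        itself, with a smaller recursion argument; hence an inner induction on the head of the
        argument list.\<close>
      have "g (pr c (pr (lcons n xs) y)) = h (pr c (pr (lcons n xs) y))" for n xs y
      proof (induction n arbitrary: y)
        case 0
        have "eval_clause p g \<Phi> c (lcons 0 xs) y \<longleftrightarrow> eval_clause p h \<Phi> c (lcons 0 xs) y"
          using True by (simp add: eval_clause_def IH)
        then show ?case by (simp only: eval_eqsD[OF g, of c _ y] eval_eqsD[OF h, of c _ y])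
      next
        case (Suc n)
        have "eval_clause p g \<Phi> c (lcons (Suc n) xs) y \<longleftrightarrow> eval_clause p h \<Phi> c (lcons (Suc n) xs) y"
          using True by (simp add: eval_clause_def IH Suc)
        then show ?case by (simp only: eval_eqsD[OF g, of c _ y] eval_eqsD[OF h, of c _ y])
      qed
      moreover have "eval_clause p g \<Phi> c 0 y \<longleftrightarrow> eval_clause p h \<Phi> c 0 y" for y
        using True lcons_eq_iff(2) by (simp add: eval_clause_def)
      then have "g (pr c (pr 0 y)) = h (pr c (pr 0 y))" for y
        by (simp only: eval_eqsD[OF g, of c 0 y] eval_eqsD[OF h, of c 0 y])
      ultimately show ?thesis by (metis list_code_cases)
    next
      case False
      show ?thesis by (simp only: clause[OF False] eval_eqsD[OF g, of c l y] eval_eqsD[OF h, of c l y])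
    qed
  qed
  then show ?thesis by (metis ext pr_pfst_psnd)
qed

text \<open>Evaluation is even \<Sigma>^0_1, but the unique solution of its recursion equations
  gives \<Delta>^1_1 without coding computations. Evaluation is needed only at levels
  \<open>Suc k\<close>, so this costs nothing.\<close>

lemma Dfun_eval_fun: "Dfun (Suc 0) (\<lambda>\<Phi> \<rho>. eval_fun p \<Phi> (\<rho> 0))"
  by (rule Dfun_unique_solution[OF Delta_eval_eqs eval_eqs_eval_fun eval_eqs_unique[OF _ eval_eqs_eval_fun]])

lemma Delta_eval:
  assumes "Dfun (Suc k) s" "Dfun (Suc k) t" "Dfun (Suc k) u"
  shows "Delta (Suc k) (\<lambda>\<Phi> \<rho>. eval (map \<Phi> [0..<p]) (dec (s \<Phi> \<rho>)) (list_decode (t \<Phi> \<rho>)) (u \<Phi> \<rho>))"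
proof -
  have "Dfun (Suc k) (\<lambda>\<Phi> \<rho>. eval_fun p \<Phi> (\<rho> 0))" by (rule Dfun_mono[OF _ Dfun_eval_fun]) simp
  from Dfun_let[OF this Dfun_pr[OF assms(1) Dfun_pr[OF assms(2,3)]]]
  have "Delta (Suc k) (\<lambda>\<Phi> \<rho>. eval_fun p \<Phi> (pr (s \<Phi> \<rho>) (pr (t \<Phi> \<rho>) (u \<Phi> \<rho>))) = 1)"
    by (intro D_intros)
  then show ?thesis by (simp add: eval_fun_def)
qed

section \<open>Indices of total computable functions\<close>

definition halting :: "nat \<Rightarrow> bool" where "halting e \<longleftrightarrow> (\<forall>x. \<exists>y. eval [] (dec e) [x] y)"

text \<open>Programs that are not total are sent to the zero function, so every number is an index
  and quantifiers over indices run exactly over the computable functions. The price is that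
  \<open>phi\<close> is \<Delta>^1_1, but not computable, as a function of both arguments.\<close>

definition phi :: "nat \<Rightarrow> nat \<Rightarrow> nat" where
  "phi e x = (if halting e then (THE y. eval [] (dec e) [x] y) else 0)"

lemma phi_graph: "y = phi e x \<longleftrightarrow> halting e \<and> eval [] (dec e) [x] y \<or> \<not> halting e \<and> y = 0"
proof (cases "halting e")
  case True
  then obtain z where z: "eval [] (dec e) [x] z" unfolding halting_def by blast
  then have "(THE y. eval [] (dec e) [x] y) = z" by (rule the_equality) (rule eval_deterministic[OF _ z])
  with True z show ?thesis unfolding phi_def by (metis eval_deterministic)
qed (simp add: phi_def)

lemma Delta_eval_unary:
  assumes "Dfun (Suc k) s" "Dfun (Suc k) t" "Dfun (Suc k) u"
  shows "Delta (Suc k) (\<lambda>\<Phi> \<rho>. eval [] (dec (s \<Phi> \<rho>)) [t \<Phi> \<rho>] (u \<Phi> \<rho>))"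
  using Delta_eval[OF assms(1) Dfun_lcons[OF assms(2) Dfun_const[of _ 0]] assms(3), of 0] by simp

lemma Dfun_phi: "Dfun (Suc k) s \<Longrightarrow> Dfun (Suc k) t \<Longrightarrow> Dfun (Suc k) (\<lambda>\<Phi> \<rho>. phi (s \<Phi> \<rho>) (t \<Phi> \<rho>))"
proof (rule Dfun_comp2[of "Suc k" phi])
  show "Dfun (Suc k) (\<lambda>\<Phi> \<rho>. phi (\<rho> 0) (\<rho> 1))"
    unfolding Dfun_def phi_graph halting_def by (intro D_intros Delta_eval_unary)
qed

lemma computable_phi: "computable (phi e)"
proof (cases "halting e")
  case True
  then have "eval [] (dec e) [x] (phi e x)" for x using phi_graph[of "phi e x" e x] by simp
  then show ?thesis unfolding computable_def by blast
next
  case False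
  then have "phi e = (\<lambda>_. 0)" by (simp add: phi_def fun_eq_iff)
  then show ?thesis by (simp add: computable_iff_recfun recfun_const)
qed

lemma computable_ex_phi:
  assumes "computable f"
  obtains e where "phi e = f"
proof -
  from assms obtain p where p: "\<And>x. eval [] p [x] (f x)" unfolding computable_def by blast
  obtain e where "dec e = p" using dec_surj by blast
  with p have "phi e x = f x" for x using phi_graph[of "f x" e x] by (auto simp: halting_def)
  then have "phi e = f" by (simp add: fun_eq_iff)
  then show thesis by (rule that)
qed

lemma recfun_phi: "recfun s \<Longrightarrow> recfun (\<lambda>\<Phi> \<rho>. phi e (s \<Phi> \<rho>))"
  by (rule recfun_computable[OF computable_phi])

text \<open>Codes of arithmetical relations: \<open>\<langle>0, c\<rangle>\<close> is the recursive relation decided by program \<open>c\<close>,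
  \<open>\<langle>1, a\<rangle>\<close> a complement, and any other tag an existential number quantification.\<close>

function sat :: "nat \<Rightarrow> (nat \<Rightarrow> nat \<Rightarrow> nat) \<Rightarrow> nat \<Rightarrow> nat list \<Rightarrow> bool" where
  "sat p \<Phi> a xs =
    (if pfst a = 0 then eval (map \<Phi> [0..<p]) (dec (psnd a)) xs 1
     else if pfst a = 1 then \<not> sat p \<Phi> (psnd a) xs
     else (\<exists>n. sat p \<Phi> (psnd a) (n # xs)))"
  by auto
termination
  by (relation "measure (\<lambda>(p, \<Phi>, a, xs). a)") (auto simp: psnd_less)

declare sat.simps [simp del]

definition sat_eqs :: "nat \<Rightarrow> (nat \<Rightarrow> nat) \<Rightarrow> (nat \<Rightarrow> nat \<Rightarrow> nat) \<Rightarrow> bool" where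
  "sat_eqs p h \<Phi> \<longleftrightarrow> (\<forall>a l. h (pr a l) =
    (if pfst a = 0 \<and> eval_fun p \<Phi> (pr (psnd a) (pr l 1)) = 1 \<or> pfst a = 1 \<and> h (pr (psnd a) l) = 0 \<or>
       1 < pfst a \<and> (\<exists>n. h (pr (psnd a) (lcons n l)) = 1) then 1 else 0))"

definition sat_fun :: "nat \<Rightarrow> (nat \<Rightarrow> nat \<Rightarrow> nat) \<Rightarrow> nat \<Rightarrow> nat" where
  "sat_fun p \<Phi> z = (if sat p \<Phi> (pfst z) (list_decode (psnd z)) then 1 else 0)"

lemma sat_eqs_sat_fun: "sat_eqs p (sat_fun p \<Phi>) \<Phi>"
  unfolding sat_eqs_def
proof (intro allI)
  fix a l
  consider "pfst a = 0" | "pfst a = 1" | "1 < pfst a" by linarith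
  then show "sat_fun p \<Phi> (pr a l) = (if pfst a = 0 \<and> eval_fun p \<Phi> (pr (psnd a) (pr l 1)) = 1 \<or>
      pfst a = 1 \<and> sat_fun p \<Phi> (pr (psnd a) l) = 0 \<or>
       1 < pfst a \<and> (\<exists>n. sat_fun p \<Phi> (pr (psnd a) (lcons n l)) = 1) then 1 else 0)"
    by cases (simp_all add: sat_fun_def eval_fun_def sat.simps[of p \<Phi> a])
qed

lemma sat_eqs_unique:
  assumes g: "sat_eqs p g \<Phi>" and h: "sat_eqs p h \<Phi>"
  shows "g = h"
proof -
  have "g (pr a l) = h (pr a l)" for a l
  proof (induction a arbitrary: l rule: less_induct)
    case (less a)
    then have "0 < pfst a \<Longrightarrow> g (pr (psnd a) l) = h (pr (psnd a) l)" for l using psnd_less by blast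
    then show ?case
      using g[unfolded sat_eqs_def, rule_format, of a l] h[unfolded sat_eqs_def, rule_format, of a l]
      by (auto cong: conj_cong)
  qed
  then show ?thesis by (metis ext pr_pfst_psnd)
qed

lemma Dfun_eval_fun_shift: "Dfun (Suc 0) (\<lambda>\<Phi> \<rho>. eval_fun p (\<lambda>i. \<Phi> (Suc i)) (\<rho> 0))"
proof -
  have "rec_subst (\<lambda>\<Phi> \<rho> i. \<Phi> (Suc i)) (\<lambda>\<Phi> \<rho>. \<rho>)" by (rule rec_subst_shift)
  from is_Sigma_Pi_esubst[OF _ this, of "Suc 0" "\<lambda>\<Phi> \<rho>. \<rho> 0 = eval_fun p \<Phi> (\<rho> 1)"] Dfun_eval_fun[of p] show ?thesis
    by (simp add: Dfun_def Delta_def esubst_def)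
qed

lemma Dfun_sat_fun: "Dfun (Suc 0) (\<lambda>\<Phi> \<rho>. sat_fun p \<Phi> (\<rho> 0))"
proof (rule Dfun_unique_solution[of 0 "sat_eqs p", OF _ sat_eqs_sat_fun sat_eqs_unique[OF _ sat_eqs_sat_fun]])
  have *: "Dfun (Suc 0) s \<Longrightarrow> Dfun (Suc 0) (\<lambda>\<Phi> \<rho>. eval_fun p (\<lambda>i. \<Phi> (Suc i)) (s \<Phi> \<rho>))" for s
    using Dfun_let[of "Suc 0" "\<lambda>\<Phi> x \<rho>. eval_fun p (\<lambda>i. \<Phi> (Suc i)) x"] Dfun_eval_fun_shift by blast
  show "Delta (Suc 0) (\<lambda>\<Phi> \<rho>. sat_eqs p (\<Phi> 0) (\<lambda>i. \<Phi> (Suc i)))"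
    unfolding sat_eqs_def by (intro D_intros * Dfun_lcons)
qed

lemma Delta_sat: "Delta (Suc 0) (\<lambda>\<Phi> \<rho>. sat p \<Phi> (\<rho> 0) (list_decode (\<rho> 1)))"
proof -
  from Dfun_let[OF Dfun_sat_fun Dfun_pr[OF Dfun_var[of _ 0] Dfun_var[of _ 1]]]
  have "Delta (Suc 0) (\<lambda>\<Phi> \<rho>. sat_fun p \<Phi> (pr (\<rho> 0) (\<rho> 1)) = 1)" by (intro D_intros)
  then show ?thesis by (simp add: sat_fun_def)
qed

lemma arithmetical_sat:
  "arithmetical p q R \<Longrightarrow> \<exists>a. \<forall>\<Phi> xs. length xs = q \<longrightarrow> R (map \<Phi> [0..<p]) xs = sat p \<Phi> a xs"
proof (induction rule: arithmetical.induct)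
  case (arithmetical_recursive p q R)
  then obtain e where e: "\<And>F xs. length F = p \<Longrightarrow> length xs = q \<Longrightarrow> eval F e xs (if R F xs then 1 else 0)"
    unfolding recursive_rel_def by blast
  obtain c where c: "dec c = e" using dec_surj by blast
  have "R (map \<Phi> [0..<p]) xs = sat p \<Phi> (pr 0 c) xs" if "length xs = q" for \<Phi> xs
  proof -
    have ev: "eval (map \<Phi> [0..<p]) e xs (if R (map \<Phi> [0..<p]) xs then 1 else 0)"
      using e[of "map \<Phi> [0..<p]" xs] that by simp
    have "sat p \<Phi> (pr 0 c) xs \<longleftrightarrow> eval (map \<Phi> [0..<p]) e xs 1"
      by (subst sat.simps) (simp add: c)
    also have "\<dots> \<longleftrightarrow> R (map \<Phi> [0..<p]) xs"
      using ev eval_deterministic[OF ev, of 1] by (auto split: if_splits)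
    finally show ?thesis ..
  qed
  then show ?case by blast
next
  case (arithmetical_not p q R)
  then obtain a where a: "\<And>\<Phi> xs. length xs = q \<Longrightarrow> R (map \<Phi> [0..<p]) xs = sat p \<Phi> a xs" by blast
  have "sat p \<Phi> (pr 1 a) xs \<longleftrightarrow> \<not> sat p \<Phi> a xs" for \<Phi> xs
    by (subst sat.simps) simp
  with a show ?case by (intro exI[of _ "pr 1 a"]) simp
next
  case (arithmetical_ex p q Q R)
  then obtain a where a: "\<And>\<Phi> xs. length xs = Suc q \<Longrightarrow> Q (map \<Phi> [0..<p]) xs = sat p \<Phi> a xs" by blast
  have "sat p \<Phi> (pr 2 a) xs \<longleftrightarrow> (\<exists>n. sat p \<Phi> a (n # xs))" for \<Phi> xs
    by (subst sat.simps) simp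
  with a arithmetical_ex.hyps(2) show ?case by (intro exI[of _ "pr 2 a"]) simp
qed

text \<open>The code \<open>a\<close> names only the arithmetical matrix. The level determines the
  prefix, and each function quantifier adds one oracle in front.\<close>

fun USigma UPi :: "nat \<Rightarrow> nat \<Rightarrow> (nat \<Rightarrow> nat \<Rightarrow> nat) \<Rightarrow> nat \<Rightarrow> nat list \<Rightarrow> bool" where
  "USigma 0 p \<Phi> a xs \<longleftrightarrow> sat p \<Phi> a xs"
| "USigma (Suc k) p \<Phi> a xs \<longleftrightarrow> (\<exists>f. UPi k (Suc p) (case_nat f \<Phi>) a xs)"
| "UPi 0 p \<Phi> a xs \<longleftrightarrow> sat p \<Phi> a xs"
| "UPi (Suc k) p \<Phi> a xs \<longleftrightarrow> (\<forall>f. USigma k (Suc p) (case_nat f \<Phi>) a xs)"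

lemma universal_complete:
  "Sigma1_rel k p q R \<Longrightarrow> \<exists>a. \<forall>\<Phi> xs. length xs = q \<longrightarrow> R (map \<Phi> [0..<p]) xs = USigma k p \<Phi> a xs"
  "Pi1_rel k p q R \<Longrightarrow> \<exists>a. \<forall>\<Phi> xs. length xs = q \<longrightarrow> R (map \<Phi> [0..<p]) xs = UPi k p \<Phi> a xs"
proof (induction k arbitrary: R p)
  case 0
  { case 1 then show ?case using arithmetical_sat by simp
  next case 2 then show ?case using arithmetical_sat by simp }
next
  case (Suc k)
  { case 1
    then obtain Q where Q: "Pi1_rel k (Suc p) q Q"
      "\<And>F xs. length F = p \<Longrightarrow> length xs = q \<Longrightarrow> R F xs \<longleftrightarrow> (\<exists>f. Q (f # F) xs)" by auto
    from Suc.IH(2)[OF Q(1)] obtain a where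
      a: "\<And>\<Phi> xs. length xs = q \<Longrightarrow> Q (map \<Phi> [0..<Suc p]) xs = UPi k (Suc p) \<Phi> a xs" by blast
    have "Q (f # map \<Phi> [0..<p]) xs = UPi k (Suc p) (case_nat f \<Phi>) a xs" if "length xs = q" for f \<Phi> xs
      using a[OF that, of "case_nat f \<Phi>"] by (simp add: map_upt_Suc del: upt_Suc)
    then show ?case using Q(2) by (intro exI[of _ a]) simp
  next
    case 2
    then obtain Q where Q: "Sigma1_rel k (Suc p) q Q"
      "\<And>F xs. length F = p \<Longrightarrow> length xs = q \<Longrightarrow> R F xs \<longleftrightarrow> (\<forall>f. Q (f # F) xs)" by auto
    from Suc.IH(1)[OF Q(1)] obtain a where
      a: "\<And>\<Phi> xs. length xs = q \<Longrightarrow> Q (map \<Phi> [0..<Suc p]) xs = USigma k (Suc p) \<Phi> a xs" by blast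
    have "Q (f # map \<Phi> [0..<p]) xs = USigma k (Suc p) (case_nat f \<Phi>) a xs" if "length xs = q" for f \<Phi> xs
      using a[OF that, of "case_nat f \<Phi>"] by (simp add: map_upt_Suc del: upt_Suc)
    then show ?case using Q(2) by (intro exI[of _ a]) simp }
qed

text \<open>The base is level 1 and not level 0: satisfaction for arithmetical relations is not
  arithmetical, but it is \<Delta>^1_1, and the first function quantifier absorbs it. This is where
  \<open>n\<close> must be non-zero in \<open>universal_Pi1\<close>.\<close>

lemma universal_class:
  "is_Sigma (Suc k) (\<lambda>\<Phi> \<rho>. USigma (Suc k) p \<Phi> (\<rho> 0) (list_decode (\<rho> 1)))"
  "is_Pi (Suc k) (\<lambda>\<Phi> \<rho>. UPi (Suc k) p \<Phi> (\<rho> 0) (list_decode (\<rho> 1)))"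
proof (induction k arbitrary: p)
  case 0
  { case 1
    show ?case using is_Sigma_eexf[of 0 "\<lambda>\<Phi> \<rho>. sat (Suc p) \<Phi> (\<rho> 0) (list_decode (\<rho> 1))"] Delta_sat[of "Suc p"]
      by (simp add: eexf_def Delta_def)
  next
    case 2
    show ?case using is_Pi_eallf[of 0 "\<lambda>\<Phi> \<rho>. sat (Suc p) \<Phi> (\<rho> 0) (list_decode (\<rho> 1))"] Delta_sat[of "Suc p"]
      by (simp add: eallf_def Delta_def) }
next
  case (Suc k)
  { case 1
    show ?case using Suc.IH(2)[of "Suc p"] unfolding is_Sigma.simps(2)[of "Suc k"] USigma.simps(2)[of "Suc k"]
      by (intro exI conjI) (assumption, simp add: eexf_def)
  next
    case 2
    show ?case using Suc.IH(1)[of "Suc p"] unfolding is_Pi.simps(2)[of "Suc k"] UPi.simps(2)[of "Suc k"]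
      by (intro exI conjI) (assumption, simp add: eallf_def) }
qed

lemma universal_Pi1:
  assumes "0 < n"
  obtains U :: "nat \<Rightarrow> nat \<Rightarrow> bool" where "Delta (Suc n) (\<lambda>\<Phi> \<rho>. U (\<rho> 0) (\<rho> 1))"
    "\<And>A. Pi1_set n A \<Longrightarrow> \<exists>u. A = {x. U u x}"
proof
  from assms obtain k where k: "n = Suc k" by (cases n) auto
  define U where "U u x = UPi n 0 (\<lambda>_ _. 0) u [x]" for u x
  have "rec_subst (\<lambda>\<Phi> \<rho> i x. 0) (\<lambda>\<Phi> \<rho>. case_nat (\<rho> 0) (\<lambda>_. lcons (\<rho> 1) 0))"
    by (simp add: rec_subst_def recfun_case_nat rec_intros lcons_def)
  from is_Sigma_Pi_esubst(2)[OF universal_class(2)[of k 0] this]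
  have "is_Pi n (\<lambda>\<Phi> \<rho>. U (\<rho> 0) (\<rho> 1))" by (simp add: esubst_def U_def k)
  then show "Delta (Suc n) (\<lambda>\<Phi> \<rho>. U (\<rho> 0) (\<rho> 1))" by (rule Delta_Suc)
  fix A assume "Pi1_set n A"
  then obtain R where R: "Pi1_rel n 0 1 R" "A = {x. R [] [x]}" by (auto simp: Pi1_set_def)
  from universal_complete(2)[OF R(1)] obtain a where
    "\<And>xs. length xs = 1 \<Longrightarrow> R [] xs = UPi n 0 (\<lambda>_ _. 0) a xs" by auto
  then show "\<exists>u. A = {x. U u x}" using R(2) by (intro exI[of _ a]) (simp add: U_def)
qed

section \<open>Thinning computable sets\<close>

lemma recfun_card:
  assumes "recpred (\<lambda>\<Phi> \<rho>. P \<Phi> (\<rho> 0) (\<lambda>i. \<rho> (Suc i)))" "recfun t"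
  shows "recfun (\<lambda>\<Phi> \<rho>. card {y. y < t \<Phi> \<rho> \<and> P \<Phi> y \<rho>})"
proof -
  have "recfun (\<lambda>\<Phi> \<rho>. case_nat (\<rho> 0) (\<lambda>i. \<rho> (Suc (Suc i))) i)" for i
    by (cases i) (simp_all add: recfun_var)
  from recpred_subst_num[OF assms(1), of "\<lambda>\<Phi> \<rho>. case_nat (\<rho> 0) (\<lambda>i. \<rho> (Suc (Suc i)))", OF this]
  have "recpred (\<lambda>\<Phi> \<rho>. P \<Phi> (\<rho> 0) (\<lambda>i. \<rho> (Suc (Suc i))))" by simp
  then have "recfun (\<lambda>\<Phi> \<rho>. rec_nat 0 (\<lambda>k r. if P \<Phi> k \<rho> then Suc r else r) (t \<Phi> \<rho>))"
    by (intro recfun_rec recfun_if recfun_const recfun_Suc recfun_var assms(2))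
  moreover have "rec_nat (0::nat) (\<lambda>k r. if P \<Phi> k \<rho> then Suc r else r) n = card {y. y < n \<and> P \<Phi> y \<rho>}" for \<Phi> \<rho> n
  proof (induction n)
    case (Suc n)
    have "{y. y < Suc n \<and> P \<Phi> y \<rho>} = (if P \<Phi> n \<rho> then insert n {y. y < n \<and> P \<Phi> y \<rho>} else {y. y < n \<and> P \<Phi> y \<rho>})"
      by (auto simp: less_Suc_eq)
    with Suc show ?case by simp
  qed simp
  ultimately show ?thesis by simp
qed

text \<open>A strictly increasing computable function presents an infinite computable set, its
  range.\<close>

definition cincr :: "(nat \<Rightarrow> nat) \<Rightarrow> bool" where
  "cincr r \<longleftrightarrow> computable r \<and> strict_mono r"

lemma cincr_unbounded:
  assumes "cincr r"
  shows "b \<le> r b"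
  using assms strict_mono_imp_increasing unfolding cincr_def by blast

text \<open>An infinite computably enumerable set has an infinite computable subset: search for the
  next element above the last one. The search also finds the witnesses, which
  \<open>\<omega>\<close> records.\<close>

lemma infinite_ce_has_cincr:
  assumes r: "cincr r" and P: "recpred (\<lambda>\<Phi> \<rho>. P (\<rho> 0) (\<rho> 1))"
    and inf: "infinite {x \<in> range r. \<exists>w. P x w}"
  shows "\<exists>r' \<omega>. cincr r' \<and> computable \<omega> \<and> range r' \<subseteq> range r \<and> (\<forall>k. P (r' k) (\<omega> k))"
proof -
  have rc: "recfun s \<Longrightarrow> recfun (\<lambda>\<Phi> \<rho>. r (s \<Phi> \<rho>))" for s
    using r recfun_computable unfolding cincr_def by blast
  have Pc: "recpred (\<lambda>\<Phi> \<rho>. P (s \<Phi> \<rho>) (t \<Phi> \<rho>))" if "recfun s" "recfun t" for s t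
    using recfun_comp2[of "\<lambda>x y. of_bool (P x y)" s t] P that unfolding recpred_def by blast
  define nxt where "nxt b = (LEAST z. b \<le> r (pfst z) \<and> P (r (pfst z)) (psnd z))" for b
  have ex: "\<exists>z. b \<le> r (pfst z) \<and> P (r (pfst z)) (psnd z)" for b
  proof -
    from inf have "\<not> {x \<in> range r. \<exists>w. P x w} \<subseteq> {..<b}" by (meson finite_lessThan finite_subset)
    then obtain x where "x \<in> range r" "\<exists>w. P x w" "\<not> x < b" by blast
    then obtain k w where "b \<le> r k" "P (r k) w" by (auto simp: not_less)
    then show ?thesis by (intro exI[of _ "pr k w"]) simp
  qed
  have nxt: "b \<le> r (pfst (nxt b))" "P (r (pfst (nxt b))) (psnd (nxt b))" for b
    using LeastI_ex[OF ex[of b]] unfolding nxt_def by blast+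
  have nxtc: "recfun (\<lambda>\<Phi> \<rho>. nxt (\<rho> 0))"
    unfolding nxt_def by (intro recfun_Least rec_intros rc Pc ex)
  define q where "q n = rec_nat (nxt 0) (\<lambda>_ z. nxt (Suc (r (pfst z)))) n" for n
  have qc: "recfun (\<lambda>\<Phi> \<rho>. q (\<rho> 0))"
    unfolding q_def by (intro recfun_rec rec_intros recfun_comp1[OF nxtc] rc)
  define r' where "r' n = r (pfst (q n))" for n
  define \<omega> where "\<omega> n = psnd (q n)" for n
  have "r' n < r' (Suc n)" for n
    using nxt(1)[of "Suc (r (pfst (q n)))"] by (simp add: r'_def q_def)
  then have "strict_mono r'" by (rule strict_mono_Suc_iff[THEN iffD2, rule_format])
  moreover have "computable r'" "computable \<omega>"
    unfolding r'_def \<omega>_def computable_iff_recfun by (intro rc recfun_pfst recfun_psnd qc)+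
  moreover have "P (r' k) (\<omega> k)" for k
    by (cases k) (simp_all add: r'_def \<omega>_def q_def nxt)
  moreover have "range r' \<subseteq> range r" by (auto simp: r'_def)
  ultimately show ?thesis unfolding cincr_def by blast
qed

lemma cincr_avoid_finite:
  assumes r: "cincr r" and "finite F"
  obtains r' where "cincr r'" "range r' \<subseteq> range r - F"
proof -
  obtain b where b: "\<And>x. x \<in> F \<Longrightarrow> x < b" using assms(2) by (meson finite_nat_set_iff_bounded)
  define r' where "r' n = r (n + b)" for n
  have "computable r'"
    unfolding r'_def computable_iff_recfun
    by (intro recfun_computable[of r] recfun_plus recfun_var recfun_const) (use r in \<open>simp add: cincr_def\<close>)
  moreover have "strict_mono r'" using r unfolding r'_def cincr_def strict_mono_def by simp
  moreover have "r' n \<notin> F" for n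
    using b[of "r' n"] cincr_unbounded[OF r, of "n + b"] by (force simp: r'_def)
  ultimately show thesis by (intro that[of r']) (auto simp: cincr_def r'_def)
qed

section \<open>Conditions: a computable reservoir of places and an enumeration of bad
  candidates\<close>

definition bd :: "(nat \<Rightarrow> nat) \<Rightarrow> nat \<Rightarrow> nat \<Rightarrow> bool" where
  "bd g x y \<longleftrightarrow> (\<exists>z. g z = pr x y)"

text \<open>Here \<open>d\<close> is the number of a piece, and \<open>pr (Suc d) (pr x y)\<close>
  is the index of copy \<open>y\<close> of \<open>x\<close> in that piece of the numbering
  \<open>mu\<close>; column 0 is kept for the family.\<close>

definition hit :: "(nat \<Rightarrow> nat) \<Rightarrow> nat \<Rightarrow> nat \<Rightarrow> nat \<Rightarrow> bool" where
  "hit f d x y \<longleftrightarrow> (\<exists>z. f z = pr (Suc d) (pr x y))"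

definition free :: "(nat \<Rightarrow> nat) \<Rightarrow> nat \<Rightarrow> nat set" where
  "free g x = {y. \<not> bd g x y}"

text \<open>A condition after \<open>s\<close> requirements: at every place \<open>x\<close> of the
  reservoir at least the fraction \<open>1 / 4 ^ s\<close> of the \<open>2 ^ x\<close> initial
  candidates is still free. Places outside the reservoir are not restricted.\<close>

definition okcond :: "nat \<Rightarrow> (nat \<Rightarrow> nat) \<Rightarrow> (nat \<Rightarrow> nat) \<Rightarrow> bool" where
  "okcond s r g \<longleftrightarrow> cincr r \<and> computable g \<and> (\<forall>x y. 2 ^ x \<le> y \<longrightarrow> bd g x y) \<and>
     (\<forall>x\<in>range r. 2 ^ x \<le> 4 ^ s * card (free g x))"

definition const_or_finite_to_one :: "(nat \<Rightarrow> nat) \<Rightarrow> nat set \<Rightarrow> bool" where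
  "const_or_finite_to_one f X \<longleftrightarrow> (\<exists>v. \<forall>x\<in>X. f x = v) \<or> (\<forall>v. \<exists>b. \<forall>x\<in>X. f x = v \<longrightarrow> x \<le> b)"

text \<open>The last two alternatives demand a hit that is bad. A bad copy will never be the
  exceptional one, so such a hit is an index with the colour of \<open>x\<close> itself.\<close>

definition decides :: "(nat \<Rightarrow> nat) \<Rightarrow> nat \<Rightarrow> nat set \<Rightarrow> (nat \<Rightarrow> nat) \<Rightarrow> bool" where
  "decides f d X g \<longleftrightarrow>
     (\<forall>x\<in>X. \<forall>y. \<not> hit f d x y) \<or>
     (\<forall>x\<in>X. (\<exists>y. hit f d x y \<and> bd g x y) \<and> (\<forall>y. hit f d x y \<longrightarrow> bd g x y)) \<or>
     (\<forall>x\<in>X. (\<exists>y. hit f d x y \<and> bd g x y) \<and> (\<forall>y. hit f d x y \<or> bd g x y))"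

lemma free_finite: "okcond s r g \<Longrightarrow> free g x \<subseteq> {..<2 ^ x}"
  unfolding okcond_def free_def by (auto simp: not_le[symmetric])

lemma extend_bd:
  assumes "computable g" "computable f"
  obtains g' where "computable g'" "\<And>x y. bd g' x y \<longleftrightarrow> bd g x y \<or> (\<exists>z. f z = pr x y)"
proof
  let ?g = "\<lambda>n. if even n then g (n div 2) else f (n div 2)"
  show "computable ?g"
    unfolding computable_iff_recfun
    by (intro rec_intros recfun_computable[OF assms(1)] recfun_computable[OF assms(2)])
  show "bd ?g x y \<longleftrightarrow> bd g x y \<or> (\<exists>z. f z = pr x y)" for x y
  proof
    assume "bd g x y \<or> (\<exists>z. f z = pr x y)"
    then obtain z where "g z = pr x y \<or> f z = pr x y" by (auto simp: bd_def)
    then have "?g (2 * z) = pr x y \<or> ?g (2 * z + 1) = pr x y" by auto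
    then show "bd ?g x y" unfolding bd_def by blast
  qed (auto simp: bd_def split: if_splits)
qed

lemma extend_bd_pred:
  assumes "computable g" "bd g 0 1" "recpred (\<lambda>\<Phi> \<rho>. P (\<rho> 0))" "computable f"
  obtains g' where "computable g'" "\<And>x y. bd g' x y \<longleftrightarrow> bd g x y \<or> (\<exists>z. P z \<and> f z = pr x y)"
proof -
  \<comment> \<open>Repeating a pair that is already bad stands for enumerating nothing. Under
    \<open>okcond\<close> the pair \<open>pr 0 1\<close> is bad, since
    \<open>2 ^ 0 \<le> 1\<close>.\<close>
  have "computable (\<lambda>z. if P z then f z else pr 0 1)"
    unfolding computable_iff_recfun by (intro rec_intros assms(3) recfun_computable[OF assms(4)])
  from extend_bd[OF assms(1) this] obtain g' where g': "computable g'"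
    "\<And>x y. bd g' x y \<longleftrightarrow> bd g x y \<or> (\<exists>z. (if P z then f z else pr 0 1) = pr x y)" by blast
  have "bd g' x y \<longleftrightarrow> bd g x y \<or> (\<exists>z. P z \<and> f z = pr x y)" for x y
  proof
    assume "bd g' x y"
    then show "bd g x y \<or> (\<exists>z. P z \<and> f z = pr x y)"
      unfolding g'(2) using assms(2) by (auto split: if_splits)
  next
    assume "bd g x y \<or> (\<exists>z. P z \<and> f z = pr x y)"
    then show "bd g' x y" unfolding g'(2) by (metis (full_types))
  qed
  with g'(1) show thesis by (rule that)
qed

lemma thin_const_or_finite_to_one:
  assumes r: "cincr r" and f: "computable f"
  obtains r' where "cincr r'" "range r' \<subseteq> range r" "const_or_finite_to_one f (range r')"
proof (cases "\<forall>v. finite {x \<in> range r. f x = v}")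
  case True
  then have "\<exists>b. \<forall>x\<in>range r. f x = v \<longrightarrow> x \<le> b" for v
    using finite_nat_set_iff_bounded_le[of "{x \<in> range r. f x = v}"] by blast
  then show thesis using r by (intro that[of r]) (auto simp: const_or_finite_to_one_def)
next
  case False
  then obtain v where "infinite {x \<in> range r. f x = v}" by blast
  then have inf: "infinite {x \<in> range r. \<exists>w::nat. f x = v}" by simp
  have "recpred (\<lambda>\<Phi> \<rho>. f (\<rho> 0) = v)" using f by (simp add: computable_iff_recfun recpred_eq recfun_const)
  from infinite_ce_has_cincr[of r "\<lambda>x w. f x = v", OF r this inf] obtain r' where
    "cincr r'" "range r' \<subseteq> range r" "\<forall>k. f (r' k) = v" by (elim exE conjE)
  then show thesis by (intro that[of r']) (auto simp: const_or_finite_to_one_def)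
qed

lemma const_or_finite_to_one_subset:
  "const_or_finite_to_one f X \<Longrightarrow> Y \<subseteq> X \<Longrightarrow> const_or_finite_to_one f Y"
  unfolding const_or_finite_to_one_def by blast

text \<open>
  Call \<open>y\<close> found at \<open>x\<close> if it is bad or hit. If many \<open>x\<close> have all but a small fraction of their
  candidates found, keep such \<open>x\<close> and declare the remaining candidates bad; otherwise, for
  almost all \<open>x\<close>, declaring all hits bad still leaves enough candidates.
\<close>

lemma thin_decides:
  assumes ok: "okcond s r g" and f: "computable f"
  obtains r' g' where "range r' \<subseteq> range r" "\<And>x y. bd g x y \<Longrightarrow> bd g' x y" "okcond (Suc s) r' g'"
    "decides f d (range r') g'"
proof (cases "finite {x \<in> range r. \<exists>y. hit f d x y}")
  case True
  have r: "cincr r" using ok by (simp add: okcond_def)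
  from cincr_avoid_finite[OF r True] obtain r' where
    r': "cincr r'" "range r' \<subseteq> range r - {x \<in> range r. \<exists>y. hit f d x y}" by blast
  have "okcond (Suc s) r' g"
    unfolding okcond_def
  proof (intro conjI ballI)
    fix x assume "x \<in> range r'"
    then have "2 ^ x \<le> 4 ^ s * card (free g x)" using r' ok by (auto simp: okcond_def)
    then show "2 ^ x \<le> 4 ^ Suc s * card (free g x)" by simp
  qed (use ok r' in \<open>auto simp: okcond_def\<close>)
  moreover have "decides f d (range r') g" unfolding decides_def using r'(2) by blast
  ultimately show thesis using r'(2) by (intro that[of r' g]) auto
next
  case False
  note okd = ok[unfolded okcond_def]
  have r: "cincr r" using ok by (simp add: okcond_def)
  have fc: "recfun t \<Longrightarrow> recfun (\<lambda>\<Phi> \<rho>. f (t \<Phi> \<rho>))" for t using f by (rule recfun_computable)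
  \<comment> \<open>The bound \<open>2 * s + 2 \<le> x\<close> makes \<open>2 ^ x\<close> divisible
    by \<open>4 ^ Suc s\<close>; the threshold \<open>\<theta> x\<close> below is the exact
    quotient.\<close>
  let ?P1 = "\<lambda>x w. pfst (f w) = Suc d \<and> pfst (psnd (f w)) = x \<and> 2 * s + 2 \<le> x"
  have P1: "recpred (\<lambda>\<Phi> \<rho>. ?P1 (\<rho> 0) (\<rho> 1))" by (intro rec_intros fc)
  have hit_iff: "(\<exists>y. hit f d x y) \<longleftrightarrow> (\<exists>w. pfst (f w) = Suc d \<and> pfst (psnd (f w)) = x)" for x
    unfolding hit_def by (metis pfst_pr pr_pfst_psnd psnd_pr)
  have inf1: "infinite {x \<in> range r. \<exists>w. ?P1 x w}"
  proof -
    have "{x \<in> range r. \<exists>y. hit f d x y} \<subseteq> {x \<in> range r. \<exists>w. ?P1 x w} \<union> {..<2 * s + 2}"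
      by (auto simp: hit_iff not_le)
    with False show ?thesis by (meson finite_Un finite_lessThan finite_subset)
  qed
  from infinite_ce_has_cincr[of r ?P1, OF r P1 inf1] obtain r2 \<omega>2 where
    r2: "cincr r2" "computable \<omega>2" "range r2 \<subseteq> range r" and r2P: "\<forall>k. ?P1 (r2 k) (\<omega>2 k)"
    by (elim exE conjE)
  \<comment> \<open>One hit at each place \<open>r2 k\<close> is made bad at once. It supplies the
    bad hit demanded by \<open>decides\<close>, whichever of the last two alternatives is
    reached.\<close>
  define y0 where "y0 k = psnd (psnd (f (\<omega>2 k)))" for k
  have hit0: "hit f d (r2 k) (y0 k)" for k
    unfolding hit_def y0_def using r2P[rule_format, of k] by (metis pr_pfst_psnd)
  have "computable (\<lambda>k. pr (r2 k) (y0 k))"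
    using r2 unfolding y0_def computable_iff_recfun cincr_def by (intro rec_intros fc) auto
  from extend_bd[of g, OF _ this] okd obtain g2 where
    g2: "computable g2" "\<And>x y. bd g2 x y \<longleftrightarrow> bd g x y \<or> (\<exists>k. pr (r2 k) (y0 k) = pr x y)" by blast
  have g2c: "recfun t \<Longrightarrow> recfun (\<lambda>\<Phi> \<rho>. g2 (t \<Phi> \<rho>))" for t using g2(1) by (rule recfun_computable)
  have bd01: "bd g2 0 1" using okd g2(2) by simp
  have inj2: "r2 k = r2 k' \<Longrightarrow> k = k'" for k k'
    using r2(1) strict_mono_eq unfolding cincr_def by blast
  define \<theta> where "\<theta> x = (2::nat) ^ (x - (2 * s + 2))" for x
  have \<theta>: "2 ^ x = 4 * 4 ^ s * \<theta> x" if "2 * s + 2 \<le> x" for x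
  proof -
    from that obtain k where "x = 2 * s + 2 + k" by (auto simp: le_iff_add)
    then show ?thesis by (simp add: \<theta>_def power_mult power_add)
  qed
  \<comment> \<open>The budget: \<open>4 * \<theta> x\<close> candidates are free at first, one is
    spent on \<open>y0\<close>, and \<open>2 * \<theta> x\<close> remain because
    \<open>\<theta> x \<ge> 1\<close>. Another \<open>\<theta> x\<close> may be spent below, and
    \<open>\<theta> x\<close> must survive.\<close>
  have free2: "2 * \<theta> x \<le> card (free g2 x)" if x: "x \<in> range r2" for x
  proof -
    from x obtain k where k: "x = r2 k" by blast
    have "free g x - {y0 k} \<subseteq> free g2 x"
      using inj2 by (auto simp: free_def g2(2) k)
    moreover have fin: "finite (free g2 x)"
      using free_finite[OF ok, of x] by (rule finite_subset[rotated, OF finite_subset[OF _ finite_lessThan[of "2 ^ x"]]])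
         (auto simp: free_def g2(2))
    ultimately have "card (free g x - {y0 k}) \<le> card (free g2 x)" by (simp add: card_mono)
    then have *: "card (free g x) \<le> Suc (card (free g2 x))"
      using card_Diff1_le[of "free g x" "y0 k"] by (cases "y0 k \<in> free g x")
        (simp_all add: card_Diff_singleton)
    have xs: "2 * s + 2 \<le> x" using r2P[rule_format, of k] k by simp
    have "2 ^ x \<le> 4 ^ s * card (free g x)" using okd r2(3) x by blast
    then have "4 * 4 ^ s * \<theta> x \<le> 4 ^ s * card (free g x)" by (simp only: \<theta>[OF xs])
    then have "4 * \<theta> x \<le> card (free g x)" by simp
    moreover have "1 \<le> \<theta> x" by (simp add: \<theta>_def)
    ultimately show ?thesis using * by linarith
  qed
  have bnd2: "2 ^ x \<le> y \<Longrightarrow> bd g2 x y" for x y using okd g2(2) by blast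
  define found where "found x y w \<longleftrightarrow> (\<exists>z<w. g2 z = pr x y \<or> f z = pr (Suc d) (pr x y))" for x y w
  have found_ex: "(\<exists>w. found x y w) \<longleftrightarrow> bd g2 x y \<or> hit f d x y" for x y
    unfolding found_def bd_def hit_def by blast
  have found_mono: "found x y w \<Longrightarrow> w \<le> w' \<Longrightarrow> found x y w'" for x y w w'
    unfolding found_def by (meson less_le_trans)
  have foundc: "recpred (\<lambda>\<Phi> \<rho>. found (t1 \<Phi> \<rho>) (t2 \<Phi> \<rho>) (t3 \<Phi> \<rho>))" if "recfun t1" "recfun t2" "recfun t3" for t1 t2 t3
    unfolding found_def
    by (intro rec_intros g2c fc recfun_shift[OF that(1)] recfun_shift[OF that(2)] that(3))
  \<comment> \<open>By stage \<open>w\<close> at most \<open>\<theta> x\<close> of the candidates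
    have not been found. As a decidable relation of \<open>x\<close> and \<open>w\<close> this can
    be thinned by \<open>infinite_ce_has_cincr\<close>, and the witness gives a computable
    stage.\<close>
  let ?P3 = "\<lambda>x w. 2 ^ x \<le> \<theta> x + card {y. y < 2 ^ x \<and> found x y w}"
  have P3: "recpred (\<lambda>\<Phi> \<rho>. ?P3 (\<rho> 0) (\<rho> 1))"
    unfolding \<theta>_def by (intro rec_intros recfun_card foundc)
  have le_found: "card {y. y < 2 ^ x \<and> \<not> found x y w} + card {y. y < 2 ^ x \<and> found x y w} = 2 ^ x" for x w
  proof -
    have "card ({y. y < 2 ^ x \<and> \<not> found x y w} \<union> {y. y < 2 ^ x \<and> found x y w}) =
        card {y. y < 2 ^ x \<and> \<not> found x y w} + card {y. y < 2 ^ x \<and> found x y w}"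
      by (rule card_Un_disjoint) auto
    moreover have "{y. y < 2 ^ x \<and> \<not> found x y w} \<union> {y. y < 2 ^ x \<and> found x y w} = {..<2 ^ x}" by auto
    ultimately show ?thesis by simp
  qed
  show thesis
  proof (cases "finite {x \<in> range r2. \<exists>w. ?P3 x w}")
    case True
    from cincr_avoid_finite[OF r2(1) True] obtain r' where
      r': "cincr r'" "range r' \<subseteq> range r2 - {x \<in> range r2. \<exists>w. ?P3 x w}" .
    then have r'2: "range r' \<subseteq> range r2" by (simp add: subset_iff)
    have "recpred (\<lambda>\<Phi> \<rho>. pfst (f (\<rho> 0)) = Suc d)" by (intro rec_intros fc)
    moreover have "computable (\<lambda>z. psnd (f z))" unfolding computable_iff_recfun by (intro rec_intros fc)
    ultimately obtain g' where g': "computable g'"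
      "\<And>x y. bd g' x y \<longleftrightarrow> bd g2 x y \<or> (\<exists>z. pfst (f z) = Suc d \<and> psnd (f z) = pr x y)"
      using extend_bd_pred[OF g2(1) bd01, of "\<lambda>z. pfst (f z) = Suc d" "\<lambda>z. psnd (f z)"] by blast
    have g'_iff: "bd g' x y \<longleftrightarrow> bd g2 x y \<or> hit f d x y" for x y
      unfolding g'(2) hit_def by (metis pfst_pr pr_pfst_psnd psnd_pr)
    have "okcond (Suc s) r' g'"
      unfolding okcond_def
    proof (intro conjI ballI)
      fix x assume x: "x \<in> range r'"
      then have x2: "x \<in> range r2" and nP: "\<not> ?P3 x w" for w using r'(2) by auto
      \<comment> \<open>Only finitely many candidates matter at \<open>x\<close>, so one stage finds
        all the bad ones; as \<open>?P3\<close> fails at that stage, more than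
        \<open>\<theta> x\<close> candidates stay free.\<close>
      have "\<exists>w. \<forall>y<n. bd g' x y \<longrightarrow> found x y w" for n
      proof (induction n)
        case (Suc n)
        then obtain w where w: "\<forall>y<n. bd g' x y \<longrightarrow> found x y w" by blast
        obtain w' where "bd g' x n \<longrightarrow> found x n w'" using found_ex g'_iff by blast
        with w have "\<forall>y<Suc n. bd g' x y \<longrightarrow> found x y (max w w')"
          using found_mono by (metis less_Suc_eq max.cobounded1 max.cobounded2)
        then show ?case by blast
      qed simp
      then obtain w where w: "\<And>y. y < 2 ^ x \<Longrightarrow> bd g' x y \<Longrightarrow> found x y w" by blast
      have "{y. y < 2 ^ x \<and> \<not> found x y w} \<subseteq> free g' x" using w by (auto simp: free_def)
      moreover have "finite (free g' x)"
        by (rule finite_subset[of _ "{..<2 ^ x}"]) (use bnd2 g'_iff in \<open>auto simp: free_def not_le[symmetric]\<close>)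
      ultimately have "card {y. y < 2 ^ x \<and> \<not> found x y w} \<le> card (free g' x)" by (rule card_mono[rotated])
      then have "\<theta> x \<le> card (free g' x)" using nP[of w] le_found[of x w] by linarith
      moreover have "2 * s + 2 \<le> x" using r2P x2 by auto
      ultimately show "2 ^ x \<le> 4 ^ Suc s * card (free g' x)" using \<theta> by simp
    qed (use r' g' bnd2 g'_iff in auto)
    moreover have "decides f d (range r') g'"
    proof -
      have "\<forall>x\<in>range r'. (\<exists>y. hit f d x y \<and> bd g' x y) \<and> (\<forall>y. hit f d x y \<longrightarrow> bd g' x y)"
      proof
        fix x assume "x \<in> range r'"
        with r'2 obtain k where "x = r2 k" by auto
        with hit0[of k] have "hit f d x (y0 k)" by simp
        then show "(\<exists>y. hit f d x y \<and> bd g' x y) \<and> (\<forall>y. hit f d x y \<longrightarrow> bd g' x y)"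
          by (auto simp: g'_iff)
      qed
      then show ?thesis unfolding decides_def by blast
    qed
    moreover have "range r' \<subseteq> range r" using r'2 r2(3) by (rule order_trans)
    moreover have "bd g x y \<Longrightarrow> bd g' x y" for x y by (simp add: g2(2) g'_iff)
    ultimately show thesis by (intro that[of r' g'])
  next
    case False
    from infinite_ce_has_cincr[of r2 ?P3, OF r2(1) P3 False] obtain r4 \<omega> where
      r4: "cincr r4" "computable \<omega>" "range r4 \<subseteq> range r2" and r4P: "\<forall>k. ?P3 (r4 k) (\<omega> k)"
      by (elim exE conjE)
    have r4c: "recfun t \<Longrightarrow> recfun (\<lambda>\<Phi> \<rho>. r4 (t \<Phi> \<rho>))" for t
      using r4(1) recfun_computable unfolding cincr_def by blast
    have \<omega>c: "recfun t \<Longrightarrow> recfun (\<lambda>\<Phi> \<rho>. \<omega> (t \<Phi> \<rho>))" for t using r4(2) by (rule recfun_computable)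
    have "recpred (\<lambda>\<Phi> \<rho>. \<not> found (r4 (pfst (\<rho> 0))) (psnd (\<rho> 0)) (\<omega> (pfst (\<rho> 0))))"
      by (intro rec_intros foundc r4c \<omega>c)
    moreover have "computable (\<lambda>z. pr (r4 (pfst z)) (psnd z))"
      unfolding computable_iff_recfun by (intro rec_intros r4c)
    ultimately obtain g' where g': "computable g'"
      "\<And>x y. bd g' x y \<longleftrightarrow> bd g2 x y \<or>
        (\<exists>z. \<not> found (r4 (pfst z)) (psnd z) (\<omega> (pfst z)) \<and> pr (r4 (pfst z)) (psnd z) = pr x y)"
      using extend_bd_pred[OF g2(1) bd01, of "\<lambda>z. \<not> found (r4 (pfst z)) (psnd z) (\<omega> (pfst z))"
          "\<lambda>z. pr (r4 (pfst z)) (psnd z)"] by blast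
    have inj4: "r4 k = r4 k' \<Longrightarrow> k = k'" for k k'
      using r4(1) strict_mono_eq unfolding cincr_def by blast
    have g'_iff: "bd g' (r4 k) y \<longleftrightarrow> bd g2 (r4 k) y \<or> \<not> found (r4 k) y (\<omega> k)" for k y
    proof -
      have "(\<exists>z. \<not> found (r4 (pfst z)) (psnd z) (\<omega> (pfst z)) \<and> pr (r4 (pfst z)) (psnd z) = pr (r4 k) y)
        \<longleftrightarrow> \<not> found (r4 k) y (\<omega> k)"
      proof
        assume "\<not> found (r4 k) y (\<omega> k)"
        then show "\<exists>z. \<not> found (r4 (pfst z)) (psnd z) (\<omega> (pfst z)) \<and> pr (r4 (pfst z)) (psnd z) = pr (r4 k) y"
          by (intro exI[of _ "pr k y"]) simp
      qed (auto dest: inj4)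
      then show ?thesis unfolding g'(2) by simp
    qed
    have "okcond (Suc s) r4 g'"
      unfolding okcond_def
    proof (intro conjI ballI)
      fix x assume "x \<in> range r4"
      then obtain k where k: "x = r4 k" by blast
      have sub: "free g2 x - {y. y < 2 ^ x \<and> \<not> found x y (\<omega> k)} \<subseteq> free g' x"
        using bnd2 by (auto simp: free_def k g'_iff not_less)
      have "finite (free g' x)"
        by (rule finite_subset[of _ "{..<2 ^ x}"]) (use bnd2 g'(2) in \<open>auto simp: free_def not_le[symmetric]\<close>)
      from card_mono[OF this sub]
      have "card (free g2 x) \<le> card (free g' x) + card {y. y < 2 ^ x \<and> \<not> found x y (\<omega> k)}"
        using diff_card_le_card_Diff[of "{y. y < 2 ^ x \<and> \<not> found x y (\<omega> k)}" "free g2 x"] by simp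
      moreover have "card {y. y < 2 ^ x \<and> \<not> found x y (\<omega> k)} \<le> \<theta> x"
        using r4P[rule_format, of k] le_found[of x "\<omega> k"] by (simp add: k)
      moreover have "x \<in> range r2" using r4(3) k by blast
      moreover note free2[OF this]
      ultimately have "\<theta> x \<le> card (free g' x)" by linarith
      moreover have "2 * s + 2 \<le> x" using r2P \<open>x \<in> range r2\<close> by auto
      ultimately show "2 ^ x \<le> 4 ^ Suc s * card (free g' x)" using \<theta> by simp
    qed (use r4 g' bnd2 in auto)
    moreover have "decides f d (range r4) g'"
    proof -
      have "(\<exists>y. hit f d x y \<and> bd g' x y) \<and> (\<forall>y. hit f d x y \<or> bd g' x y)" if x: "x \<in> range r4" for x
      proof -
        from x obtain k where k: "x = r4 k" by blast
        moreover from x r4(3) obtain k2 where "x = r2 k2" by auto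
        ultimately have k: "x = r4 k" "x = r2 k2" by simp_all
        have "hit f d x y \<or> bd g' x y" for y
          using found_ex[of x y] g'_iff[of k y] k(1) by auto
        moreover have "bd g2 x (y0 k2)" unfolding g2(2) using k(2) by auto
        then have "bd g' x (y0 k2)" using g'_iff[of k] k(1) by simp
        ultimately show ?thesis using hit0[of k2] k(2) by auto
      qed
      then show ?thesis unfolding decides_def by blast
    qed
    moreover have "range r4 \<subseteq> range r" using r4(3) r2(3) by (rule order_trans)
    moreover have "bd g x y \<Longrightarrow> bd g' x y" for x y by (simp add: g2(2) g'(2))
    ultimately show thesis by (intro that[of r4 g'])
  qed
qed

section \<open>The construction\<close>

text \<open>Every finite sequence is an initial segment of some \<open>phi l\<close>. Quantifiers
  over finite sequences thereby become number quantifiers over \<open>l\<close>, both for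
  cardinalities and for the covers in \<open>codes\<close>.\<close>

lemma computable_finite_sequence:
  fixes b :: "nat \<Rightarrow> nat"
  shows "\<exists>l. \<forall>a<n. phi l a = b a"
proof -
  have "computable (\<lambda>a. if a < n then b a else 0)"
  proof (induction n)
    case 0
    show ?case by (simp add: computable_iff_recfun recfun_const)
  next
    case (Suc n)
    have "recfun (\<lambda>\<Phi> \<rho>. if \<rho> 0 = n then b n else if \<rho> 0 < n then b (\<rho> 0) else 0)"
      by (rule recfun_if[OF recpred_eq[OF recfun_var recfun_const] recfun_const
            Suc[unfolded computable_iff_recfun]])
    moreover have "(if x = n then b n else if x < n then b x else 0) = (if x < Suc n then b x else 0)" for x
      by auto
    ultimately show ?case by (simp add: computable_iff_recfun)
  qed
  then obtain l where "phi l = (\<lambda>a. if a < n then b a else 0)" by (rule computable_ex_phi)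
  then show ?thesis by (intro exI[of _ l]) simp
qed

text \<open>\<open>pfst c\<close> is an index of the reservoir and \<open>psnd c\<close> of the
  enumeration of bad candidates. Requirement \<open>s\<close> concerns the function with index
  \<open>pfst s\<close> and the piece with number \<open>psnd s\<close>.\<close>

definition cstep :: "nat \<Rightarrow> nat \<Rightarrow> nat \<Rightarrow> bool" where
  "cstep s c c' \<longleftrightarrow> range (phi (pfst c')) \<subseteq> range (phi (pfst c)) \<and>
     (\<forall>x y. bd (phi (psnd c)) x y \<longrightarrow> bd (phi (psnd c')) x y) \<and>
     okcond (Suc s) (phi (pfst c')) (phi (psnd c')) \<and>
     const_or_finite_to_one (phi (pfst s)) (range (phi (pfst c'))) \<and>
     decides (phi (pfst s)) (psnd s) (range (phi (pfst c'))) (phi (psnd c'))"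

lemma okcond_subset: "okcond s r g \<Longrightarrow> cincr r' \<Longrightarrow> range r' \<subseteq> range r \<Longrightarrow> okcond s r' g"
  unfolding okcond_def by blast

lemma cstep_ex:
  assumes "okcond s (phi (pfst c)) (phi (psnd c))"
  shows "\<exists>c'. cstep s c c'"
proof -
  have "cincr (phi (pfst c))" using assms by (simp add: okcond_def)
  from thin_const_or_finite_to_one[OF this computable_phi[of "pfst s"]] obtain r1 where
    r1: "cincr r1" "range r1 \<subseteq> range (phi (pfst c))" "const_or_finite_to_one (phi (pfst s)) (range r1)" .
  from thin_decides[OF okcond_subset[OF assms r1(1,2)] computable_phi[of "pfst s"], of "psnd s"] obtain r' g' where
    r': "range r' \<subseteq> range r1" "\<And>x y. bd (phi (psnd c)) x y \<Longrightarrow> bd g' x y" "okcond (Suc s) r' g'"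
    "decides (phi (pfst s)) (psnd s) (range r') g'" by blast
  from r'(3) have "computable r'" "computable g'" by (simp_all add: okcond_def cincr_def)
  then obtain a b where ab: "phi a = r'" "phi b = g'" by (metis computable_ex_phi)
  show ?thesis
    by (rule exI[of _ "pr a b"])
      (use r' r1 const_or_finite_to_one_subset[OF r1(3) r'(1)] in \<open>auto simp: cstep_def ab\<close>)
qed

lemma okcond_init: "\<exists>c. okcond 0 (phi (pfst c)) (phi (psnd c))"
proof -
  define g where "g z = (if 2 ^ pfst z \<le> psnd z then z else pr 0 1)" for z
  have bd: "bd g x y \<longleftrightarrow> 2 ^ x \<le> y" for x y
  proof
    show "bd g x y \<Longrightarrow> 2 ^ x \<le> y" unfolding bd_def g_def by (auto split: if_splits)
    show "2 ^ x \<le> y \<Longrightarrow> bd g x y" unfolding bd_def g_def by (intro exI[of _ "pr x y"]) simp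
  qed
  have free: "free g x = {..<2 ^ x}" for x by (auto simp: free_def bd)
  have "computable g" unfolding g_def computable_iff_recfun by (intro rec_intros)
  moreover have "computable (\<lambda>x. x)" by (simp add: computable_iff_recfun recfun_var)
  ultimately obtain a b where ab: "phi a = (\<lambda>x. x)" "phi b = g" by (metis computable_ex_phi)
  show ?thesis
    by (rule exI[of _ "pr a b"])
      (simp add: okcond_def ab cincr_def bd free \<open>computable g\<close> \<open>computable (\<lambda>x. x)\<close> strict_mono_def)
qed

text \<open>Taking least codes makes the sequence the only solution of its recursion, hence
  definable by \<open>Dfun_unique_solution\<close>. It depends neither on \<open>Y\<close> nor on
  the family.\<close>

primrec st :: "nat \<Rightarrow> nat" where
  "st 0 = (LEAST c. okcond 0 (phi (pfst c)) (phi (psnd c)))"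
| "st (Suc s) = (LEAST c'. cstep s (st s) c')"

definition Rset :: "nat \<Rightarrow> nat set" where "Rset s = range (phi (pfst (st s)))"
definition Bad :: "nat \<Rightarrow> nat \<Rightarrow> nat \<Rightarrow> bool" where "Bad s x y \<longleftrightarrow> bd (phi (psnd (st s))) x y"

lemma okcond_st: "okcond s (phi (pfst (st s))) (phi (psnd (st s)))"
proof (induction s)
  case 0
  show ?case using LeastI_ex[OF okcond_init] by simp
next
  case (Suc s)
  from LeastI_ex[OF cstep_ex[OF this]] show ?case by (simp add: cstep_def)
qed

lemma cstep_st: "cstep s (st s) (st (Suc s))"
  using LeastI_ex[OF cstep_ex[OF okcond_st]] by simp

lemma Rset_antimono: "s \<le> s' \<Longrightarrow> Rset s' \<subseteq> Rset s"
proof (induction rule: dec_induct)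
  case (step n)
  with cstep_st[of n] show ?case unfolding cstep_def Rset_def by blast
qed simp

lemma Bad_mono: "s \<le> s' \<Longrightarrow> Bad s x y \<Longrightarrow> Bad s' x y"
proof (induction rule: dec_induct)
  case (step n)
  with cstep_st[of n] show ?case unfolding cstep_def Bad_def by blast
qed

lemma Rset_cincr: "\<exists>r. cincr r \<and> Rset s = range r"
  using okcond_st[of s] unfolding okcond_def Rset_def by blast

lemma Rset_unbounded: "\<exists>x\<in>Rset s. b \<le> x"
  using Rset_cincr[of s] cincr_unbounded by (metis rangeI)

lemma Bad_free:
  assumes "x \<in> Rset s"
  shows "2 ^ x \<le> 4 ^ s * card {y. \<not> Bad s x y}" "finite {y. \<not> Bad s x y}" "{y. \<not> Bad s x y} \<subseteq> {..<2 ^ x}"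
  using assms okcond_st[of s] free_finite[OF okcond_st[of s], of x] finite_subset[OF _ finite_lessThan]
  unfolding okcond_def Rset_def Bad_def free_def by blast+

lemma Rset_const_or_finite_to_one: "const_or_finite_to_one (phi (pfst s)) (Rset (Suc s))"
  using cstep_st[of s] unfolding cstep_def Rset_def by blast

lemma Rset_decides: "decides (phi (pfst s)) (psnd s) (Rset (Suc s)) (phi (psnd (st (Suc s))))"
  using cstep_st[of s] unfolding cstep_def Rset_def by blast

text \<open>Only number quantifiers remain: computability is automatic for \<open>phi\<close>, and a
  lower bound on a cardinality becomes an injective list of \<open>K\<close> free candidates with
  index \<open>l\<close>.\<close>

lemma okcond_arith:
  "okcond s (phi r) (phi g) \<longleftrightarrow> (\<forall>n. phi r n < phi r (Suc n)) \<and> (\<forall>x y. 2 ^ x \<le> y \<longrightarrow> bd (phi g) x y) \<and>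
     (\<forall>n. \<exists>l K. 2 ^ phi r n \<le> 4 ^ s * K \<and> (\<forall>a. a < K \<longrightarrow> \<not> bd (phi g) (phi r n) (phi l a)) \<and>
       (\<forall>a b. a < b \<longrightarrow> b < K \<longrightarrow> phi l a \<noteq> phi l b))"
proof -
  have "2 ^ x \<le> 4 ^ s * card (free (phi g) x) \<longleftrightarrow>
     (\<exists>l K. 2 ^ x \<le> 4 ^ s * K \<and> (\<forall>a. a < K \<longrightarrow> \<not> bd (phi g) x (phi l a)) \<and>
       (\<forall>a b. a < b \<longrightarrow> b < K \<longrightarrow> phi l a \<noteq> phi l b))"
    if "\<forall>x y. 2 ^ x \<le> y \<longrightarrow> bd (phi g) x y" for x
  proof -
    have fin: "finite (free (phi g) x)"
      by (rule finite_subset[of _ "{..<2 ^ x}"]) (use that in \<open>auto simp: free_def not_le[symmetric]\<close>)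
    show ?thesis
    proof
      assume le: "2 ^ x \<le> 4 ^ s * card (free (phi g) x)"
      obtain b where b: "bij_betw b {0..<card (free (phi g) x)} (free (phi g) x)"
        using ex_bij_betw_nat_finite[OF fin] by blast
      obtain l where l: "\<And>a. a < card (free (phi g) x) \<Longrightarrow> phi l a = b a"
        using computable_finite_sequence by metis
      have 1: "\<not> bd (phi g) x (phi l a)" if "a < card (free (phi g) x)" for a
        using bij_betwE[OF b] that l[OF that] by (auto simp: free_def)
      have 2: "phi l a \<noteq> phi l a'" if "a < a'" "a' < card (free (phi g) x)" for a a'
        using bij_betw_imp_inj_on[OF b] that l[of a] l[of a'] by (auto dest: inj_onD)
      show "\<exists>l K. 2 ^ x \<le> 4 ^ s * K \<and> (\<forall>a. a < K \<longrightarrow> \<not> bd (phi g) x (phi l a)) \<and>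
       (\<forall>a b. a < b \<longrightarrow> b < K \<longrightarrow> phi l a \<noteq> phi l b)"
        using le 1 2 by blast
    next
      assume "\<exists>l K. 2 ^ x \<le> 4 ^ s * K \<and> (\<forall>a. a < K \<longrightarrow> \<not> bd (phi g) x (phi l a)) \<and>
       (\<forall>a b. a < b \<longrightarrow> b < K \<longrightarrow> phi l a \<noteq> phi l b)"
      then obtain l K where lK: "2 ^ x \<le> 4 ^ s * K" "\<And>a. a < K \<Longrightarrow> \<not> bd (phi g) x (phi l a)"
        "\<And>a b. a < b \<Longrightarrow> b < K \<Longrightarrow> phi l a \<noteq> phi l b" by blast
      have "inj_on (phi l) {..<K}" by (rule linorder_inj_onI) (use lK(3) in auto)
      then have "K \<le> card (free (phi g) x)"
        using card_inj_on_le[of "phi l" "{..<K}" "free (phi g) x"] lK(2) fin by (auto simp: free_def)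
      then show "2 ^ x \<le> 4 ^ s * card (free (phi g) x)"
        using lK(1) by (meson le_trans mult_le_mono2)
    qed
  qed
  then show ?thesis
    unfolding okcond_def cincr_def strict_mono_Suc_iff using computable_phi by (auto simp del: One_nat_def)
qed

lemma Delta_bd:
  assumes "Dfun (Suc k) g" "Dfun (Suc k) x" "Dfun (Suc k) y"
  shows "Delta (Suc k) (\<lambda>\<Phi> \<rho>. bd (phi (g \<Phi> \<rho>)) (x \<Phi> \<rho>) (y \<Phi> \<rho>))"
  unfolding bd_def by (intro D_intros Dfun_phi Dfun_shift[OF assms(1)] Dfun_shift[OF assms(2)] Dfun_shift[OF assms(3)])

lemma Delta_hit:
  assumes "Dfun (Suc k) f" "Dfun (Suc k) d" "Dfun (Suc k) x" "Dfun (Suc k) y"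
  shows "Delta (Suc k) (\<lambda>\<Phi> \<rho>. hit (phi (f \<Phi> \<rho>)) (d \<Phi> \<rho>) (x \<Phi> \<rho>) (y \<Phi> \<rho>))"
  unfolding hit_def
  by (intro D_intros Dfun_phi Dfun_shift[OF assms(1)] Dfun_shift[OF assms(2)] Dfun_shift[OF assms(3)] Dfun_shift[OF assms(4)])

lemma Delta_cstep_var: "Delta (Suc k) (\<lambda>\<Phi> \<rho>. cstep (\<rho> a) (\<rho> b) (\<rho> c))"
  unfolding cstep_def okcond_arith const_or_finite_to_one_def decides_def subset_eq ball_simps image_iff bex_UNIV ball_UNIV
  by (intro D_intros Dfun_phi Delta_bd Delta_hit)

text \<open>From variables to terms, by quantifying over the values of the terms.\<close>

lemma Delta_cstep:
  assumes "Dfun (Suc k) s" "Dfun (Suc k) t" "Dfun (Suc k) u"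
  shows "Delta (Suc k) (\<lambda>\<Phi> \<rho>. cstep (s \<Phi> \<rho>) (t \<Phi> \<rho>) (u \<Phi> \<rho>))"
proof -
  have "Delta (Suc k) (\<lambda>\<Phi> \<rho>. \<exists>x y z. x = s \<Phi> \<rho> \<and> y = t \<Phi> \<rho> \<and> z = u \<Phi> \<rho> \<and> cstep x y z)"
    by (intro D_intros Delta_cstep_var Dfun_shift assms)
  then show ?thesis by simp
qed

lemma Dfun_st_var: "Dfun (Suc k) (\<lambda>\<Phi> \<rho>. st (\<rho> 0))"
proof (rule Dfun_unique_solution[of k "\<lambda>h \<Phi>. h 0 = st 0 \<and>
    (\<forall>s. cstep s (h s) (h (Suc s)) \<and> (\<forall>c'. c' < h (Suc s) \<longrightarrow> \<not> cstep s (h s) c'))" "\<lambda>_. st"])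
  show "Delta (Suc k) (\<lambda>\<Phi> \<rho>. \<Phi> 0 0 = st 0 \<and>
    (\<forall>s. cstep s (\<Phi> 0 s) (\<Phi> 0 (Suc s)) \<and> (\<forall>c'. c' < \<Phi> 0 (Suc s) \<longrightarrow> \<not> cstep s (\<Phi> 0 s) c')))"
    by (intro D_intros Delta_cstep)
  show "st 0 = st 0 \<and> (\<forall>s. cstep s (st s) (st (Suc s)) \<and> (\<forall>c'. c' < st (Suc s) \<longrightarrow> \<not> cstep s (st s) c'))"
    using cstep_st not_less_Least by auto
  fix h assume h: "h 0 = st 0 \<and>
    (\<forall>s. cstep s (h s) (h (Suc s)) \<and> (\<forall>c'. c' < h (Suc s) \<longrightarrow> \<not> cstep s (h s) c'))"
  have "h s = st s" for s
  proof (induction s)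
    case (Suc s)
    from h have "cstep s (h s) (h (Suc s))" "\<And>c'. c' < h (Suc s) \<Longrightarrow> \<not> cstep s (h s) c'" by blast+
    then have "st (Suc s) = h (Suc s)"
      unfolding st.simps Suc by (intro Least_equality) (auto simp: not_less[symmetric])
    then show ?case ..
  qed (use h in simp)
  then show "h = st" by (rule ext)
qed

lemma Dfun_st: "Dfun (Suc k) s \<Longrightarrow> Dfun (Suc k) (\<lambda>\<Phi> \<rho>. st (s \<Phi> \<rho>))"
  by (rule Dfun_comp1[OF Dfun_st_var])

lemma Delta_Bad:
  "Dfun (Suc k) s \<Longrightarrow> Dfun (Suc k) x \<Longrightarrow> Dfun (Suc k) y \<Longrightarrow> Delta (Suc k) (\<lambda>\<Phi> \<rho>. Bad (s \<Phi> \<rho>) (x \<Phi> \<rho>) (y \<Phi> \<rho>))"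
  unfolding Bad_def by (intro Delta_bd D_intros Dfun_st)

section \<open>The sparse set of elements\<close>

definition Lp :: "nat \<Rightarrow> nat" where "Lp p = Suc (pr p (pr p p))"

text \<open>Element number \<open>p\<close> will be taken from the reservoir of stage
  \<open>Lp p\<close>, where all requirements on functions and pieces with parameters up to
  \<open>p\<close> are already settled.\<close>

lemma less_Lp: "e \<le> p \<Longrightarrow> i \<le> p \<Longrightarrow> j \<le> p \<Longrightarrow> pr e (pr i j) < Lp p"
  unfolding Lp_def by (simp add: le_imp_less_Suc pr_mono)

text \<open>\<open>u\<close> is the previous element. The bound with \<open>p + 2\<close> leaves
  that many free candidates at \<open>x\<close>. The next clause puts \<open>x\<close> above the
  values of early functions at all indices attached to earlier elements, as
  \<open>pr u (2 ^ u)\<close> bounds those. The last one makes an early function that is not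
  constant on the reservoir exceed, at \<open>x\<close>, every \<open>pr d v\<close> with
  \<open>d \<le> Suc (pr p p)\<close> and \<open>v \<le> u\<close>.\<close>

definition cspec :: "nat \<Rightarrow> nat \<Rightarrow> nat \<Rightarrow> bool" where
  "cspec p u x \<longleftrightarrow> x \<in> Rset (Lp p) \<and> u < x \<and> 4 ^ Lp p * (p + 2) < 2 ^ x \<and>
     (\<forall>e w. e \<le> p \<longrightarrow> w \<le> pr u (2 ^ u) \<longrightarrow> phi e w < x) \<and>
     (\<forall>e. e \<le> p \<longrightarrow> (\<exists>v. \<forall>z. z \<in> Rset (Lp p) \<longrightarrow> phi e z = v) \<or> pr (Suc (pr p p)) u < phi e x)"

lemma bound_ex:
  fixes P :: "nat \<Rightarrow> nat \<Rightarrow> bool"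
  assumes "\<And>e. e \<le> n \<Longrightarrow> \<exists>b. \<forall>x\<ge>b. P e x"
  shows "\<exists>b. \<forall>e\<le>n. \<forall>x\<ge>b. P e x"
  using assms
proof (induction n)
  case (Suc n)
  then obtain b where "\<forall>e\<le>n. \<forall>x\<ge>b. P e x" by (meson le_SucI)
  moreover from Suc.prems[of "Suc n"] obtain b' where "\<forall>x\<ge>b'. P (Suc n) x" by auto
  ultimately have "\<forall>e\<le>Suc n. \<forall>x\<ge>max b b'. P e x" by (simp add: le_Suc_eq)
  then show ?case by blast
qed (use assms in auto)

text \<open>Each clause holds at all large places of the reservoir; for the last one, a
  finite-to-one function eventually leaves every bounded set of values.\<close>

lemma cspec_ex: "\<exists>x. cspec p u x"
proof -
  have 1: "\<exists>b. \<forall>x\<ge>b. x \<in> Rset (Lp p) \<longrightarrow>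
      (\<exists>v. \<forall>z. z \<in> Rset (Lp p) \<longrightarrow> phi e z = v) \<or> pr (Suc (pr p p)) u < phi e x" if "e \<le> p" for e
  proof -
    have "const_or_finite_to_one (phi e) (Rset (Lp p))"
      using const_or_finite_to_one_subset[OF Rset_const_or_finite_to_one[of "pr e (pr 0 0)"] Rset_antimono[of "Suc (pr e (pr 0 0))" "Lp p"]]
        less_Lp[of e p 0 0] that by simp
    then show ?thesis
      unfolding const_or_finite_to_one_def
    proof
      assume "\<forall>v. \<exists>b. \<forall>x\<in>Rset (Lp p). phi e x = v \<longrightarrow> x \<le> b"
      then have "\<exists>b. \<forall>x\<ge>b. x \<in> Rset (Lp p) \<longrightarrow> phi e x \<noteq> v" for v
        by (meson not_less_eq_eq)
      from bound_ex[of "pr (Suc (pr p p)) u" "\<lambda>v x. x \<in> Rset (Lp p) \<longrightarrow> phi e x \<noteq> v", OF this]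
      obtain b where "\<forall>v\<le>pr (Suc (pr p p)) u. \<forall>x\<ge>b. x \<in> Rset (Lp p) \<longrightarrow> phi e x \<noteq> v" ..
      then have "\<forall>x\<ge>b. x \<in> Rset (Lp p) \<longrightarrow> pr (Suc (pr p p)) u < phi e x" by (auto simp: not_le[symmetric])
      then show ?thesis by blast
    qed blast
  qed
  have "\<exists>b. \<forall>e\<le>p. \<forall>x\<ge>b. x \<in> Rset (Lp p) \<longrightarrow>
      (\<exists>v. \<forall>z. z \<in> Rset (Lp p) \<longrightarrow> phi e z = v) \<or> pr (Suc (pr p p)) u < phi e x"
    by (rule bound_ex) (rule 1)
  then obtain b1 where b1: "\<forall>e\<le>p. \<forall>x\<ge>b1. x \<in> Rset (Lp p) \<longrightarrow>
      (\<exists>v. \<forall>z. z \<in> Rset (Lp p) \<longrightarrow> phi e z = v) \<or> pr (Suc (pr p p)) u < phi e x" by blast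
  have "\<exists>b. \<forall>w\<le>pr u (2 ^ u). \<forall>x\<ge>b. phi e w < x" for e
    by (rule bound_ex) (meson Suc_le_lessD)
  then have "\<exists>b. \<forall>x\<ge>b. \<forall>w\<le>pr u (2 ^ u). phi e w < x" for e by blast
  then have "\<exists>b. \<forall>e\<le>p. \<forall>x\<ge>b. \<forall>w\<le>pr u (2 ^ u). phi e w < x" by (intro bound_ex)
  then obtain b2 where b2: "\<forall>e\<le>p. \<forall>x\<ge>b2. \<forall>w\<le>pr u (2 ^ u). phi e w < x" by blast
  obtain x where x: "x \<in> Rset (Lp p)" "b1 + b2 + Suc u + 4 ^ Lp p * (p + 2) \<le> x"
    using Rset_unbounded by blast
  have "4 ^ Lp p * (p + 2) < 2 ^ x" using x(2) less_exp[of x] by linarith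
  with x b1 b2 have "cspec p u x" unfolding cspec_def by auto
  then show ?thesis ..
qed

primrec cq :: "nat \<Rightarrow> nat" where
  "cq 0 = (LEAST x. cspec 0 0 x)"
| "cq (Suc p) = (LEAST x. cspec (Suc p) (cq p) x)"

lemma cspec_cq_0: "cspec 0 0 (cq 0)" and cspec_cq_Suc: "cspec (Suc p) (cq p) (cq (Suc p))"
  using LeastI_ex[OF cspec_ex] by simp_all

lemma cspec_cq: "\<exists>u. cspec p u (cq p) \<and> (\<forall>q<p. cq q \<le> u)"
proof (cases p)
  case (Suc n)
  have "q < Suc n \<Longrightarrow> cq q \<le> cq n" for q
    by (rule lift_Suc_mono_le[of cq]) (use cspec_cq_Suc in \<open>auto simp: cspec_def less_imp_le\<close>)
  with Suc show ?thesis using cspec_cq_Suc by blast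
qed (use cspec_cq_0 in blast)

lemma cq_strict_mono: "strict_mono cq"
  unfolding strict_mono_Suc_iff using cspec_cq_Suc by (simp add: cspec_def)

lemma cq_eq_iff: "cq p = cq q \<longleftrightarrow> p = q"
  by (rule strict_mono_eq[OF cq_strict_mono])

lemma cq_in_Rset: "s \<le> Lp p \<Longrightarrow> cq p \<in> Rset s"
  using cspec_cq[of p] Rset_antimono[of s "Lp p"] unfolding cspec_def by blast

text \<open>A pair is at least as large as its components, so an index that mentions
  \<open>cq q\<close> is not below \<open>cq q\<close>. Hence an early function, applied to an index
  attached to \<open>cq p\<close>, never points to a later element.\<close>

lemma cq_dominates:
  assumes "e \<le> q" "p < q" "w \<le> pr (cq p) (2 ^ cq p)"
  shows "phi e w < cq q"
proof -
  from cspec_cq[of q] obtain u where u: "cspec q u (cq q)" "cq p \<le> u" using assms(2) by blast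
  have "pr (cq p) (2 ^ cq p) \<le> pr u (2 ^ u)" using u(2) by (intro pr_mono) auto
  with u(1) assms show ?thesis unfolding cspec_def by (meson le_trans)
qed

text \<open>The complement of \<open>cq_dominates\<close>: an early function that points from
  \<open>cq p\<close> back to an earlier element must be constant on the reservoir.\<close>

lemma cq_avoids:
  assumes "e \<le> p"
  shows "(\<exists>v. \<forall>z\<in>Rset (Lp p). phi e z = v) \<or> (\<forall>q<p. \<forall>d\<le>Suc (pr p p). pr d (cq q) < phi e (cq p))"
proof -
  from cspec_cq[of p] obtain u where u: "cspec p u (cq p)" "\<forall>q<p. cq q \<le> u" by blast
  from u(1) assms consider "\<exists>v. \<forall>z\<in>Rset (Lp p). phi e z = v" | "pr (Suc (pr p p)) u < phi e (cq p)"
    unfolding cspec_def by blast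
  then show ?thesis
  proof cases
    case 2
    have "pr d (cq q) < phi e (cq p)" if "q < p" "d \<le> Suc (pr p p)" for q d
    proof -
      have "pr d (cq q) \<le> pr (Suc (pr p p)) u" using that u(2) by (intro pr_mono) auto
      with 2 show ?thesis by simp
    qed
    then show ?thesis by blast
  qed blast
qed

section \<open>Candidates and choice of the exceptional copies\<close>

definition cand :: "nat \<Rightarrow> nat set" where "cand p = {y. \<not> Bad (Lp p) (cq p) y}"

lemma cand: "finite (cand p)" "p + 2 \<le> card (cand p)" "y \<in> cand p \<Longrightarrow> y < 2 ^ cq p"
proof -
  have in_R: "cq p \<in> Rset (Lp p)" by (rule cq_in_Rset) simp
  from Bad_free[OF in_R] show "finite (cand p)" "y \<in> cand p \<Longrightarrow> y < 2 ^ cq p"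
    unfolding cand_def by blast+
  have "4 ^ Lp p * (p + 2) < 2 ^ cq p" using cspec_cq[of p] by (auto simp: cspec_def)
  with Bad_free(1)[OF in_R] have "4 ^ Lp p * (p + 2) < 4 ^ Lp p * card (cand p)"
    unfolding cand_def by linarith
  then show "p + 2 \<le> card (cand p)" by (simp only: mult_less_cancel1 less_imp_le)
qed

lemma Delta_Rset:
  "Dfun (Suc k) s \<Longrightarrow> Dfun (Suc k) x \<Longrightarrow> Delta (Suc k) (\<lambda>\<Phi> \<rho>. x \<Phi> \<rho> \<in> Rset (s \<Phi> \<rho>))"
  unfolding Rset_def image_iff bex_UNIV by (intro D_intros Dfun_phi Dfun_st Dfun_shift)

lemma Dfun_Lp: "Dfun k s \<Longrightarrow> Dfun k (\<lambda>\<Phi> \<rho>. Lp (s \<Phi> \<rho>))"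
  unfolding Lp_def by (intro D_intros)

lemma Delta_cspec:
  assumes "Dfun (Suc k) s" "Dfun (Suc k) t" "Dfun (Suc k) u"
  shows "Delta (Suc k) (\<lambda>\<Phi> \<rho>. cspec (s \<Phi> \<rho>) (t \<Phi> \<rho>) (u \<Phi> \<rho>))"
proof -
  have "Delta (Suc k) (\<lambda>\<Phi> \<rho>. cspec (\<rho> a) (\<rho> b) (\<rho> c))" for a b c
    unfolding cspec_def by (intro D_intros Delta_Rset Dfun_Lp Dfun_phi)
  then have "Delta (Suc k) (\<lambda>\<Phi> \<rho>. \<exists>x y z. x = s \<Phi> \<rho> \<and> y = t \<Phi> \<rho> \<and> z = u \<Phi> \<rho> \<and> cspec x y z)"
    by (intro D_intros Dfun_shift assms)
  then show ?thesis by simp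
qed

lemma Dfun_cq_var: "Dfun (Suc k) (\<lambda>\<Phi> \<rho>. cq (\<rho> 0))"
proof (rule Dfun_unique_solution[of k "\<lambda>h \<Phi>. h 0 = cq 0 \<and>
    (\<forall>s. cspec (Suc s) (h s) (h (Suc s)) \<and> (\<forall>c'. c' < h (Suc s) \<longrightarrow> \<not> cspec (Suc s) (h s) c'))" "\<lambda>_. cq"])
  show "Delta (Suc k) (\<lambda>\<Phi> \<rho>. \<Phi> 0 0 = cq 0 \<and>
    (\<forall>s. cspec (Suc s) (\<Phi> 0 s) (\<Phi> 0 (Suc s)) \<and> (\<forall>c'. c' < \<Phi> 0 (Suc s) \<longrightarrow> \<not> cspec (Suc s) (\<Phi> 0 s) c')))"
    by (intro D_intros Delta_cspec)
  show "cq 0 = cq 0 \<and> (\<forall>s. cspec (Suc s) (cq s) (cq (Suc s)) \<and> (\<forall>c'. c' < cq (Suc s) \<longrightarrow> \<not> cspec (Suc s) (cq s) c'))"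
    using cspec_cq_Suc not_less_Least by auto
  fix h assume h: "h 0 = cq 0 \<and>
    (\<forall>s. cspec (Suc s) (h s) (h (Suc s)) \<and> (\<forall>c'. c' < h (Suc s) \<longrightarrow> \<not> cspec (Suc s) (h s) c'))"
  have "h s = cq s" for s
  proof (induction s)
    case (Suc s)
    from h have "cspec (Suc s) (h s) (h (Suc s))" "\<And>c'. c' < h (Suc s) \<Longrightarrow> \<not> cspec (Suc s) (h s) c'" by blast+
    then have "cq (Suc s) = h (Suc s)"
      unfolding cq.simps Suc by (intro Least_equality) (auto simp: not_less[symmetric])
    then show ?case ..
  qed (use h in simp)
  then show "h = cq" by (rule ext)
qed

lemma Dfun_cq: "Dfun (Suc k) s \<Longrightarrow> Dfun (Suc k) (\<lambda>\<Phi> \<rho>. cq (s \<Phi> \<rho>))"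
  by (rule Dfun_comp1[OF Dfun_cq_var])

lemma Delta_cand: "Dfun (Suc k) p \<Longrightarrow> Dfun (Suc k) y \<Longrightarrow> Delta (Suc k) (\<lambda>\<Phi> \<rho>. y \<Phi> \<rho> \<in> cand (p \<Phi> \<rho>))"
  unfolding cand_def mem_Collect_eq by (intro D_intros Delta_Bad Dfun_Lp Dfun_cq)

text \<open>The default exceptional copy, for the pieces against which no diagonalisation takes
  place at \<open>p\<close>.\<close>

definition ell :: "nat \<Rightarrow> nat" where "ell p = (LEAST y. y \<in> cand p)"

lemma cand_nonempty: "\<exists>y. y \<in> cand p"
  using cand(2)[of p] by (metis add_2_eq_Suc' card.empty equals0I not_less_eq_eq zero_le)

lemma ell_in_cand: "ell p \<in> cand p"
  unfolding ell_def by (rule LeastI_ex[OF cand_nonempty])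

lemma Dfun_ell: "Dfun (Suc k) s \<Longrightarrow> Dfun (Suc k) (\<lambda>\<Phi> \<rho>. ell (s \<Phi> \<rho>))"
proof (rule Dfun_comp1[of _ ell])
  show "Dfun (Suc k) (\<lambda>\<Phi> \<rho>. ell (\<rho> 0))"
    unfolding ell_def by (intro Dfun_Least Delta_cand D_intros cand_nonempty)
qed

text \<open>
  The number \<open>p = \<langle>Suc i, \<langle>e, \<langle>j, k\<rangle>\<rangle>\<rangle>\<close> is reserved for diagonalising against \<open>phi e\<close> as a reduction
  of piece \<open>(i, j)\<close>; numbers \<open>\<langle>0, q\<rangle>\<close> carry the given numbering of the family.
\<close>

definition eidx :: "nat \<Rightarrow> nat" where "eidx p = pfst (psnd p)"
definition jidx :: "nat \<Rightarrow> nat" where "jidx p = pfst (psnd (psnd p))"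

text \<open>Just one piece at \<open>q\<close> uses the copy chosen by diagonalisation. The others
  use the default, so their colours at \<open>q\<close> are known before that choice is
  made.\<close>

definition nx :: "(nat \<Rightarrow> nat) \<Rightarrow> nat \<Rightarrow> nat \<Rightarrow> nat" where
  "nx h q j = (if j = jidx q then h q else ell q)"

text \<open>The indices outside column 0 with the first colour, sorted by the element
  \<open>q\<close> responsible. Piece 0 has no exception and serves the atom; pieces
  \<open>1\<close> to \<open>i + 1\<close> serve its covers.\<close>

definition inM :: "nat set \<Rightarrow> (nat \<Rightarrow> nat) \<Rightarrow> nat \<Rightarrow> nat \<Rightarrow> bool" where
  "inM Y h t q \<longleftrightarrow> (\<exists>i j y. t = pr (Suc (pr i j)) (pr (cq q) y) \<and> pfst q = Suc i \<and> i \<in> Y \<and> j \<le> Suc i \<and>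
     (j = 0 \<or> y \<noteq> nx h q j))"

text \<open>The part of the first colour class that is known when the exceptional copy at
  \<open>p\<close> is chosen: earlier elements, and \<open>p\<close> itself outside the piece under
  treatment.\<close>

definition isM :: "nat set \<Rightarrow> (nat \<Rightarrow> nat) \<Rightarrow> nat \<Rightarrow> nat \<Rightarrow> bool" where
  "isM Y h p t \<longleftrightarrow> (\<exists>q. q < p \<and> inM Y h t q) \<or>
     (\<exists>i j y. t = pr (Suc (pr i j)) (pr (cq p) y) \<and> pfst p = Suc i \<and> i \<in> Y \<and> j \<le> Suc i \<and> j \<noteq> jidx p \<and>
       (j = 0 \<or> y \<noteq> ell p))"

text \<open>The earlier family items. They may have any colour of the family, so no disagreement can
  be based on them.\<close>

definition isSig :: "nat \<Rightarrow> nat \<Rightarrow> bool" where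
  "isSig p t \<longleftrightarrow> (\<exists>q. q < p \<and> pfst q = 0 \<and> t = pr 0 (cq q))"

definition target :: "nat \<Rightarrow> nat \<Rightarrow> nat" where "target p y = phi (eidx p) (pr (cq p) y)"

text \<open>Three ways for the exceptional copy \<open>v\<close> to defeat the reduction:
  \<open>y\<close> gets the second colour while its target has the first; \<open>y\<close> gets the
  first colour while its target has not; or \<open>y\<close> and \<open>y'\<close> get different
  colours and share a target.\<close>

definition espec :: "nat set \<Rightarrow> (nat \<Rightarrow> nat) \<Rightarrow> nat \<Rightarrow> nat \<Rightarrow> bool" where
  "espec Y h p v \<longleftrightarrow> v \<in> cand p \<and> (\<exists>y. y \<in> cand p \<and>
     (v = y \<and> isM Y h p (target p y) \<or>
      v \<noteq> y \<and> \<not> isM Y h p (target p y) \<and> \<not> isSig p (target p y) \<or>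
      v = y \<and> (\<exists>y'. y' \<in> cand p \<and> y' \<noteq> y \<and> target p y' = target p y)))"

text \<open>If the first two ways fail, all targets are among at most \<open>p\<close> family items,
  and with \<open>p + 2\<close> candidates two targets coincide. The second way needs two
  candidates, which are there even for \<open>p = 0\<close>.\<close>

lemma espec_ex: "\<exists>v. espec Y h p v"
proof -
  consider y where "y \<in> cand p" "isM Y h p (target p y)"
    | y where "y \<in> cand p" "\<not> isM Y h p (target p y)" "\<not> isSig p (target p y)"
    | "\<And>y. y \<in> cand p \<Longrightarrow> isSig p (target p y)" by blast
  then show ?thesis
  proof cases
    case 1
    then show ?thesis unfolding espec_def by blast
  next
    case 2
    have "\<not> cand p \<subseteq> {y}" using cand(2)[of p] card_mono[of "{y}" "cand p"] by auto
    then obtain v where "v \<in> cand p" "v \<noteq> y" by blast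
    with 2 show ?thesis unfolding espec_def by blast
  next
    case 3
    then have "target p ` cand p \<subseteq> (\<lambda>q. pr 0 (cq q)) ` {..<p}" by (auto simp: isSig_def)
    then have "card (target p ` cand p) \<le> p"
      by (metis card_image_le card_lessThan card_mono finite_imageI finite_lessThan le_trans)
    then have "\<not> inj_on (target p) (cand p)" using cand(2)[of p] card_image by fastforce
    then obtain y y' where "y \<in> cand p" "y' \<in> cand p" "target p y' = target p y" "y' \<noteq> y"
      unfolding inj_on_def by blast
    then show ?thesis unfolding espec_def by blast
  qed
qed

lemma espec_cong:
  assumes "\<And>q. q < p \<Longrightarrow> h q = h' q"
  shows "espec Y h p v \<longleftrightarrow> espec Y h' p v"
proof -
  have "q < p \<Longrightarrow> inM Y h t q \<longleftrightarrow> inM Y h' t q" for q t unfolding inM_def nx_def using assms by auto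
  then have "isM Y h p t \<longleftrightarrow> isM Y h' p t" for t unfolding isM_def by blast
  then show ?thesis unfolding espec_def by simp
qed

text \<open>The guard \<open>q < p\<close> serves termination; \<open>est_eq\<close> removes it,
  since \<open>espec\<close> at \<open>p\<close> reads its function argument only below
  \<open>p\<close>.\<close>

function est :: "nat set \<Rightarrow> nat \<Rightarrow> nat" where
  "est Y p = (LEAST v. espec Y (\<lambda>q. if q < p then est Y q else 0) p v)"
  by auto
termination by (relation "measure snd") auto

declare est.simps [simp del]

lemma est_eq: "est Y p = (LEAST v. espec Y (est Y) p v)"
proof -
  have "espec Y (\<lambda>q. if q < p then est Y q else 0) p v \<longleftrightarrow> espec Y (est Y) p v" for v
    by (rule espec_cong) simp
  then have "espec Y (\<lambda>q. if q < p then est Y q else 0) p = espec Y (est Y) p" ..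
  then show ?thesis by (subst est.simps) (simp only:)
qed

lemma espec_est: "espec Y (est Y) p (est Y p)"
  unfolding est_eq[of Y p] by (rule LeastI_ex[OF espec_ex])

lemma nx_in_cand: "nx (est Y) q j \<in> cand q"
  using espec_est[of Y q] ell_in_cand unfolding nx_def espec_def by simp

lemma Dfun_eidx: "Dfun k s \<Longrightarrow> Dfun k (\<lambda>\<Phi> \<rho>. eidx (s \<Phi> \<rho>))"
  and Dfun_jidx: "Dfun k s \<Longrightarrow> Dfun k (\<lambda>\<Phi> \<rho>. jidx (s \<Phi> \<rho>))"
  unfolding eidx_def jidx_def by (intro D_intros; assumption)+

context
  fixes Y :: "nat set" and k :: nat
  assumes Y: "Delta (Suc k) (\<lambda>\<Phi> \<rho>. \<rho> 0 \<in> Y)"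
begin

lemma Delta_Y: "Dfun (Suc k) s \<Longrightarrow> Delta (Suc k) (\<lambda>\<Phi> \<rho>. s \<Phi> \<rho> \<in> Y)"
  by (rule Delta_comp1[OF Y])

lemma Delta_inM_oracle: "Delta (Suc k) (\<lambda>\<Phi> \<rho>. inM Y (\<Phi> 0) (\<rho> a) (\<rho> b))"
  unfolding inM_def nx_def by (intro D_intros Dfun_cq Delta_Y Dfun_jidx Dfun_ell)

lemma Dfun_est_var: "Dfun (Suc k) (\<lambda>\<Phi> \<rho>. est Y (\<rho> 0))"
proof (rule Dfun_unique_solution[of k "\<lambda>h \<Phi>. \<forall>p. espec Y h p (h p) \<and> (\<forall>v. v < h p \<longrightarrow> \<not> espec Y h p v)" "\<lambda>_. est Y"])
  have inM: "Delta (Suc k) (\<lambda>\<Phi> \<rho>. inM Y (\<Phi> 0) (s \<Phi> \<rho>) (t \<Phi> \<rho>))" if "Dfun (Suc k) s" "Dfun (Suc k) t" for s t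
  proof -
    have "Delta (Suc k) (\<lambda>\<Phi> \<rho>. \<exists>x y. x = s \<Phi> \<rho> \<and> y = t \<Phi> \<rho> \<and> inM Y (\<Phi> 0) x y)"
      by (intro D_intros Delta_inM_oracle Dfun_shift that)
    then show ?thesis by simp
  qed
  have "Delta (Suc k) (\<lambda>\<Phi> \<rho>. isM Y (\<Phi> 0) (\<rho> a) (\<rho> b))" for a b
    unfolding isM_def by (intro D_intros inM Dfun_cq Delta_Y Dfun_jidx Dfun_ell)
  then have isM: "Delta (Suc k) (\<lambda>\<Phi> \<rho>. isM Y (\<Phi> 0) (s \<Phi> \<rho>) (t \<Phi> \<rho>))" if "Dfun (Suc k) s" "Dfun (Suc k) t" for s t
  proof -
    have "Delta (Suc k) (\<lambda>\<Phi> \<rho>. \<exists>x y. x = s \<Phi> \<rho> \<and> y = t \<Phi> \<rho> \<and> isM Y (\<Phi> 0) x y)"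
      by (intro D_intros \<open>\<And>b a. Delta (Suc k) (\<lambda>\<Phi> \<rho>. isM Y (\<Phi> 0) (\<rho> a) (\<rho> b))\<close> Dfun_shift that)
    then show ?thesis by simp
  qed
  have isSig: "Delta (Suc k) (\<lambda>\<Phi> \<rho>. isSig (s \<Phi> \<rho>) (t \<Phi> \<rho>))" if "Dfun (Suc k) s" "Dfun (Suc k) t" for s t
    unfolding isSig_def by (intro D_intros Dfun_cq Dfun_shift that)
  have target: "Dfun (Suc k) (\<lambda>\<Phi> \<rho>. target (s \<Phi> \<rho>) (t \<Phi> \<rho>))" if "Dfun (Suc k) s" "Dfun (Suc k) t" for s t
    unfolding target_def by (intro D_intros Dfun_phi Dfun_eidx Dfun_cq that)
  show "Delta (Suc k) (\<lambda>\<Phi> \<rho>. \<forall>p. espec Y (\<Phi> 0) p (\<Phi> 0 p) \<and> (\<forall>v. v < \<Phi> 0 p \<longrightarrow> \<not> espec Y (\<Phi> 0) p v))"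
    unfolding espec_def by (intro D_intros Delta_cand isM isSig target)
  show "\<forall>p. espec Y (est Y) p (est Y p) \<and> (\<forall>v. v < est Y p \<longrightarrow> \<not> espec Y (est Y) p v)"
    using espec_est est_eq not_less_Least by metis
  fix h assume h: "\<forall>p. espec Y h p (h p) \<and> (\<forall>v. v < h p \<longrightarrow> \<not> espec Y h p v)"
  have "h p = est Y p" for p
  proof (induction p rule: less_induct)
    case (less p)
    have "espec Y h p v \<longleftrightarrow> espec Y (est Y) p v" for v by (rule espec_cong) (rule less)
    then have "est Y p = h p"
      unfolding est_eq[of Y p] by (intro Least_equality) (use h in \<open>auto simp: not_less[symmetric]\<close>)
    then show ?case ..
  qed
  then show "h = est Y" by (rule ext)
qed

lemma Dfun_est: "Dfun (Suc k) s \<Longrightarrow> Dfun (Suc k) (\<lambda>\<Phi> \<rho>. est Y (s \<Phi> \<rho>))"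
  by (rule Dfun_comp1[OF Dfun_est_var])

lemma Delta_inM: "Delta (Suc k) (\<lambda>\<Phi> \<rho>. inM Y (est Y) (\<rho> a) (\<rho> b))"
  unfolding inM_def nx_def by (intro D_intros Dfun_cq Delta_Y Dfun_jidx Dfun_ell Dfun_est)

end

text \<open>Colours are given as indices in the original numbering of the family. Thus only this
  selector has to be \<Delta>, and membership in the sets themselves is left to that
  numbering.\<close>

definition gsel :: "nat set \<Rightarrow> nat \<Rightarrow> nat \<Rightarrow> nat \<Rightarrow> nat" where
  "gsel Y a b t = (if \<exists>q. t = pr 0 (cq (pr 0 q)) then (THE q. t = pr 0 (cq (pr 0 q)))
     else if \<exists>q. inM Y (est Y) t q then a else b)"

lemma gsel_Sig: "gsel Y a b (pr 0 (cq (pr 0 q))) = q"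
proof -
  have "(THE q'. pr 0 (cq (pr 0 q)) = pr 0 (cq (pr 0 q'))) = q" by (rule the_equality) (auto simp: cq_eq_iff)
  then show ?thesis unfolding gsel_def by auto
qed

lemma gsel_inM: "inM Y (est Y) t q \<Longrightarrow> gsel Y a b t = a"
  unfolding gsel_def by (auto simp: inM_def)

lemma gsel_else: "(\<And>q. t \<noteq> pr 0 (cq (pr 0 q))) \<Longrightarrow> (\<And>q. \<not> inM Y (est Y) t q) \<Longrightarrow> gsel Y a b t = b"
  unfolding gsel_def by auto

lemma Dfun_gsel:
  assumes "Delta (Suc k) (\<lambda>\<Phi> \<rho>. \<rho> 0 \<in> Y)"
  shows "Dfun (Suc k) (\<lambda>\<Phi> \<rho>. gsel Y a b (\<rho> 0))"
proof -
  have "z = gsel Y a b t \<longleftrightarrow> t = pr 0 (cq (pr 0 z)) \<or> \<not> (\<exists>q. t = pr 0 (cq (pr 0 q))) \<and>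
      ((\<exists>q. inM Y (est Y) t q) \<and> z = a \<or> \<not> (\<exists>q. inM Y (est Y) t q) \<and> z = b)" for z t
  proof (cases "\<exists>q. t = pr 0 (cq (pr 0 q))")
    case True
    then obtain q where q: "t = pr 0 (cq (pr 0 q))" by blast
    then show ?thesis by (auto simp: gsel_Sig cq_eq_iff)
  qed (auto simp: gsel_def)
  then show ?thesis
    unfolding Dfun_def by (simp only:) (intro D_intros Dfun_cq Delta_inM[OF assms])
qed

section \<open>Coding a set into an interval of numberings\<close>

lemma num_reducible_refl: "num_reducible \<nu> \<nu>"
  unfolding num_reducible_def
  by (intro exI[of _ "\<lambda>x. x"]) (simp add: computable_iff_recfun recfun_var)

lemma num_reducible_trans:
  assumes "num_reducible \<nu> \<mu>" "num_reducible \<mu> \<xi>"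
  shows "num_reducible \<nu> \<xi>"
proof -
  from assms obtain f g where "computable f" "\<And>x. \<nu> x = \<mu> (f x)" "computable g" "\<And>x. \<mu> x = \<xi> (g x)"
    unfolding num_reducible_def by blast
  then show ?thesis
    unfolding num_reducible_def by (intro exI[of _ "\<lambda>x. g (f x)"]) (simp add: computable_comp)
qed

lemma num_reducible_comp: "computable f \<Longrightarrow> num_reducible (\<lambda>x. \<mu> (f x)) \<mu>"
  unfolding num_reducible_def by blast

lemma num_reducible_sum:
  "num_reducible \<nu> (num_sum \<nu> \<mu>)" "num_reducible \<mu> (num_sum \<nu> \<mu>)"
  "num_reducible \<nu> \<xi> \<Longrightarrow> num_reducible \<mu> \<xi> \<Longrightarrow> num_reducible (num_sum \<nu> \<mu>) \<xi>"
proof -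
  have "computable (\<lambda>x. 2 * x)" "computable (\<lambda>x. 2 * x + 1)"
    unfolding computable_iff_recfun by (intro rec_intros)+
  then show "num_reducible \<nu> (num_sum \<nu> \<mu>)" "num_reducible \<mu> (num_sum \<nu> \<mu>)"
    unfolding num_reducible_def using num_sum_simps by metis+
  assume "num_reducible \<nu> \<xi>" "num_reducible \<mu> \<xi>"
  then obtain f g where f: "computable f" "\<And>x. \<nu> x = \<xi> (f x)" and g: "computable g" "\<And>x. \<mu> x = \<xi> (g x)"
    unfolding num_reducible_def by blast
  have "computable (\<lambda>x. if even x then f (x div 2) else g (x div 2))"
    unfolding computable_iff_recfun
    by (intro rec_intros recfun_computable[OF f(1)] recfun_computable[OF g(1)])
  then show "num_reducible (num_sum \<nu> \<mu>) \<xi>"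
    unfolding num_reducible_def using f(2) g(2) by (auto simp: num_sum_def)
qed

text \<open>Formulated for preorders, so that numberings, or indices of them, can be used without
  passing to equivalence classes.\<close>

definition atom_over :: "'a set \<Rightarrow> ('a \<Rightarrow> 'a \<Rightarrow> bool) \<Rightarrow> 'a \<Rightarrow> 'a \<Rightarrow> bool" where
  "atom_over X lq z0 a \<longleftrightarrow> a \<in> X \<and> \<not> lq a z0 \<and> (\<forall>z\<in>X. lq z a \<longrightarrow> lq z z0 \<or> lq a z)"

definition chain_cover :: "'a set \<Rightarrow> ('a \<Rightarrow> 'a \<Rightarrow> bool) \<Rightarrow> 'a \<Rightarrow> 'a \<Rightarrow> 'a \<Rightarrow> bool" where
  "chain_cover X lq z0 a b \<longleftrightarrow> b \<in> X \<and> lq a b \<and> \<not> lq b a \<and>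
     (\<forall>z\<in>X. lq z b \<longrightarrow> lq z z0 \<or> lq z a \<and> lq a z \<or> lq b z)"

definition codes :: "'a set \<Rightarrow> ('a \<Rightarrow> 'a \<Rightarrow> bool) \<Rightarrow> 'a \<Rightarrow> nat \<Rightarrow> bool" where
  "codes X lq z0 i \<longleftrightarrow> (\<exists>a. atom_over X lq z0 a \<and> (\<exists>b.
     (\<forall>j\<le>i. chain_cover X lq z0 a (b j)) \<and>
     (\<forall>j\<le>i. \<forall>j'\<le>i. j \<noteq> j' \<longrightarrow> \<not> (lq (b j) (b j') \<and> lq (b j') (b j))) \<and>
     (\<forall>c. chain_cover X lq z0 a c \<longrightarrow> (\<exists>j\<le>i. lq c (b j) \<and> lq (b j) c))))"

lemma recpred_bool: "recpred (\<lambda>\<Phi> \<rho>. c)"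
  unfolding recpred_def by (rule recfun_const)

text \<open>For a fixed element \<open>q\<close> all noncomputable data are constants:
  \<open>cq q\<close>, \<open>h q\<close>, \<open>ell q\<close>, and whether
  \<open>pfst q - 1\<close> is in \<open>Y\<close>. Early elements can therefore be put into a
  finite table.\<close>

lemma recpred_inM: "recpred (\<lambda>\<Phi> \<rho>. inM Y h (\<rho> 0) q)"
proof -
  have "inM Y h t q \<longleftrightarrow> pfst q \<noteq> 0 \<and> pfst q - 1 \<in> Y \<and> pfst t \<noteq> 0 \<and> pfst (pfst t - 1) = pfst q - 1 \<and>
      pfst (psnd t) = cq q \<and> psnd (pfst t - 1) \<le> pfst q \<and>
      (psnd (pfst t - 1) = 0 \<or> psnd (psnd t) \<noteq> (if psnd (pfst t - 1) = jidx q then h q else ell q))" for t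
  proof
    assume "inM Y h t q"
    then show "pfst q \<noteq> 0 \<and> pfst q - 1 \<in> Y \<and> pfst t \<noteq> 0 \<and> pfst (pfst t - 1) = pfst q - 1 \<and>
      pfst (psnd t) = cq q \<and> psnd (pfst t - 1) \<le> pfst q \<and>
      (psnd (pfst t - 1) = 0 \<or> psnd (psnd t) \<noteq> (if psnd (pfst t - 1) = jidx q then h q else ell q))"
      by (auto simp: inM_def nx_def)
  next
    assume *: "pfst q \<noteq> 0 \<and> pfst q - 1 \<in> Y \<and> pfst t \<noteq> 0 \<and> pfst (pfst t - 1) = pfst q - 1 \<and>
      pfst (psnd t) = cq q \<and> psnd (pfst t - 1) \<le> pfst q \<and>
      (psnd (pfst t - 1) = 0 \<or> psnd (psnd t) \<noteq> (if psnd (pfst t - 1) = jidx q then h q else ell q))"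
    then have "t = pr (Suc (pr (pfst q - 1) (psnd (pfst t - 1)))) (pr (cq q) (psnd (psnd t)))"
      by (metis Suc_pred' bot_nat_0.not_eq_extremum pr_pfst_psnd)
    with * show "inM Y h t q"
      unfolding inM_def nx_def by (intro exI[of _ "pfst q - 1"] exI[of _ "psnd (pfst t - 1)"] exI[of _ "psnd (psnd t)"]) auto
  qed
  then show ?thesis by (simp only:) (intro rec_intros recpred_bool)
qed

text \<open>A finite disjunction rather than bounded quantification: \<open>n\<close> is fixed, and
  the \<open>P q\<close> need not be decidable uniformly in \<open>q\<close>.\<close>

lemma recpred_ex_le:
  fixes n :: nat
  assumes "\<And>q. recpred (\<lambda>\<Phi> \<rho>. P q (\<rho> 0))"
  shows "recpred (\<lambda>\<Phi> \<rho>. \<exists>q\<le>n. P q (\<rho> 0))"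
proof (induction n)
  case 0
  show ?case using assms[of 0] by simp
next
  case (Suc n)
  have "(\<exists>q\<le>Suc n. P q x) \<longleftrightarrow> (\<exists>q\<le>n. P q x) \<or> P (Suc n) x" for x by (auto simp: le_Suc_eq)
  then show ?case using recpred_disj[OF Suc assms[of "Suc n"]] by simp
qed

lemma recpred_comp1:
  assumes "recpred (\<lambda>\<Phi> \<rho>. P (\<rho> 0))" "recfun s"
  shows "recpred (\<lambda>\<Phi> \<rho>. P (s \<Phi> \<rho>))"
  using recfun_comp1[of "\<lambda>x. of_bool (P x)" s] assms by (simp add: recpred_def)

lemma recpred_Rset: "recfun s \<Longrightarrow> recpred (\<lambda>\<Phi> \<rho>. s \<Phi> \<rho> \<in> Rset n)"
proof (rule recpred_comp1[of "\<lambda>x. x \<in> Rset n"])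
  let ?r = "phi (pfst (st n))"
  have r: "cincr ?r" using okcond_st[of n] by (simp add: okcond_def)
  have "x \<in> Rset n \<longleftrightarrow> (\<exists>z<Suc x. ?r z = x)" for x
    unfolding Rset_def using cincr_unbounded[OF r] by (auto simp: less_Suc_eq_le)
  then show "recpred (\<lambda>\<Phi> \<rho>. \<rho> 0 \<in> Rset n)"
    by (simp only:) (intro rec_intros recfun_phi)
qed

text \<open>
  Layout of the numbering \<open>mu\<close>. The column \<open>\<langle>0, w\<rangle>\<close> contains the whole family, at the sparse places
  \<open>w = cq \<langle>0, q\<rangle>\<close>, so that \<open>nu0\<close> is a numbering of the family. The index \<open>\<langle>Suc \<langle>i, j\<rangle>, \<langle>x, y\<rangle>\<rangle>\<close> gets the first
  colour iff \<open>i \<in> Y\<close>, \<open>j \<le> i + 1\<close> and \<open>x = cq p\<close> for some \<open>p = \<langle>Suc i, _\<rangle>\<close>, with a single exception \<open>y = exc p j\<close> when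
  \<open>j > 0\<close>. All other indices get the second colour.
\<close>

locale coding =
  fixes Y :: "nat set" and \<pi> :: numbering and iA iB :: nat
  assumes colours: "\<pi> iA \<noteq> \<pi> iB"
begin

abbreviation "exc \<equiv> nx (est Y)"
definition mu :: numbering where "mu t = \<pi> (gsel Y iA iB t)"
definition nu0 :: numbering where "nu0 w = mu (pr 0 w)"
definition ai :: "nat \<Rightarrow> nat \<Rightarrow> nat" where "ai i x = pr (Suc (pr i 0)) (pr x 0)"
definition piece :: "nat \<Rightarrow> nat \<Rightarrow> nat \<Rightarrow> nat" where "piece i j w = pr (Suc (pr i j)) w"
definition alpha :: "nat \<Rightarrow> numbering" where "alpha i = num_sum nu0 (\<lambda>x. mu (ai i x))"
definition beta :: "nat \<Rightarrow> nat \<Rightarrow> numbering" where "beta i j = num_sum nu0 (\<lambda>w. mu (piece i j w))"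

lemma nu0_item: "nu0 (cq (pr 0 q)) = \<pi> q"
  unfolding nu0_def mu_def by (simp add: gsel_Sig)

lemma mu_inM: "inM Y (est Y) t q \<Longrightarrow> mu t = \<pi> iA"
  unfolding mu_def by (simp add: gsel_inM)

lemma mu_piece:
  "mu (pr (Suc (pr i j)) (pr x y)) =
    (if i \<in> Y \<and> j \<le> Suc i \<and> (\<exists>p. x = cq p \<and> pfst p = Suc i \<and> (j = 0 \<or> y \<noteq> exc p j)) then \<pi> iA else \<pi> iB)"
proof -
  have "(\<exists>q. inM Y (est Y) (pr (Suc (pr i j)) (pr x y)) q) \<longleftrightarrow>
      i \<in> Y \<and> j \<le> Suc i \<and> (\<exists>p. x = cq p \<and> pfst p = Suc i \<and> (j = 0 \<or> y \<noteq> exc p j))"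
    unfolding inM_def by auto
  then show ?thesis
    unfolding mu_def using gsel_inM[of Y "pr (Suc (pr i j)) (pr x y)" _ iA iB] gsel_else[of "pr (Suc (pr i j)) (pr x y)" Y iA iB]
    by auto
qed

lemma mu_item:
  assumes "i \<in> Y" "j \<le> Suc i" "pfst p = Suc i"
  shows "mu (pr (Suc (pr i j)) (pr (cq p) y)) = (if j = 0 \<or> y \<noteq> exc p j then \<pi> iA else \<pi> iB)"
  unfolding mu_piece using assms by (auto simp: cq_eq_iff)

lemma mu_no_item:
  "(\<And>p. x = cq p \<Longrightarrow> pfst p \<noteq> Suc i) \<Longrightarrow> mu (pr (Suc (pr i j)) (pr x y)) = \<pi> iB"
  unfolding mu_piece by auto

lemma mu_not_B_cases:
  assumes "mu t \<noteq> \<pi> iB"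
  obtains q where "pfst q = 0" "t = pr 0 (cq q)" | q where "inM Y (est Y) t q"
proof -
  from assms gsel_else[of t Y iA iB] have "(\<exists>q. t = pr 0 (cq (pr 0 q))) \<or> (\<exists>q. inM Y (est Y) t q)"
    unfolding mu_def by metis
  then show thesis using that by (metis pfst_pr)
qed

section \<open>Reductions obtained from the way a computable function meets a piece\<close>

definition s_of :: "nat \<Rightarrow> nat \<Rightarrow> nat \<Rightarrow> nat" where "s_of e i j = Suc (pr e (pr i j))"

definition type0 :: "nat \<Rightarrow> nat \<Rightarrow> nat \<Rightarrow> bool" where
  "type0 e i j \<longleftrightarrow> (\<forall>x\<in>Rset (s_of e i j). \<forall>y. \<not> hit (phi e) (pr i j) x y)"
definition type1 :: "nat \<Rightarrow> nat \<Rightarrow> nat \<Rightarrow> bool" where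
  "type1 e i j \<longleftrightarrow> (\<forall>x\<in>Rset (s_of e i j). (\<exists>y. hit (phi e) (pr i j) x y \<and> Bad (s_of e i j) x y) \<and>
     (\<forall>y. hit (phi e) (pr i j) x y \<longrightarrow> Bad (s_of e i j) x y))"
definition type2 :: "nat \<Rightarrow> nat \<Rightarrow> nat \<Rightarrow> bool" where
  "type2 e i j \<longleftrightarrow> (\<forall>x\<in>Rset (s_of e i j). (\<exists>y. hit (phi e) (pr i j) x y \<and> Bad (s_of e i j) x y) \<and>
     (\<forall>y. hit (phi e) (pr i j) x y \<or> Bad (s_of e i j) x y))"

lemma type_cases: "type0 e i j \<or> type1 e i j \<or> type2 e i j"
  using Rset_decides[of "pr e (pr i j)"]
  unfolding decides_def type0_def type1_def type2_def s_of_def Bad_def by simp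

text \<open>Elements numbered beyond \<open>e\<close> lie in the reservoir on which
  \<open>phi e\<close> was decided, and their exceptional copies are not bad at that stage. So a bad
  copy is surely not exceptional; the elements up to \<open>e\<close> are left to tables.\<close>

lemma late_item:
  assumes "e < p" "pfst p = Suc i" "j \<le> Suc i"
  shows "cq p \<in> Rset (s_of e i j)" "\<not> Bad (s_of e i j) (cq p) (exc p j)"
proof -
  have "s_of e i j \<le> Lp p"
    using less_Lp[of e p i j] assms pfst_le[of p] by (simp add: s_of_def)
  then show "cq p \<in> Rset (s_of e i j)" "\<not> Bad (s_of e i j) (cq p) (exc p j)"
    using cq_in_Rset Bad_mono nx_in_cand[of Y p j] unfolding cand_def by blast+
qed

lemma colour_indices:
  assumes "num_reducible nu0 \<xi>"
  obtains jA jB where "\<xi> jA = \<pi> iA" "\<xi> jB = \<pi> iB"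
  using assms nu0_item unfolding num_reducible_def by metis

lemma computable_ai: "computable (ai i)" and computable_piece: "computable (piece i j)"
  and computable_pr0: "computable (pr 0)"
  unfolding computable_iff_recfun ai_def piece_def by (intro rec_intros)+

lemma nu0_le_mu: "num_reducible nu0 mu"
  unfolding nu0_def by (rule num_reducible_comp[OF computable_pr0])

text \<open>The value \<open>phi e z\<close> itself tells how to proceed: column 0 goes through
  \<open>nu0\<close>, early elements are tabulated, and a hit in a piece of type 1 (or in piece 0)
  is not exceptional, so it has the colour of \<open>ai i x\<close>. Everything else has the second
  colour, since type 0 pieces are not hit at late elements.\<close>

lemma reduce_upper:
  assumes \<xi>: "num_reducible nu0 \<xi>"
    and other: "\<And>i' j. i' \<in> Y \<Longrightarrow> i' \<noteq> i \<Longrightarrow> j \<le> Suc i' \<Longrightarrow> type0 e i' j"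
    and own: "\<And>j. i \<in> Y \<Longrightarrow> j \<le> Suc i \<Longrightarrow>
      type0 e i j \<or> (type1 e i j \<or> j = 0) \<and> num_reducible (\<lambda>x. mu (ai i x)) \<xi>"
  shows "num_reducible (\<lambda>z. mu (phi e z)) \<xi>"
proof -
  from \<xi> obtain k0 where k0: "computable k0" "\<And>w. nu0 w = \<xi> (k0 w)" unfolding num_reducible_def by blast
  obtain jA jB where jAB: "\<xi> jA = \<pi> iA" "\<xi> jB = \<pi> iB" using \<xi> by (rule colour_indices)
  define good where "good \<longleftrightarrow> num_reducible (\<lambda>x. mu (ai i x)) \<xi>"
  \<comment> \<open>A reduction of the atom part is called only if some piece of \<open>i\<close> is
    under the second alternative of \<open>own\<close>; otherwise any computable function will
    do.\<close>
  obtain ka where ka: "computable ka" "good \<Longrightarrow> mu (ai i x) = \<xi> (ka x)" for x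
  proof (cases good)
    case True
    then show ?thesis using that unfolding good_def num_reducible_def by blast
  next
    case False
    then show ?thesis using that[OF k0(1)] by blast
  qed
  define J where "J j \<longleftrightarrow> good \<and> (type1 e i j \<or> j = 0) \<and> i \<in> Y \<and> j \<le> Suc i" for j
  define tab where "tab t \<longleftrightarrow> (\<exists>q\<le>e. inM Y (est Y) t q)" for t
  define early where "early x \<longleftrightarrow> (\<exists>q\<le>e. x = cq q)" for x
  define H where "H t = (if pfst t = 0 then k0 (psnd t) else if tab t then jA
    else if pfst (pfst t - 1) = i \<and> (\<exists>j\<le>Suc i. J j \<and> psnd (pfst t - 1) = j) \<and> \<not> early (pfst (psnd t))
    then ka (pfst (psnd t)) else jB)" for t
  have tabc: "recpred (\<lambda>\<Phi> \<rho>. tab (s \<Phi> \<rho>))" if "recfun s" for s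
    unfolding tab_def by (rule recpred_comp1[OF recpred_ex_le[OF recpred_inM] that])
  have "recpred (\<lambda>\<Phi> \<rho>. \<rho> 0 = cq q)" for q by (intro rec_intros)
  then have earlyc: "recpred (\<lambda>\<Phi> \<rho>. early (s \<Phi> \<rho>))" if "recfun s" for s
    unfolding early_def by (rule recpred_comp1[OF recpred_ex_le that])
  have "recpred (\<lambda>\<Phi> \<rho>. J j \<and> \<rho> 0 = j)" for j by (intro rec_intros recpred_bool)
  then have Jc: "recpred (\<lambda>\<Phi> \<rho>. \<exists>j\<le>Suc i. J j \<and> s \<Phi> \<rho> = j)" if "recfun s" for s
    by (rule recpred_comp1[OF recpred_ex_le that])
  have "recfun (\<lambda>\<Phi> \<rho>. H (\<rho> 0))"
    unfolding H_def by (intro recfun_if recpred_conj recpred_not tabc earlyc Jc recfun_computable[OF k0(1)]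
        recfun_computable[OF ka(1)] rec_intros)
  then have "computable (\<lambda>z. H (phi e z))"
    unfolding computable_iff_recfun by (rule recfun_comp1[of H, OF _ recfun_phi[OF recfun_var]])
  moreover have "mu (phi e z) = \<xi> (H (phi e z))" for z
  proof -
    obtain d w where t: "phi e z = pr d w" by (rule pr_cases)
    show ?thesis
    proof (cases d)
      case 0
      then show ?thesis using k0(2)[of w] by (simp add: t H_def nu0_def)
    next
      case (Suc d')
      obtain i' j' where d': "d' = pr i' j'" by (rule pr_cases)
      obtain x y where w: "w = pr x y" by (rule pr_cases)
      have tt: "phi e z = pr (Suc (pr i' j')) (pr x y)" by (simp add: t Suc d' w)
      have hit: "hit (phi e) (pr i' j') x y" unfolding hit_def using tt by blast
      show ?thesis
      proof (cases "tab (phi e z)")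
        case True
        then have "mu (phi e z) = \<pi> iA" unfolding tab_def using mu_inM by blast
        with True show ?thesis by (simp add: H_def tt jAB)
      next
        case ntab: False
        have late: "e < q" if "inM Y (est Y) (phi e z) q" for q
          using ntab that unfolding tab_def by (meson not_le)
        show ?thesis
        proof (cases "i' = i \<and> J j' \<and> \<not> early x")
          case True
          then have J: "good" "type1 e i j' \<or> j' = 0" "i \<in> Y" "j' \<le> Suc i" by (auto simp: J_def)
          have "H (phi e z) = ka x" using True ntab J by (simp add: H_def tt)
          then have "\<xi> (H (phi e z)) = mu (ai i x)" using ka(2)[OF J(1), of x] by simp
          also have "\<dots> = mu (pr (Suc (pr i j')) (pr x y))"
          proof (cases "\<exists>p. x = cq p \<and> pfst p = Suc i")
            case True
            then obtain p where p: "x = cq p" "pfst p = Suc i" by blast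
            have "e < p" using \<open>i' = i \<and> J j' \<and> \<not> early x\<close> p(1) unfolding early_def by (metis not_le)
            note l = late_item[OF this p(2) J(4)]
            have "j' = 0 \<or> y \<noteq> exc p j'"
              using J(2) l hit p(1) True \<open>i' = i \<and> J j' \<and> \<not> early x\<close> unfolding type1_def by blast
            then show ?thesis using mu_item[OF J(3) _ p(2)] J(4) by (simp add: ai_def p(1))
          next
            case False
            then show ?thesis unfolding ai_def by (simp add: mu_no_item)
          qed
          finally show ?thesis using True by (simp add: tt)
        next
          case False
          have "H (phi e z) = jB" using False ntab by (auto simp: H_def tt)
          moreover have "\<not> inM Y (est Y) (phi e z) q" for q
          proof
            assume inM: "inM Y (est Y) (phi e z) q"
            then have q: "x = cq q" "pfst q = Suc i'" "i' \<in> Y" "j' \<le> Suc i'" unfolding inM_def tt by auto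
            note l = late_item[OF late[OF inM] q(2,4)]
            have nt0: "\<not> type0 e i' j'" using l(1) hit q(1) unfolding type0_def by blast
            then have "i' = i" using other q by blast
            moreover have "J j'" using own[of j'] nt0 q \<open>i' = i\<close> unfolding J_def good_def by blast
            moreover have "\<not> early x" using late[OF inM] q(1) unfolding early_def by (auto simp: cq_eq_iff)
            ultimately show False using False by blast
          qed
          then have "mu (phi e z) = \<pi> iB"
            unfolding mu_def by (subst gsel_else) (auto simp: tt)
          ultimately show ?thesis by (simp add: jAB)
        qed
      qed
    qed
  qed
  ultimately show ?thesis unfolding num_reducible_def by blast
qed

text \<open>In types 1 and 2 every place of the reservoir has a bad hit. It is found by searching
  the range of \<open>phi e\<close> and the enumeration of bad pairs together, and at late elements
  it has the colour of the place.\<close>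

lemma reduce_lower_a:
  assumes \<xi>: "num_reducible nu0 (\<lambda>z. mu (phi e z))" and ij: "i \<in> Y" "j \<le> Suc i" and "\<not> type0 e i j"
  shows "num_reducible (\<lambda>x. mu (ai i x)) (\<lambda>z. mu (phi e z))"
proof -
  let ?s = "s_of e i j" and ?g = "phi (psnd (st (s_of e i j)))"
  have hb: "\<exists>y. hit (phi e) (pr i j) x y \<and> Bad ?s x y" if "x \<in> Rset ?s" for x
    using type_cases[of e i j] assms(4) that unfolding type1_def type2_def by blast
  from \<xi> obtain jA jB where jAB: "mu (phi e jA) = \<pi> iA" "mu (phi e jB) = \<pi> iB" by (rule colour_indices)
  \<comment> \<open>Places outside the reservoir satisfy \<open>Q\<close> trivially to make the
    search total; \<open>H\<close> answers them without using its result. Unless tabulated, they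
    carry no element labelled \<open>i\<close>, so the second colour is right.\<close>
  define Q where "Q x u \<longleftrightarrow> x \<notin> Rset ?s \<or> phi e (pfst u) = pr (Suc (pr i j)) (?g (psnd u)) \<and> pfst (?g (psnd u)) = x" for x u
  have Qex: "\<exists>u. Q x u" for x
  proof (cases "x \<in> Rset ?s")
    case True
    from hb[OF True] obtain y z z' where "phi e z = pr (Suc (pr i j)) (pr x y)" "?g z' = pr x y"
      unfolding hit_def Bad_def bd_def by blast
    then show ?thesis unfolding Q_def by (intro exI[of _ "pr z z'"]) simp
  qed (simp add: Q_def)
  define early where "early x \<longleftrightarrow> (\<exists>q\<le>e. x = cq q)" for x
  define tabA where "tabA x \<longleftrightarrow> (\<exists>q\<le>e. pfst q = Suc i \<and> x = cq q)" for x
  define H where "H x = (if tabA x then jA else if early x \<or> x \<notin> Rset ?s then jB else pfst (LEAST u. Q x u))" for x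
  have "recpred (\<lambda>\<Phi> \<rho>. \<rho> 0 = cq q)" for q by (intro rec_intros)
  then have earlyc: "recpred (\<lambda>\<Phi> \<rho>. early (\<rho> 0))" unfolding early_def by (rule recpred_ex_le)
  have "recpred (\<lambda>\<Phi> \<rho>. pfst q = Suc i \<and> \<rho> 0 = cq q)" for q by (intro rec_intros)
  then have tabc: "recpred (\<lambda>\<Phi> \<rho>. tabA (\<rho> 0))" unfolding tabA_def by (rule recpred_ex_le)
  have "recfun (\<lambda>\<Phi> \<rho>. LEAST u. Q (\<rho> 0) u)"
    by (rule recfun_Least[OF _ Qex]) (unfold Q_def, intro rec_intros recpred_Rset recfun_phi)
  then have "computable H"
    unfolding H_def computable_iff_recfun by (intro rec_intros tabc earlyc recpred_Rset)
  moreover have "mu (ai i x) = mu (phi e (H x))" for x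
  proof -
    consider (1) "tabA x" | (2) "\<not> tabA x" "early x \<or> x \<notin> Rset ?s" | (3) "\<not> tabA x" "\<not> early x" "x \<in> Rset ?s" by blast
    then show ?thesis
    proof cases
      case 1
      then obtain q where "pfst q = Suc i" "x = cq q" unfolding tabA_def by blast
      then show ?thesis using 1 mu_item[OF ij(1), of 0 q 0] by (simp add: H_def jAB ai_def)
    next
      case 2
      have "pfst p \<noteq> Suc i" if "x = cq p" for p
      proof
        assume p: "pfst p = Suc i"
        then have "\<not> p \<le> e" using 2(1) that unfolding tabA_def by blast
        then show False using 2(2) that late_item(1)[of e p i j] p ij(2) unfolding early_def by (auto simp: cq_eq_iff)
      qed
      then show ?thesis using 2 by (simp add: H_def jAB ai_def mu_no_item)
    next
      case 3
      define u where "u = (LEAST u. Q x u)"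
      have "Q x u" unfolding u_def by (rule LeastI_ex[OF Qex])
      with 3 have u: "phi e (pfst u) = pr (Suc (pr i j)) (?g (psnd u))" "pfst (?g (psnd u)) = x"
        unfolding Q_def by auto
      obtain y where y: "?g (psnd u) = pr x y" using u(2) by (metis pr_pfst_psnd)
      have bad: "Bad ?s x y" unfolding Bad_def bd_def using y by blast
      have Hx: "phi e (H x) = pr (Suc (pr i j)) (pr x y)" using 3 u y by (simp add: H_def u_def)
      show ?thesis
      proof (cases "\<exists>p. x = cq p \<and> pfst p = Suc i")
        case True
        then obtain p where p: "x = cq p" "pfst p = Suc i" by blast
        have "e < p" using 3(2) p(1) unfolding early_def by (metis not_le)
        from late_item(2)[OF this p(2) ij(2)] have "y \<noteq> exc p j" using bad p(1) by blast
        then show ?thesis unfolding Hx using mu_item[OF ij(1) _ p(2)] ij(2) by (simp add: p(1) ai_def)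
      next
        case False
        then show ?thesis unfolding Hx ai_def by (simp add: mu_no_item)
      qed
    qed
  qed
  ultimately show ?thesis unfolding num_reducible_def by blast
qed

lemma type2_not_type0: "type2 e i j \<Longrightarrow> \<not> type0 e i j"
  using Rset_unbounded[of "s_of e i j" 0] unfolding type2_def type0_def by blast

text \<open>In type 2 each copy is hit or bad. A hit is its own answer; a bad copy at a late element
  is not exceptional and is answered by the reduction for the atom.\<close>

lemma reduce_lower_b:
  assumes \<xi>: "num_reducible nu0 (\<lambda>z. mu (phi e z))" and ij: "i \<in> Y" "j \<le> Suc i" and t2: "type2 e i j"
  shows "num_reducible (\<lambda>w. mu (piece i j w)) (\<lambda>z. mu (phi e z))"
proof -
  let ?s = "s_of e i j" and ?g = "phi (psnd (st (s_of e i j)))"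
  from \<xi> obtain jA jB where jAB: "mu (phi e jA) = \<pi> iA" "mu (phi e jB) = \<pi> iB" by (rule colour_indices)
  from reduce_lower_a[OF \<xi> ij type2_not_type0[OF t2]] obtain ka where
    ka: "computable ka" "\<And>x. mu (ai i x) = mu (phi e (ka x))" unfolding num_reducible_def by blast
  define Q where "Q w u \<longleftrightarrow> pfst w \<notin> Rset ?s \<or> phi e u = piece i j w \<or> ?g u = w" for w u
  have Qex: "\<exists>u. Q w u" for w
    using t2 unfolding Q_def type2_def hit_def Bad_def bd_def piece_def by (metis pr_pfst_psnd)
  define early where "early x \<longleftrightarrow> (\<exists>q\<le>e. x = cq q)" for x
  define tab where "tab t \<longleftrightarrow> (\<exists>q\<le>e. inM Y (est Y) t q)" for t
  define L where "L w = (LEAST u. Q w u)" for w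
  define H where "H w = (if tab (piece i j w) then jA else if early (pfst w) \<or> pfst w \<notin> Rset ?s then jB
    else if phi e (L w) = piece i j w then L w else ka (pfst w))" for w
  have "recpred (\<lambda>\<Phi> \<rho>. \<rho> 0 = cq q)" for q by (intro rec_intros)
  then have earlyc: "recpred (\<lambda>\<Phi> \<rho>. early (s \<Phi> \<rho>))" if "recfun s" for s
    unfolding early_def by (rule recpred_comp1[OF recpred_ex_le that])
  have tabc: "recpred (\<lambda>\<Phi> \<rho>. tab (s \<Phi> \<rho>))" if "recfun s" for s
    unfolding tab_def by (rule recpred_comp1[OF recpred_ex_le[OF recpred_inM] that])
  have bc: "recfun s \<Longrightarrow> recfun (\<lambda>\<Phi> \<rho>. piece i j (s \<Phi> \<rho>))" for s by (rule recfun_computable[OF computable_piece])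
  have "recfun (\<lambda>\<Phi> \<rho>. L (\<rho> 0))"
    unfolding L_def
    by (rule recfun_Least[OF _ Qex]) (unfold Q_def, intro rec_intros recpred_Rset recfun_phi bc)
  then have "computable H"
    unfolding H_def computable_iff_recfun
    by (intro recfun_if recpred_disj recpred_not recpred_eq tabc earlyc recpred_Rset recfun_phi bc
        recfun_computable[OF ka(1)] recfun_pfst recfun_var recfun_const)
  moreover have "mu (piece i j w) = mu (phi e (H w))" for w
  proof -
    obtain x y where w: "w = pr x y" by (rule pr_cases)
    consider (1) "tab (piece i j w)" | (2) "\<not> tab (piece i j w)" "early x \<or> x \<notin> Rset ?s"
      | (3) "\<not> tab (piece i j w)" "\<not> early x" "x \<in> Rset ?s" by blast
    then show ?thesis
    proof cases
      case 1
      then have "mu (piece i j w) = \<pi> iA" unfolding tab_def using mu_inM by blast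
      with 1 show ?thesis by (simp add: H_def jAB)
    next
      case 2
      have "\<not> inM Y (est Y) (piece i j w) q" for q
      proof
        assume inM: "inM Y (est Y) (piece i j w) q"
        then have q: "x = cq q" "pfst q = Suc i" unfolding inM_def piece_def w by auto
        have "\<not> q \<le> e" using 2(1) inM unfolding tab_def by blast
        then show False using 2(2) q late_item(1)[of e q i j] ij(2) unfolding early_def by (auto simp: cq_eq_iff)
      qed
      then have "mu (piece i j w) = \<pi> iB" unfolding mu_def by (subst gsel_else) (auto simp: piece_def)
      with 2 show ?thesis by (simp add: H_def jAB w)
    next
      case 3
      have "Q w (L w)" unfolding L_def by (rule LeastI_ex[OF Qex])
      then consider "phi e (L w) = piece i j w" | "phi e (L w) \<noteq> piece i j w" "?g (L w) = w"
        using 3 unfolding Q_def w by auto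
      then show ?thesis
      proof cases
        case 1
        then show ?thesis using 3 by (simp add: H_def w)
      next
        case 2
        then have "Bad ?s x y" unfolding Bad_def bd_def w by blast
        have "mu (piece i j w) = mu (ai i x)"
        proof (cases "\<exists>p. x = cq p \<and> pfst p = Suc i")
          case True
          then obtain p where p: "x = cq p" "pfst p = Suc i" by blast
          have "e < p" using 3(2) p(1) unfolding early_def by (metis not_le)
          from late_item(2)[OF this p(2) ij(2)] have "y \<noteq> exc p j" using \<open>Bad ?s x y\<close> p(1) by blast
          then show ?thesis using mu_item[OF ij(1) _ p(2)] ij(2) by (simp add: p(1) ai_def piece_def w)
        next
          case False
          then show ?thesis unfolding ai_def piece_def w by (simp add: mu_no_item)
        qed
        with 2 3 show ?thesis by (simp add: H_def w ka(2))
      qed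
    qed
  qed
  ultimately show ?thesis unfolding num_reducible_def by blast
qed

text \<open>The elements outgrow every enumeration of a reservoir, which thus has a point strictly
  between \<open>cq p\<close> and \<open>cq (Suc p)\<close>. Such points have only the second
  colour, which defeats reductions that are constant on the reservoir.\<close>

lemma skipped:
  "\<exists>x\<in>Rset s. b \<le> x \<and> x \<notin> range cq"
proof -
  from Rset_cincr[of s] obtain r where r: "cincr r" "Rset s = range r" by blast
  have "computable (\<lambda>x. r (Suc x))"
    unfolding computable_iff_recfun by (intro rec_intros recfun_computable[of r]) (use r in \<open>simp add: cincr_def\<close>)
  then obtain e where e: "phi e = (\<lambda>x. r (Suc x))" by (rule computable_ex_phi)
  define p where "p = max e b"
  have "cq p < r (Suc (cq p))" using cincr_unbounded[OF r(1), of "Suc (cq p)"] by simp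
  moreover have "phi e (cq p) < cq (Suc p)"
    by (rule cq_dominates[of e "Suc p" p]) (simp_all add: p_def le_prod_encode_1)
  then have "r (Suc (cq p)) < cq (Suc p)" by (simp add: e)
  ultimately have "r (Suc (cq p)) \<noteq> cq q" for q
    using strict_mono_less[OF cq_strict_mono] by (metis less_Suc_eq not_less_eq)
  moreover have "b \<le> r (Suc (cq p))"
    using \<open>cq p < r (Suc (cq p))\<close> strict_mono_imp_increasing[OF cq_strict_mono, of p] by (simp add: p_def)
  ultimately show ?thesis using r(2) by (intro bexI[of _ "r (Suc (cq p))"]) auto
qed

lemma inM_D:
  assumes "inM Y (est Y) t q"
  obtains i j y where "t = pr (Suc (pr i j)) (pr (cq q) y)" "pfst q = Suc i" "i \<in> Y" "j \<le> Suc i" "j = 0 \<or> y \<noteq> exc q j"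
  using assms unfolding inM_def by blast

text \<open>At a large element \<open>x\<close> labelled \<open>i\<close> the value
  \<open>h x\<close> has the first colour. It cannot belong to a later element, by domination, nor
  to \<open>x\<close> itself, by \<open>avoid\<close>, so it belongs to an earlier one. Then the
  column and element of \<open>h\<close> are constant on the reservoir, and skipped places give a
  contradiction.\<close>

lemma not_reducible_a:
  assumes i: "i \<in> Y" and h: "computable h" and eq: "\<And>x. mu (ai i x) = mu (h x)"
    and avoid: "\<And>x j. pfst (h x) \<noteq> Suc (pr i j)"
  shows False
proof -
  \<comment> \<open>Copy numbers are forgotten, because \<open>cq_avoids\<close> covers the values
    \<open>pr d (cq q)\<close> but not the copies attached to them.\<close>
  define col where "col t = (if pfst t = 0 then t else pr (pfst t) (pfst (psnd t)))" for t
  have "computable (\<lambda>x. col (h x))"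
    unfolding col_def computable_iff_recfun by (intro rec_intros recfun_computable[OF h])
  then obtain e' where e': "phi e' = (\<lambda>x. col (h x))" by (rule computable_ex_phi)
  from h obtain e where e: "phi e = h" by (rule computable_ex_phi)
  define p where "p = pr (Suc i) (max e e')"
  have ep: "e \<le> p" "e' \<le> p" using le_prod_encode_2[of "max e e'" "Suc i"] unfolding p_def by linarith+
  have lab: "pfst p = Suc i" by (simp add: p_def)
  define x where "x = cq p"
  have A: "mu (h x) = \<pi> iA"
    using mu_item[OF i _ lab, of 0 0] eq[of x] by (simp add: ai_def x_def)
  have late: "\<not> p < q" if "cq q \<le> h x" for q
    using cq_dominates[of e q p x] ep that le_prod_encode_1 by (auto simp: e x_def not_le[symmetric])
  have "\<exists>q d. q < p \<and> d \<le> Suc (pr p p) \<and> col (h x) = pr d (cq q) \<and>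
    (d = 0 \<or> (\<exists>i' j'. d = Suc (pr i' j') \<and> i' \<in> Y \<and> j' \<le> Suc i' \<and> pfst q = Suc i'))"
  proof -
    have "mu (h x) \<noteq> \<pi> iB" using A colours by simp
    then show ?thesis
    proof (cases rule: mu_not_B_cases)
      case (1 q)
      have "\<not> p < q" using late[of q] 1(2) le_prod_encode_2[of "cq q" 0] by simp
      moreover have "q \<noteq> p" using 1(1) lab by auto
      ultimately have "q < p" by simp
      moreover have "col (h x) = pr 0 (cq q)" using 1(2) by (simp add: col_def)
      ultimately show ?thesis by blast
    next
      case (2 q)
      then obtain i' j' y where t: "h x = pr (Suc (pr i' j')) (pr (cq q) y)" "pfst q = Suc i'" "i' \<in> Y" "j' \<le> Suc i'"
        by (rule inM_D)
      have "cq q \<le> h x" unfolding t(1) by (meson le_prod_encode_1 le_prod_encode_2 le_trans)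
      then have "\<not> p < q" by (rule late)
      moreover have "q \<noteq> p" using t(1,2) lab avoid[of x j'] by auto
      ultimately have q: "q < p" by simp
      have "pr i' j' \<le> pr p p" using t(2,4) q pfst_le[of q] by (intro pr_mono) linarith+
      then have "Suc (pr i' j') \<le> Suc (pr p p)" by simp
      moreover have "col (h x) = pr (Suc (pr i' j')) (cq q)" using t(1) by (simp add: col_def)
      ultimately show ?thesis using q t by blast
    qed
  qed
  then obtain q d where q: "q < p" "d \<le> Suc (pr p p)" "col (h x) = pr d (cq q)"
    and d: "d = 0 \<or> (\<exists>i' j'. d = Suc (pr i' j') \<and> i' \<in> Y \<and> j' \<le> Suc i' \<and> pfst q = Suc i')" by blast
  have "\<not> (\<forall>q<p. \<forall>d\<le>Suc (pr p p). pr d (cq q) < phi e' (cq p))"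
    using q by (auto simp: e' x_def)
  with cq_avoids[OF ep(2)] obtain v where v: "\<And>z. z \<in> Rset (Lp p) \<Longrightarrow> col (h z) = v"
    unfolding e' by blast
  have xR: "x \<in> Rset (Lp p)" unfolding x_def by (rule cq_in_Rset) simp
  have pfst_col: "pfst (col t) = pfst t" for t by (simp add: col_def)
  have skip: "mu (h z) = \<pi> iB" if "z \<notin> range cq" for z
    using that eq[of z] mu_no_item[of z i 0 0] by (auto simp: ai_def)
  from d show False
  proof
    \<comment> \<open>In column 0 nothing is forgotten by \<open>col\<close>, so \<open>h\<close>
      agrees at \<open>x\<close> and at a skipped place although the colours differ.\<close>
    assume "d = 0"
    obtain z where z: "z \<in> Rset (Lp p)" "z \<notin> range cq" using skipped by blast
    have "col (h z) = col (h x)" using v z(1) xR by simp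
    moreover have "pfst (h z) = 0" "pfst (h x) = 0"
      using calculation q(3) \<open>d = 0\<close> pfst_col[of "h z"] pfst_col[of "h x"] by simp_all
    ultimately have "h z = h x" by (simp add: col_def)
    then show False using skip[OF z(2)] A colours by simp
  next
    assume "\<exists>i' j'. d = Suc (pr i' j') \<and> i' \<in> Y \<and> j' \<le> Suc i' \<and> pfst q = Suc i'"
    then obtain i' j' where ij: "d = Suc (pr i' j')" "i' \<in> Y" "j' \<le> Suc i'" "pfst q = Suc i'" by blast
    \<comment> \<open>At skipped places the colour is the second one, and for a given piece and
      element only the exceptional copy has it (none if \<open>j' = 0\<close>). So \<open>h\<close>
      takes one value at infinitely many places, but another at \<open>x\<close>.\<close>
    define E where "E = pr (Suc (pr i' j')) (pr (cq q) (exc q j'))"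
    have hE: "h z = E" if z: "z \<in> Rset (Lp p)" "z \<notin> range cq" for z
    proof -
      have c: "col (h z) = pr (Suc (pr i' j')) (cq q)" using v[OF z(1)] v[OF xR] q(3) ij(1) by simp
      then have 1: "pfst (h z) = Suc (pr i' j')" using pfst_col[of "h z"] by simp
      with c have 2: "pfst (psnd (h z)) = cq q" by (simp add: col_def)
      have t: "h z = pr (Suc (pr i' j')) (pr (cq q) (psnd (psnd (h z))))" using 1 2 by (metis pr_pfst_psnd)
      have "mu (h z) = \<pi> iB" by (rule skip[OF z(2)])
      then have "psnd (psnd (h z)) = exc q j'"
        using mu_item[OF ij(2,3,4), of "psnd (psnd (h z))"] t colours by (metis)
      with t show ?thesis unfolding E_def by simp
    qed
    have "const_or_finite_to_one h (Rset (Lp p))"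
      using const_or_finite_to_one_subset[OF Rset_const_or_finite_to_one[of "pr e (pr 0 0)"] Rset_antimono[of "Suc (pr e (pr 0 0))" "Lp p"]]
        less_Lp[of e p 0 0] ep(1) e by simp
    then show False
      unfolding const_or_finite_to_one_def
    proof
      assume "\<exists>v. \<forall>x\<in>Rset (Lp p). h x = v"
      moreover obtain z where z: "z \<in> Rset (Lp p)" "z \<notin> range cq" using skipped by blast
      ultimately have "h z = h x" using xR by metis
      then show False using skip[OF z(2)] A colours by simp
    next
      assume "\<forall>v. \<exists>b. \<forall>x\<in>Rset (Lp p). h x = v \<longrightarrow> x \<le> b"
      then obtain b where b: "\<And>z. z \<in> Rset (Lp p) \<Longrightarrow> h z = E \<Longrightarrow> z \<le> b" by blast
      obtain z where z: "z \<in> Rset (Lp p)" "Suc b \<le> z" "z \<notin> range cq" using skipped by blast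
      with b[OF z(1) hE[OF z(1,3)]] show False by simp
    qed
  qed
qed

text \<open>The element \<open>p\<close> is the one reserved for this function and piece. Two of the
  ways in \<open>espec\<close> contradict the reduction at once. In the remaining one the target has
  the first colour: later elements are excluded by domination, earlier ones by \<open>isM\<close>
  and \<open>isSig\<close>, and at \<open>p\<close> only the piece \<open>(i, j)\<close> escapes
  \<open>isM\<close>, which \<open>avoid\<close> excludes.\<close>

lemma not_reducible_b:
  assumes i: "i \<in> Y" and j: "0 < j" "j \<le> Suc i" and h: "computable h" and eq: "\<And>w. mu (piece i j w) = mu (h w)"
    and avoid: "\<And>w. pfst (h w) \<noteq> Suc (pr i j)"
  shows False
proof -
  from h obtain e where e: "phi e = h" by (rule computable_ex_phi)
  define p where "p = pr (Suc i) (pr e (pr j 0))"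
  have lab: "pfst p = Suc i" and ei: "eidx p = e" and ji: "jidx p = j"
    by (simp_all add: p_def eidx_def jidx_def)
  have ep: "e \<le> p" unfolding p_def by (meson le_prod_encode_1 le_prod_encode_2 le_trans)
  have target: "target p y = h (pr (cq p) y)" for y by (simp add: target_def ei e)
  have b: "mu (h (pr (cq p) y)) = (if y \<noteq> est Y p then \<pi> iA else \<pi> iB)" for y
    using mu_item[OF i j(2) lab, of y] eq[of "pr (cq p) y"] j(1) by (simp add: piece_def nx_def ji)
  have isM: "mu t = \<pi> iA" if "isM Y (est Y) p t" for t
    using that unfolding isM_def
  proof
    assume "\<exists>q. q < p \<and> inM Y (est Y) t q"
    then show ?thesis using mu_inM by blast
  next
    assume "\<exists>i j y. t = pr (Suc (pr i j)) (pr (cq p) y) \<and> pfst p = Suc i \<and> i \<in> Y \<and> j \<le> Suc i \<and> j \<noteq> jidx p \<and>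
       (j = 0 \<or> y \<noteq> ell p)"
    then have "inM Y (est Y) t p" unfolding inM_def nx_def by auto
    then show ?thesis by (rule mu_inM)
  qed
  from espec_est[of Y p] obtain y where y: "y \<in> cand p"
    and "est Y p = y \<and> isM Y (est Y) p (target p y) \<or>
      est Y p \<noteq> y \<and> \<not> isM Y (est Y) p (target p y) \<and> \<not> isSig p (target p y) \<or>
      est Y p = y \<and> (\<exists>y'. y' \<in> cand p \<and> y' \<noteq> y \<and> target p y' = target p y)"
    unfolding espec_def by blast
  then consider "est Y p = y" "isM Y (est Y) p (target p y)"
    | "est Y p \<noteq> y" "\<not> isM Y (est Y) p (target p y)" "\<not> isSig p (target p y)"
    | y' where "est Y p = y" "y' \<noteq> y" "target p y' = target p y" by blast
  then show False
  proof cases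
    case 1
    then show False using isM[OF 1(2)] b[of y] colours by (simp add: target)
  next
    case 3
    then show False using b[of y] b[of y'] colours by (simp add: target)
  next
    case 2
    let ?t = "target p y"
    have "mu ?t \<noteq> \<pi> iB" using 2(1) b[of y] colours by (simp add: target)
    have w: "pr (cq p) y \<le> pr (cq p) (2 ^ cq p)" using cand(3)[OF y] by (intro pr_mono) simp_all
    have late: "\<not> p < q" if "cq q \<le> ?t" for q
      using cq_dominates[of e q p "pr (cq p) y"] ep that w by (auto simp: target e)
    from \<open>mu ?t \<noteq> \<pi> iB\<close> show False
    proof (cases rule: mu_not_B_cases)
      case (1 q)
      have "\<not> p < q" using late[of q] 1(2) le_prod_encode_2[of "cq q" 0] by simp
      moreover have "q \<noteq> p" using 1(1) lab by auto
      ultimately show False using 2(3) 1 unfolding isSig_def by (metis linorder_neqE_nat)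
    next
      case q: (2 q)
      then obtain i' j' y' where t: "?t = pr (Suc (pr i' j')) (pr (cq q) y')" "pfst q = Suc i'" "i' \<in> Y" "j' \<le> Suc i'"
        "j' = 0 \<or> y' \<noteq> exc q j'" by (rule inM_D)
      have "cq q \<le> ?t" unfolding t(1) by (meson le_prod_encode_1 le_prod_encode_2 le_trans)
      then have "\<not> p < q" by (rule late)
      moreover have "\<not> q < p" using 2(2) q unfolding isM_def by blast
      ultimately have qp: "q = p" by simp
      then have "i' = i" using t(2) lab by simp
      then have "j' \<noteq> jidx p" using avoid[of "pr (cq p) y"] t(1) by (auto simp: target ji)
      then have "isM Y (est Y) p ?t" unfolding isM_def using t qp by (auto simp: nx_def)
      then show False using 2(2) by blast
    qed
  qed
qed

section \<open>The interval between nu0 and mu\<close>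

definition interval :: "numbering set" where
  "interval = {\<nu>. \<exists>f. computable f \<and> \<nu> = (\<lambda>z. mu (f z)) \<and> num_reducible nu0 \<nu>}"

lemma interval_nu0: "\<nu> \<in> interval \<Longrightarrow> num_reducible nu0 \<nu>"
  unfolding interval_def by blast

lemma interval_phi:
  assumes "\<nu> \<in> interval"
  obtains e where "\<nu> = (\<lambda>z. mu (phi e z))" "num_reducible nu0 (\<lambda>z. mu (phi e z))"
proof -
  from assms obtain f where f: "computable f" "\<nu> = (\<lambda>z. mu (f z))" "num_reducible nu0 \<nu>"
    unfolding interval_def by blast
  from f(1) obtain e where "phi e = f" by (rule computable_ex_phi)
  with f show thesis by (intro that[of e]) simp_all
qed

lemma sum_eq: "num_sum nu0 (\<lambda>x. mu (k x)) = (\<lambda>z. mu (if even z then pr 0 (z div 2) else k (z div 2)))"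
  by (auto simp: num_sum_def nu0_def fun_eq_iff)

lemma computable_sum: "computable k \<Longrightarrow> computable (\<lambda>z. if even z then pr 0 (z div 2) else k (z div 2))"
  unfolding computable_iff_recfun by (intro rec_intros recfun_computable[of k]) (simp add: computable_iff_recfun)

lemma sum_in_interval: "computable k \<Longrightarrow> num_sum nu0 (\<lambda>x. mu (k x)) \<in> interval"
  unfolding interval_def using computable_sum[of k] sum_eq[of k] num_reducible_sum(1)[of nu0 "\<lambda>x. mu (k x)"] by blast

lemma alpha_in_interval: "alpha i \<in> interval" and beta_in_interval: "beta i j \<in> interval"
  unfolding alpha_def beta_def by (intro sum_in_interval computable_ai computable_piece)+

text \<open>What lies below the sum is \<open>mu\<close> along a function with values in column 0 or
  among the values of \<open>k\<close>; on all pieces avoided by \<open>k\<close> this function has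
  type 0.\<close>

lemma below_sum:
  assumes "num_reducible \<nu> (num_sum nu0 (\<lambda>x. mu (k x)))" "computable k"
  obtains e where "\<nu> = (\<lambda>z. mu (phi e z))" "\<And>z. pfst (phi e z) = 0 \<or> (\<exists>x. phi e z = k x)"
proof -
  from assms(1) obtain g where g: "computable g" "\<And>z. \<nu> z = num_sum nu0 (\<lambda>x. mu (k x)) (g z)"
    unfolding num_reducible_def by blast
  define h where "h z = (if even (g z) then pr 0 (g z div 2) else k (g z div 2))" for z
  have "computable h" unfolding h_def using computable_comp[OF computable_sum[OF assms(2)] g(1)] .
  then obtain e where e: "phi e = h" by (rule computable_ex_phi)
  show thesis
    by (rule that[of e]) (auto simp: e h_def g(2) sum_eq fun_eq_iff)
qed

lemma le_sum_iff:
  assumes "\<nu> \<in> interval"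
  shows "num_reducible (num_sum nu0 \<mu>') \<nu> \<longleftrightarrow> num_reducible \<mu>' \<nu>"
  using assms num_reducible_sum(2,3) num_reducible_trans unfolding interval_def by blast

lemma ai_le_alpha: "num_reducible (\<lambda>x. mu (ai i x)) (alpha i)"
  and piece_le_beta: "num_reducible (\<lambda>w. mu (piece i j w)) (beta i j)"
  and nu0_le_alpha: "num_reducible nu0 (alpha i)"
  unfolding alpha_def beta_def by (rule num_reducible_sum)+

lemma alpha_not_le_nu0:
  assumes "i \<in> Y"
  shows "\<not> num_reducible (alpha i) nu0"
proof
  assume "num_reducible (alpha i) nu0"
  with ai_le_alpha have "num_reducible (\<lambda>x. mu (ai i x)) nu0" by (rule num_reducible_trans)
  then obtain g where g: "computable g" "\<And>x. mu (ai i x) = mu (pr 0 (g x))"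
    unfolding num_reducible_def nu0_def by blast
  show False by (rule not_reducible_a[OF assms computable_comp[OF computable_pr0 g(1)] g(2)]) simp
qed

lemma alpha_incomparable:
  assumes "i \<in> Y" "i \<noteq> i'"
  shows "\<not> num_reducible (alpha i) (alpha i')"
proof
  assume "num_reducible (alpha i) (alpha i')"
  with ai_le_alpha have "num_reducible (\<lambda>x. mu (ai i x)) (alpha i')" by (rule num_reducible_trans)
  from below_sum[OF this[unfolded alpha_def] computable_ai] obtain e where
    e: "(\<lambda>x. mu (ai i x)) = (\<lambda>z. mu (phi e z))" "\<And>z. pfst (phi e z) = 0 \<or> (\<exists>x. phi e z = ai i' x)" by blast
  have avoid: "pfst (phi e z) \<noteq> Suc (pr i j)" for z j
    using e(2)[of z] assms(2) by (auto simp: ai_def)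
  show False by (rule not_reducible_a[OF assms(1) computable_phi[of e] fun_cong[OF e(1)] avoid])
qed

lemma no_hit_type0: "(\<And>z. pfst (phi e z) \<noteq> Suc (pr i j)) \<Longrightarrow> type0 e i j"
  unfolding type0_def hit_def by (metis pfst_pr)

text \<open>A function representing a numbering below \<open>alpha i\<close> can meet only piece
  \<open>(i, 0)\<close>: type 0 there puts it below \<open>nu0\<close>, any other type above
  \<open>alpha i\<close>.\<close>

lemma alpha_atom:
  assumes i: "i \<in> Y"
  shows "atom_over interval num_reducible nu0 (alpha i)"
  unfolding atom_over_def
proof (intro conjI ballI impI)
  show "alpha i \<in> interval" by (rule alpha_in_interval)
  show "\<not> num_reducible (alpha i) nu0" by (rule alpha_not_le_nu0[OF i])
  fix \<nu> assume \<nu>: "\<nu> \<in> interval" and le: "num_reducible \<nu> (alpha i)"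
  from below_sum[OF le[unfolded alpha_def] computable_ai] obtain e where
    e: "\<nu> = (\<lambda>z. mu (phi e z))" "\<And>z. pfst (phi e z) = 0 \<or> (\<exists>x. phi e z = ai i x)" by blast
  have 0: "num_reducible nu0 (\<lambda>z. mu (phi e z))" using interval_nu0[OF \<nu>] by (simp add: e(1))
  have t0: "type0 e i' j" if "(i', j) \<noteq> (i, 0)" for i' j
  proof (rule no_hit_type0)
    show "pfst (phi e z) \<noteq> Suc (pr i' j)" for z using e(2)[of z] that by (auto simp: ai_def)
  qed
  show "num_reducible \<nu> nu0 \<or> num_reducible (alpha i) \<nu>"
  proof (cases "type0 e i 0")
    case True
    then have "type0 e i' j" for i' j using t0 by (cases "(i', j) = (i, 0)") auto
    then have "num_reducible (\<lambda>z. mu (phi e z)) nu0"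
      by (intro reduce_upper[OF num_reducible_refl, of i]) auto
    then show ?thesis by (simp add: e(1))
  next
    case False
    from reduce_lower_a[OF 0 i _ this] show ?thesis
      using le_sum_iff[OF \<nu>] by (simp add: alpha_def e(1))
  qed
qed

lemma alpha_le_beta:
  assumes i: "i \<in> Y" and j: "j \<le> Suc i"
  shows "num_reducible (alpha i) (beta i j)"
proof -
  \<comment> \<open>Candidates at \<open>x\<close> are below \<open>2 ^ x\<close>, so copy
    \<open>2 ^ x\<close> is never exceptional.\<close>
  have "mu (ai i x) = mu (piece i j (pr x (2 ^ x)))" for x
  proof (cases "\<exists>p. x = cq p \<and> pfst p = Suc i")
    case True
    then obtain p where p: "x = cq p" "pfst p = Suc i" by blast
    have "exc p j < 2 ^ cq p" by (rule cand(3)[OF nx_in_cand])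
    then show ?thesis using mu_item[OF i _ p(2), of 0] mu_item[OF i j p(2)] by (simp add: ai_def piece_def p(1))
  next
    case False
    then show ?thesis unfolding ai_def piece_def by (simp add: mu_no_item)
  qed
  moreover have "computable (\<lambda>x. pr x (2 ^ x))" unfolding computable_iff_recfun by (intro rec_intros)
  ultimately have "num_reducible (\<lambda>x. mu (ai i x)) (\<lambda>w. mu (piece i j w))"
    unfolding num_reducible_def by blast
  from num_reducible_trans[OF this piece_le_beta] show ?thesis
    unfolding alpha_def using le_sum_iff[OF beta_in_interval] by blast
qed

lemma beta_not_le:
  assumes i: "i \<in> Y" and j: "0 < j" "j \<le> Suc i" and k: "computable k" "\<And>x. pfst (k x) \<noteq> Suc (pr i j)"
  shows "\<not> num_reducible (beta i j) (num_sum nu0 (\<lambda>x. mu (k x)))"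
proof
  assume "num_reducible (beta i j) (num_sum nu0 (\<lambda>x. mu (k x)))"
  with piece_le_beta have "num_reducible (\<lambda>w. mu (piece i j w)) (num_sum nu0 (\<lambda>x. mu (k x)))" by (rule num_reducible_trans)
  from below_sum[OF this k(1)] obtain e where
    e: "(\<lambda>w. mu (piece i j w)) = (\<lambda>z. mu (phi e z))" "\<And>z. pfst (phi e z) = 0 \<or> (\<exists>x. phi e z = k x)" by blast
  have avoid: "pfst (phi e z) \<noteq> Suc (pr i j)" for z
    using e(2)[of z] k(2) by auto
  show False by (rule not_reducible_b[OF i j computable_phi[of e] fun_cong[OF e(1)] avoid])
qed

lemma beta_not_le_alpha: "i \<in> Y \<Longrightarrow> 0 < j \<Longrightarrow> j \<le> Suc i \<Longrightarrow> \<not> num_reducible (beta i j) (alpha i)"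
  unfolding alpha_def by (rule beta_not_le[OF _ _ _ computable_ai]) (auto simp: ai_def)

lemma beta_incomparable:
  "i \<in> Y \<Longrightarrow> 0 < j \<Longrightarrow> j \<le> Suc i \<Longrightarrow> j \<noteq> j' \<Longrightarrow> \<not> num_reducible (beta i j) (beta i j')"
  unfolding beta_def[of i j'] by (rule beta_not_le[OF _ _ _ computable_piece]) (auto simp: piece_def)

text \<open>The three types on piece \<open>(i, j)\<close> are the three possibilities below
  \<open>beta i j\<close>: type 0 gives the bottom, type 1 the atom, type 2 the cover
  itself.\<close>

lemma beta_cover:
  assumes i: "i \<in> Y" and j: "0 < j" "j \<le> Suc i"
  shows "chain_cover interval num_reducible nu0 (alpha i) (beta i j)"
  unfolding chain_cover_def
proof (intro conjI ballI impI)
  show "beta i j \<in> interval" by (rule beta_in_interval)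
  show "num_reducible (alpha i) (beta i j)" by (rule alpha_le_beta[OF i j(2)])
  show "\<not> num_reducible (beta i j) (alpha i)" by (rule beta_not_le_alpha[OF i j])
  fix \<nu> assume \<nu>: "\<nu> \<in> interval" and le: "num_reducible \<nu> (beta i j)"
  from below_sum[OF le[unfolded beta_def] computable_piece] obtain e where
    e: "\<nu> = (\<lambda>z. mu (phi e z))" "\<And>z. pfst (phi e z) = 0 \<or> (\<exists>x. phi e z = piece i j x)" by blast
  have 0: "num_reducible nu0 (\<lambda>z. mu (phi e z))" using interval_nu0[OF \<nu>] by (simp add: e(1))
  have t0: "type0 e i' j'" if "(i', j') \<noteq> (i, j)" for i' j'
  proof (rule no_hit_type0)
    show "pfst (phi e z) \<noteq> Suc (pr i' j')" for z using e(2)[of z] that by (auto simp: piece_def)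
  qed
  show "num_reducible \<nu> nu0 \<or> num_reducible \<nu> (alpha i) \<and> num_reducible (alpha i) \<nu> \<or> num_reducible (beta i j) \<nu>"
  proof (cases "type0 e i j")
    case True
    then have "type0 e i' j'" for i' j' using t0 by (cases "(i', j') = (i, j)") auto
    then have "num_reducible (\<lambda>z. mu (phi e z)) nu0"
      by (intro reduce_upper[OF num_reducible_refl, of i]) auto
    then show ?thesis by (simp add: e(1))
  next
    case n0: False
    have "num_reducible (alpha i) \<nu>"
      using reduce_lower_a[OF 0 i j(2) n0] le_sum_iff[OF \<nu>] by (simp add: alpha_def e(1))
    show ?thesis
    proof (cases "type2 e i j")
      case True
      from reduce_lower_b[OF 0 i j(2) True] show ?thesis
        using le_sum_iff[OF \<nu>] by (simp add: beta_def e(1))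
    next
      case False
      with n0 type_cases have t1: "type1 e i j" by blast
      have "num_reducible (\<lambda>z. mu (phi e z)) (alpha i)"
      proof (rule reduce_upper[OF nu0_le_alpha, of i])
        show "type0 e i' j'" if "i' \<noteq> i" for i' j' using t0 that by simp
        show "type0 e i j' \<or> (type1 e i j' \<or> j' = 0) \<and> num_reducible (\<lambda>x. mu (ai i x)) (alpha i)" for j'
          using t0[of i j'] t1 ai_le_alpha by (cases "j' = j") auto
      qed
      with \<open>num_reducible (alpha i) \<nu>\<close> show ?thesis by (simp add: e(1))
    qed
  qed
qed

text \<open>Meeting another label would put a foreign atom below \<open>c\<close>. If no piece with
  \<open>j > 0\<close> had type 2, \<open>c\<close> would be below \<open>alpha i\<close>; so some
  \<open>beta i j\<close> is below \<open>c\<close>, and the cover property makes them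
  equivalent.\<close>

lemma beta_complete:
  assumes i: "i \<in> Y" and c: "chain_cover interval num_reducible nu0 (alpha i) c"
  shows "\<exists>j. 0 < j \<and> j \<le> Suc i \<and> num_reducible c (beta i j) \<and> num_reducible (beta i j) c"
proof -
  from c have cX: "c \<in> interval" and ac: "num_reducible (alpha i) c" and nca: "\<not> num_reducible c (alpha i)"
    and cone: "\<And>z. z \<in> interval \<Longrightarrow> num_reducible z c \<Longrightarrow>
      num_reducible z nu0 \<or> num_reducible z (alpha i) \<and> num_reducible (alpha i) z \<or> num_reducible c z"
    unfolding chain_cover_def by blast+
  from cX obtain e where e: "c = (\<lambda>z. mu (phi e z))" "num_reducible nu0 (\<lambda>z. mu (phi e z))" by (rule interval_phi)
  have other: "type0 e i' j" if i': "i' \<in> Y" "i' \<noteq> i" "j \<le> Suc i'" for i' j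
  proof (rule ccontr)
    assume "\<not> type0 e i' j"
    from reduce_lower_a[OF e(2) i'(1,3) this] have "num_reducible (alpha i') c"
      using le_sum_iff[OF cX] by (simp add: alpha_def e(1))
    from cone[OF alpha_in_interval this] alpha_not_le_nu0[OF i'(1)] alpha_incomparable[OF i'(1,2)]
    have "num_reducible c (alpha i')" by blast
    with ac have "num_reducible (alpha i) (alpha i')" by (rule num_reducible_trans)
    with alpha_incomparable[OF i, of i'] i'(2) show False by simp
  qed
  show ?thesis
  proof (cases "\<exists>j. 0 < j \<and> j \<le> Suc i \<and> type2 e i j")
    case True
    then obtain j where j: "0 < j" "j \<le> Suc i" "type2 e i j" by blast
    from reduce_lower_b[OF e(2) i j(2,3)] have bc: "num_reducible (beta i j) c"
      using le_sum_iff[OF cX] by (simp add: beta_def e(1))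
    have "\<not> num_reducible (beta i j) nu0"
      using beta_not_le_alpha[OF i j(1,2)] nu0_le_alpha num_reducible_trans by blast
    with cone[OF beta_in_interval bc] beta_not_le_alpha[OF i j(1,2)] have "num_reducible c (beta i j)" by blast
    with bc j show ?thesis by blast
  next
    case False
    have "num_reducible (\<lambda>z. mu (phi e z)) (alpha i)"
    proof (rule reduce_upper[OF nu0_le_alpha, of i])
      show "type0 e i' j" if "i' \<in> Y" "i' \<noteq> i" "j \<le> Suc i'" for i' j using other that by blast
      \<comment> \<open>For \<open>j = 0\<close> even type 2 is harmless, because piece 0 has no
        exceptional copy.\<close>
      show "type0 e i j \<or> (type1 e i j \<or> j = 0) \<and> num_reducible (\<lambda>x. mu (ai i x)) (alpha i)" if "j \<le> Suc i" for j
        using False that type_cases[of e i j] ai_le_alpha by blast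
    qed
    with nca show ?thesis by (simp add: e(1))
  qed
qed

end

text \<open>Each \<open>b j\<close> is equivalent to some \<open>b' k\<close>, injectively since the
  \<open>b j\<close> are pairwise inequivalent. Used in both directions, this compares two counts of
  the covers of one atom.\<close>

lemma count_le:
  fixes i i' :: nat
  assumes "\<And>x y z. lq x y \<Longrightarrow> lq y z \<Longrightarrow> lq x z"
    and "\<And>j. j \<le> i \<Longrightarrow> C (b j)"
    and inequiv: "\<And>j j'. j \<le> i \<Longrightarrow> j' \<le> i \<Longrightarrow> j \<noteq> j' \<Longrightarrow> \<not> (lq (b j) (b j') \<and> lq (b j') (b j))"
    and "\<And>c. C c \<Longrightarrow> \<exists>j\<le>i'. lq c (b' j) \<and> lq (b' j) c"
  shows "i \<le> i'"
proof -
  have "\<forall>j\<in>{..i}. \<exists>k. k \<le> i' \<and> lq (b j) (b' k) \<and> lq (b' k) (b j)" using assms(2,4) by blast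
  then obtain f where f: "\<And>j. j \<le> i \<Longrightarrow> f j \<le> i' \<and> lq (b j) (b' (f j)) \<and> lq (b' (f j)) (b j)"
    unfolding bchoice_iff by auto
  have "inj_on f {..i}"
  proof (rule inj_onI, rule ccontr)
    fix j j' assume j: "j \<in> {..i}" "j' \<in> {..i}" "f j = f j'" "j \<noteq> j'"
    have "lq (b j) (b j')" "lq (b j') (b j)"
      using f[of j] f[of j'] j assms(1)[of "b j" "b' (f j)" "b j'"] assms(1)[of "b j'" "b' (f j)" "b j"] by simp_all
    with inequiv[of j j'] j show False by simp
  qed
  then have "card {..i} \<le> card {..i'}"
    by (rule card_inj_on_le) (use f in auto)
  then show ?thesis by simp
qed

lemma chain_cover_equiv:
  assumes trans: "\<And>x y z. lq x y \<Longrightarrow> lq y z \<Longrightarrow> lq x z" and "lq a a'" "lq a' a"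
  shows "chain_cover X lq z0 a c \<longleftrightarrow> chain_cover X lq z0 a' c"
proof -
  have "lq a x \<longleftrightarrow> lq a' x" "lq x a \<longleftrightarrow> lq x a'" for x using assms by blast+
  then show ?thesis unfolding chain_cover_def by simp
qed

context coding
begin

text \<open>For the converse: an atom is not below \<open>nu0\<close>, so its function has a piece
  not of type 0. It is then above some \<open>alpha i'\<close>, hence equivalent to it, and counting
  covers gives \<open>i = i'\<close>.\<close>

theorem codes_interval: "codes interval num_reducible nu0 i \<longleftrightarrow> i \<in> Y"
proof
  assume i: "i \<in> Y"
  show "codes interval num_reducible nu0 i"
    unfolding codes_def
  proof (intro exI[of _ "alpha i"] exI[of _ "\<lambda>j. beta i (Suc j)"] conjI allI impI)
    show "atom_over interval num_reducible nu0 (alpha i)" by (rule alpha_atom[OF i])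
    show "chain_cover interval num_reducible nu0 (alpha i) (beta i (Suc j))" if "j \<le> i" for j
      using that by (intro beta_cover[OF i]) auto
    show "\<not> (num_reducible (beta i (Suc j)) (beta i (Suc j')) \<and> num_reducible (beta i (Suc j')) (beta i (Suc j)))"
      if "j \<le> i" "j' \<le> i" "j \<noteq> j'" for j j' using beta_incomparable[OF i, of "Suc j" "Suc j'"] that by simp
    fix c assume "chain_cover interval num_reducible nu0 (alpha i) c"
    from beta_complete[OF i this] obtain j where "0 < j" "j \<le> Suc i" "num_reducible c (beta i j)" "num_reducible (beta i j) c"
      by blast
    then show "\<exists>j\<le>i. num_reducible c (beta i (Suc j)) \<and> num_reducible (beta i (Suc j)) c"
      by (intro exI[of _ "j - 1"]) auto
  qed
next
  assume "codes interval num_reducible nu0 i"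
  then obtain a b where a: "atom_over interval num_reducible nu0 a"
    and b: "\<And>j. j \<le> i \<Longrightarrow> chain_cover interval num_reducible nu0 a (b j)"
      "\<And>j j'. j \<le> i \<Longrightarrow> j' \<le> i \<Longrightarrow> j \<noteq> j' \<Longrightarrow> \<not> (num_reducible (b j) (b j') \<and> num_reducible (b j') (b j))"
      "\<And>c. chain_cover interval num_reducible nu0 a c \<Longrightarrow> \<exists>j\<le>i. num_reducible c (b j) \<and> num_reducible (b j) c"
    unfolding codes_def by blast
  from a have aX: "a \<in> interval" by (simp add: atom_over_def)
  then obtain e where e: "a = (\<lambda>z. mu (phi e z))" "num_reducible nu0 (\<lambda>z. mu (phi e z))" by (rule interval_phi)
  have "\<exists>i'\<in>Y. \<exists>j\<le>Suc i'. \<not> type0 e i' j"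
  proof (rule ccontr)
    assume "\<not> (\<exists>i'\<in>Y. \<exists>j\<le>Suc i'. \<not> type0 e i' j)"
    then have "num_reducible (\<lambda>z. mu (phi e z)) nu0"
      by (intro reduce_upper[OF num_reducible_refl, of 0]) blast+
    with a show False by (simp add: atom_over_def e(1))
  qed
  then obtain i' j where i': "i' \<in> Y" "j \<le> Suc i'" "\<not> type0 e i' j" by blast
  from reduce_lower_a[OF e(2) this] have le: "num_reducible (alpha i') a"
    using le_sum_iff[OF aX] by (simp add: alpha_def e(1))
  have ge: "num_reducible a (alpha i')"
    using a alpha_in_interval[of i'] le alpha_not_le_nu0[OF i'(1)] unfolding atom_over_def by blast
  have cov: "chain_cover interval num_reducible nu0 a c \<longleftrightarrow> chain_cover interval num_reducible nu0 (alpha i') c" for c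
    by (rule chain_cover_equiv[of num_reducible, OF num_reducible_trans ge le])
  have "i \<le> i'"
  proof (rule count_le[of num_reducible i "chain_cover interval num_reducible nu0 a" b i' "\<lambda>j. beta i' (Suc j)"])
    show "\<exists>j\<le>i'. num_reducible c (beta i' (Suc j)) \<and> num_reducible (beta i' (Suc j)) c"
      if "chain_cover interval num_reducible nu0 a c" for c
    proof -
      from beta_complete[OF i'(1) that[unfolded cov]] obtain j where "0 < j" "j \<le> Suc i'" "num_reducible c (beta i' j)" "num_reducible (beta i' j) c"
        by blast
      then show ?thesis by (intro exI[of _ "j - 1"]) auto
    qed
    show "num_reducible x y \<Longrightarrow> num_reducible y z \<Longrightarrow> num_reducible x z" for x y z
      by (rule num_reducible_trans)
  qed (fact b)+
  moreover have "i' \<le> i"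
  proof (rule count_le[of num_reducible i' "chain_cover interval num_reducible nu0 a" "\<lambda>j. beta i' (Suc j)" i b])
    show "chain_cover interval num_reducible nu0 a (beta i' (Suc j))" if "j \<le> i'" for j
      using cov beta_cover[OF i'(1), of "Suc j"] that by simp
    show "\<not> (num_reducible (beta i' (Suc j)) (beta i' (Suc j')) \<and> num_reducible (beta i' (Suc j')) (beta i' (Suc j)))"
      if "j \<le> i'" "j' \<le> i'" "j \<noteq> j'" for j j' using beta_incomparable[OF i'(1), of "Suc j" "Suc j'"] that by simp
    show "num_reducible x y \<Longrightarrow> num_reducible y z \<Longrightarrow> num_reducible x z" for x y z
      by (rule num_reducible_trans)
  qed (fact b(3))
  ultimately show "i \<in> Y" using i'(1) by simp
qed

end

section \<open>Isomorphic Rogers semilattices\<close>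

text \<open>\<open>E\<close> is a relation because an isomorphism of the quotients determines
  numberings only up to equivalence. Totality on both sides and preservation of order suffice, as
  \<open>codes\<close> speaks only of order up to equivalence.\<close>

lemma codes_transfer:
  fixes E :: "'a \<Rightarrow> 'b \<Rightarrow> bool"
  assumes XX': "\<And>x x'. E x x' \<Longrightarrow> x \<in> X \<and> x' \<in> X'"
    and total: "\<And>x. x \<in> X \<Longrightarrow> \<exists>x'. E x x'" "\<And>x'. x' \<in> X' \<Longrightarrow> \<exists>x. E x x'"
    and ord: "\<And>x x' y y'. E x x' \<Longrightarrow> E y y' \<Longrightarrow> lq x y \<longleftrightarrow> lq' x' y'"
    and zb: "E zb zb'" and "codes X lq zb i"
  shows "codes X' lq' zb' i"
proof -
  have atom: "atom_over X' lq' zb' a'" if "atom_over X lq zb a" "E a a'" for a a'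
    unfolding atom_over_def
  proof (intro conjI ballI impI)
    show "a' \<in> X'" using XX' that(2) by blast
    show "\<not> lq' a' zb'" using that ord[OF that(2) zb] by (simp add: atom_over_def)
    fix z' assume "z' \<in> X'" "lq' z' a'"
    then obtain z where z: "E z z'" using total by blast
    with that XX'[OF z] \<open>lq' z' a'\<close> show "lq' z' zb' \<or> lq' a' z'"
      using ord[OF z that(2)] ord[OF z zb] ord[OF that(2) z] by (auto simp: atom_over_def)
  qed
  have ball: "(\<forall>z\<in>X. P z) \<longleftrightarrow> (\<forall>z\<in>X'. P' z)" if P: "\<And>z z'. E z z' \<Longrightarrow> P z \<longleftrightarrow> P' z'" for P P'
  proof (intro iffI ballI)
    fix z' assume all: "\<forall>z\<in>X. P z" and "z' \<in> X'"
    then obtain z where "E z z'" using total(2) by auto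
    with all XX' P show "P' z'" by auto
  next
    fix z assume all: "\<forall>z\<in>X'. P' z" and "z \<in> X"
    then obtain z' where "E z z'" using total(1) by auto
    with all XX' P show "P z" by auto
  qed
  have cover: "chain_cover X lq zb a b \<longleftrightarrow> chain_cover X' lq' zb' a' b'" if a: "E a a'" and b: "E b b'" for a a' b b'
  proof -
    have "(\<forall>z\<in>X. lq z b \<longrightarrow> lq z zb \<or> lq z a \<and> lq a z \<or> lq b z) \<longleftrightarrow>
      (\<forall>z\<in>X'. lq' z b' \<longrightarrow> lq' z zb' \<or> lq' z a' \<and> lq' a' z \<or> lq' b' z)"
    proof (rule ball)
      show "(lq z b \<longrightarrow> lq z zb \<or> lq z a \<and> lq a z \<or> lq b z) \<longleftrightarrow>
        (lq' z' b' \<longrightarrow> lq' z' zb' \<or> lq' z' a' \<and> lq' a' z' \<or> lq' b' z')" if z: "E z z'" for z z'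
        using ord[OF z b] ord[OF z zb] ord[OF z a] ord[OF a z] ord[OF b z] by simp
    qed
    then show ?thesis
      unfolding chain_cover_def using XX'[OF b] ord[OF a b] ord[OF b a] by simp
  qed
  from \<open>codes X lq zb i\<close> obtain a b where a: "atom_over X lq zb a"
    and b: "\<And>j. j \<le> i \<Longrightarrow> chain_cover X lq zb a (b j)"
      "\<And>j j'. j \<le> i \<Longrightarrow> j' \<le> i \<Longrightarrow> j \<noteq> j' \<Longrightarrow> \<not> (lq (b j) (b j') \<and> lq (b j') (b j))"
      "\<And>c. chain_cover X lq zb a c \<Longrightarrow> \<exists>j\<le>i. lq c (b j) \<and> lq (b j) c"
    unfolding codes_def by blast
  obtain a' where a': "E a a'" using a total unfolding atom_over_def by blast
  have "\<forall>j\<in>{..i}. \<exists>x'. E (b j) x'" using b(1) total unfolding chain_cover_def by blast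
  then obtain b' where b': "\<And>j. j \<le> i \<Longrightarrow> E (b j) (b' j)" unfolding bchoice_iff by auto
  show ?thesis
    unfolding codes_def
  proof (intro exI[of _ a'] exI[of _ b'] conjI allI impI)
    show "atom_over X' lq' zb' a'" by (rule atom[OF a a'])
    show "chain_cover X' lq' zb' a' (b' j)" if "j \<le> i" for j
      using b(1)[OF that] cover[OF a' b'[OF that]] by simp
    show "\<not> (lq' (b' j) (b' j') \<and> lq' (b' j') (b' j))" if "j \<le> i" "j' \<le> i" "j \<noteq> j'" for j j'
      using b(2)[OF that] ord[OF b'[OF that(1)] b'[OF that(2)]] ord[OF b'[OF that(2)] b'[OF that(1)]] by simp
    fix c' assume c': "chain_cover X' lq' zb' a' c'"
    then obtain c where c: "E c c'" using total unfolding chain_cover_def by blast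
    then have "chain_cover X lq zb a c" using c' cover[OF a' c] by simp
    from b(3)[OF this] obtain j where j: "j \<le> i" "lq c (b j)" "lq (b j) c" by blast
    then show "\<exists>j\<le>i. lq' c' (b' j) \<and> lq' (b' j) c'"
      using ord[OF c b'[OF j(1)]] ord[OF b'[OF j(1)] c] by blast
  qed
qed

lemma codes_transfer_iff:
  fixes E :: "'a \<Rightarrow> 'b \<Rightarrow> bool"
  assumes "\<And>x x'. E x x' \<Longrightarrow> x \<in> X \<and> x' \<in> X'"
    and "\<And>x. x \<in> X \<Longrightarrow> \<exists>x'. E x x'" "\<And>x'. x' \<in> X' \<Longrightarrow> \<exists>x. E x x'"
    and "\<And>x x' y y'. E x x' \<Longrightarrow> E y y' \<Longrightarrow> lq x y \<longleftrightarrow> lq' x' y'"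
    and "E zb zb'"
  shows "codes X lq zb i \<longleftrightarrow> codes X' lq' zb' i"
proof
  show "codes X lq zb i \<Longrightarrow> codes X' lq' zb' i"
    by (rule codes_transfer[where E = E and X = X and lq = lq and zb = zb]) (use assms in blast)+
  show "codes X' lq' zb' i \<Longrightarrow> codes X lq zb i"
    by (rule codes_transfer[where E = "\<lambda>x' x. E x x'" and X = X' and lq = lq' and zb = zb']) (use assms in blast)+
qed

text \<open>The list of covers is replaced by an index \<open>l\<close>, so that all quantifiers are
  over numbers.\<close>

lemma codes_nat:
  fixes X :: "nat set"
  shows "codes X lq z0 i \<longleftrightarrow> (\<exists>a. atom_over X lq z0 a \<and> (\<exists>l.
     (\<forall>j. j \<le> i \<longrightarrow> chain_cover X lq z0 a (phi l j)) \<and>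
     (\<forall>j j'. j \<le> i \<longrightarrow> j' \<le> i \<longrightarrow> j \<noteq> j' \<longrightarrow> \<not> (lq (phi l j) (phi l j') \<and> lq (phi l j') (phi l j))) \<and>
     (\<forall>c. chain_cover X lq z0 a c \<longrightarrow> (\<exists>j. j \<le> i \<and> lq c (phi l j) \<and> lq (phi l j) c))))"
  (is "_ \<longleftrightarrow> ?R")
proof
  assume "codes X lq z0 i"
  then obtain a b where ab: "atom_over X lq z0 a"
     "\<forall>j\<le>i. chain_cover X lq z0 a (b j)"
     "\<forall>j\<le>i. \<forall>j'\<le>i. j \<noteq> j' \<longrightarrow> \<not> (lq (b j) (b j') \<and> lq (b j') (b j))"
     "\<forall>c. chain_cover X lq z0 a c \<longrightarrow> (\<exists>j\<le>i. lq c (b j) \<and> lq (b j) c)"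
    unfolding codes_def by blast
  from computable_finite_sequence[of "Suc i" b] obtain l where l: "\<And>j. j \<le> i \<Longrightarrow> phi l j = b j"
    by (auto simp: less_Suc_eq_le)
  show ?R
  proof (rule exI[of _ a], rule conjI[OF ab(1)], rule exI[of _ l], intro conjI allI impI)
    show "chain_cover X lq z0 a (phi l j)" if "j \<le> i" for j using ab(2) l[OF that] that by simp
    show "\<not> (lq (phi l j) (phi l j') \<and> lq (phi l j') (phi l j))" if "j \<le> i" "j' \<le> i" "j \<noteq> j'" for j j'
      using ab(3) l[OF that(1)] l[OF that(2)] that by simp
    fix c assume "chain_cover X lq z0 a c"
    with ab(4) obtain j where "j \<le> i" "lq c (b j)" "lq (b j) c" by blast
    then show "\<exists>j. j \<le> i \<and> lq c (phi l j) \<and> lq (phi l j) c" using l by metis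
  qed
next
  assume ?R
  then show "codes X lq z0 i" unfolding codes_def by blast
qed

text \<open>\<open>y \<in> \<pi> (g x)\<close> is written with a universal quantifier over the value
  of \<open>g\<close>; the negated graph of \<open>g\<close> is \<Delta>, so the class is kept for
  selectors far from computable.\<close>

lemma Pi1_computable_comp:
  assumes \<pi>: "Pi1_computable k \<pi>" and g: "Dfun k (\<lambda>\<Phi> \<rho>. g (\<rho> 0))"
  shows "Pi1_computable k (\<lambda>x. \<pi> (g x))"
proof -
  have *: "is_Pi k (\<lambda>\<Phi> \<rho>. \<rho> 2 \<in> \<pi> (\<rho> 0))"
    using is_Sigma_Pi_subst_num(2)[of "\<lambda>\<rho>. case_nat (\<rho> 0) (\<lambda>_. \<rho> 2)" k "\<lambda>\<Phi> \<rho>. \<rho> 1 \<in> \<pi> (\<rho> 0)"] \<pi>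
    by (simp add: Pi1_computable_iff recfun_case_nat recfun_var)
  have "Delta k (\<lambda>\<Phi> \<rho>. \<rho> 0 \<noteq> g (\<rho> (Suc 0)))"
    by (intro D_intros Dfun_comp1[OF g])
  then have "is_Pi k (\<lambda>\<Phi> \<rho>. \<rho> 0 \<noteq> g (\<rho> (Suc 0)) \<or> \<rho> (Suc (Suc 0)) \<in> \<pi> (\<rho> 0))"
    using * by (intro is_Pi_disj) (simp_all add: Delta_def numeral_2_eq_2)
  then have "is_Pi k (\<lambda>\<Phi> \<rho>. \<forall>z. z \<noteq> g (\<rho> 0) \<or> \<rho> (Suc 0) \<in> \<pi> z)" by (rule is_Pi_all)
  moreover have "(\<forall>z. z \<noteq> g x \<or> y \<in> \<pi> z) \<longleftrightarrow> y \<in> \<pi> (g x)" for x y by blast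
  ultimately show ?thesis by (simp add: Pi1_computable_iff)
qed

lemma Dfun_computable: "computable g \<Longrightarrow> Dfun k (\<lambda>\<Phi> \<rho>. g (\<rho> 0))"
  by (simp add: computable_iff_recfun Dfun_recfun)

lemma range_between:
  assumes "num_reducible \<sigma> \<nu>" "num_reducible \<nu> \<tau>" "range \<sigma> = S" "range \<tau> = S"
  shows "range \<nu> = S"
proof -
  have "range \<xi> \<subseteq> range \<xi>'" if "num_reducible \<xi> \<xi>'" for \<xi> \<xi>'
    using that unfolding num_reducible_def by auto
  from this[OF assms(1)] this[OF assms(2)] assms(3,4) show ?thesis by simp
qed

definition num_interval :: "nat \<Rightarrow> nat set set \<Rightarrow> numbering \<Rightarrow> numbering \<Rightarrow> numbering set" where
  "num_interval k S \<sigma> \<tau> = {\<nu> \<in> Pi1_numberings k S. num_reducible \<sigma> \<nu> \<and> num_reducible \<nu> \<tau>}"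

text \<open>A numbering between the endpoints has the right range and is \<Pi>-computable by
  composition. So the interval can be described without mentioning the family or the class.\<close>

lemma num_interval_eq:
  assumes "\<sigma> \<in> Pi1_numberings k S" "\<tau> \<in> Pi1_numberings k S"
  shows "num_interval k S \<sigma> \<tau> = {\<nu>. \<exists>f. computable f \<and> \<nu> = (\<lambda>z. \<tau> (f z)) \<and> num_reducible \<sigma> \<nu>}"
proof (intro equalityI subsetI)
  fix \<nu> assume "\<nu> \<in> num_interval k S \<sigma> \<tau>"
  then have le: "num_reducible \<sigma> \<nu>" "num_reducible \<nu> \<tau>" by (simp_all add: num_interval_def)
  from le(2) obtain f where "computable f" "\<nu> = (\<lambda>z. \<tau> (f z))" unfolding num_reducible_def by auto
  with le(1) show "\<nu> \<in> {\<nu>. \<exists>f. computable f \<and> \<nu> = (\<lambda>z. \<tau> (f z)) \<and> num_reducible \<sigma> \<nu>}" by blast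
next
  fix \<nu> assume "\<nu> \<in> {\<nu>. \<exists>f. computable f \<and> \<nu> = (\<lambda>z. \<tau> (f z)) \<and> num_reducible \<sigma> \<nu>}"
  then obtain f where f: "computable f" "\<nu> = (\<lambda>z. \<tau> (f z))" "num_reducible \<sigma> \<nu>" by blast
  have le: "num_reducible \<nu> \<tau>" unfolding f(2) by (rule num_reducible_comp[OF f(1)])
  have "range \<nu> = S"
    by (rule range_between[OF f(3) le]) (use assms in \<open>auto simp: Pi1_numberings_def numbering_of_def\<close>)
  moreover have "Pi1_computable k \<nu>"
    unfolding f(2) by (rule Pi1_computable_comp[OF _ Dfun_computable[OF f(1)]])
      (use assms in \<open>auto simp: Pi1_numberings_def\<close>)
  ultimately show "\<nu> \<in> num_interval k S \<sigma> \<tau>"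
    using f(3) le by (simp add: num_interval_def Pi1_numberings_def numbering_of_def)
qed

lemma codes_indices:
  assumes "\<sigma> = (\<lambda>z. \<tau> (phi s z))"
  shows "codes {\<nu>. \<exists>f. computable f \<and> \<nu> = (\<lambda>z. \<tau> (f z)) \<and> num_reducible \<sigma> \<nu>} num_reducible \<sigma> i \<longleftrightarrow>
    codes {e. num_reducible (\<lambda>z. \<tau> (phi s z)) (\<lambda>z. \<tau> (phi e z))}
      (\<lambda>d e. num_reducible (\<lambda>z. \<tau> (phi d z)) (\<lambda>z. \<tau> (phi e z))) s i"
proof (rule codes_transfer_iff[where E = "\<lambda>\<nu> e. \<nu> = (\<lambda>z. \<tau> (phi e z)) \<and> num_reducible \<sigma> \<nu>"])
  show "\<exists>e. \<nu> = (\<lambda>z. \<tau> (phi e z)) \<and> num_reducible \<sigma> \<nu>"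
    if "\<nu> \<in> {\<nu>. \<exists>f. computable f \<and> \<nu> = (\<lambda>z. \<tau> (f z)) \<and> num_reducible \<sigma> \<nu>}" for \<nu>
  proof -
    from that obtain f where f: "computable f" "\<nu> = (\<lambda>z. \<tau> (f z))" "num_reducible \<sigma> \<nu>" by blast
    from f(1) obtain e where "phi e = f" by (rule computable_ex_phi)
    with f show ?thesis by auto
  qed
qed (use assms computable_phi num_reducible_refl in auto)

section \<open>Decoding\<close>

text \<open>If \<open>U u\<close> is the graph of \<open>\<tau>\<close>, this is reducibility
  between \<open>\<tau>\<close> along \<open>phi d\<close> and \<open>\<tau>\<close> along
  \<open>phi e\<close>. Equality of the sets is spelt out elementwise to keep to number quantifiers
  over \<open>U\<close>.\<close>

definition red_idx :: "(nat \<Rightarrow> nat \<Rightarrow> bool) \<Rightarrow> nat \<Rightarrow> nat \<Rightarrow> nat \<Rightarrow> bool" where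
  "red_idx U u d e \<longleftrightarrow> (\<exists>c. \<forall>x v. U u (pr (phi d x) v) \<longleftrightarrow> U u (pr (phi e (phi c x)) v))"

definition decoded :: "(nat \<Rightarrow> nat \<Rightarrow> bool) \<Rightarrow> nat \<Rightarrow> nat \<Rightarrow> nat \<Rightarrow> bool" where
  "decoded U u s i \<longleftrightarrow> codes {e. red_idx U u s e} (red_idx U u) s i"

lemma red_idx_iff:
  assumes "\<And>x. \<tau> x = {v. U u (pr x v)}"
  shows "red_idx U u d e \<longleftrightarrow> num_reducible (\<lambda>z. \<tau> (phi d z)) (\<lambda>z. \<tau> (phi e z))"
proof
  assume "red_idx U u d e"
  then obtain c where "\<And>x v. U u (pr (phi d x) v) \<longleftrightarrow> U u (pr (phi e (phi c x)) v)"
    unfolding red_idx_def by blast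
  then show "num_reducible (\<lambda>z. \<tau> (phi d z)) (\<lambda>z. \<tau> (phi e z))"
    unfolding num_reducible_def assms by (intro exI[of _ "phi c"]) (simp add: computable_phi)
next
  assume "num_reducible (\<lambda>z. \<tau> (phi d z)) (\<lambda>z. \<tau> (phi e z))"
  then obtain f where f: "computable f" "\<And>x. \<tau> (phi d x) = \<tau> (phi e (f x))" unfolding num_reducible_def by blast
  from f(1) obtain c where "phi c = f" by (rule computable_ex_phi)
  with f(2) show "red_idx U u d e" unfolding red_idx_def assms by (intro exI[of _ c]) auto
qed

text \<open>All quantifiers are number quantifiers, so the level of \<open>U\<close> is not
  exceeded. The pair of parameters is at the same time the number tested, as the diagonalisation
  requires.\<close>

lemma Delta_decoded:
  assumes U: "Delta (Suc k) (\<lambda>\<Phi> \<rho>. U (\<rho> 0) (\<rho> 1))"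
  shows "Delta (Suc k) (\<lambda>\<Phi> \<rho>. decoded U (pfst (\<rho> 0)) (psnd (\<rho> 0)) (\<rho> 0))"
proof -
  note U2 = Delta_comp2[OF U]
  have "Delta (Suc k) (\<lambda>\<Phi> \<rho>. red_idx U (\<rho> a) (\<rho> b) (\<rho> c))" for a b c
    unfolding red_idx_def by (intro D_intros U2 Dfun_phi)
  then have red: "Delta (Suc k) (\<lambda>\<Phi> \<rho>. red_idx U (r \<Phi> \<rho>) (s \<Phi> \<rho>) (t \<Phi> \<rho>))"
    if "Dfun (Suc k) r" "Dfun (Suc k) s" "Dfun (Suc k) t" for r s t
  proof -
    have "Delta (Suc k) (\<lambda>\<Phi> \<rho>. \<exists>x y z. x = r \<Phi> \<rho> \<and> y = s \<Phi> \<rho> \<and> z = t \<Phi> \<rho> \<and> red_idx U x y z)"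
      by (intro D_intros \<open>\<And>c b a. Delta (Suc k) (\<lambda>\<Phi> \<rho>. red_idx U (\<rho> a) (\<rho> b) (\<rho> c))\<close> Dfun_shift that)
    then show ?thesis by simp
  qed
  show ?thesis
    unfolding decoded_def codes_nat atom_over_def chain_cover_def mem_Collect_eq Ball_def
    by (intro D_intros red Dfun_phi)
qed

lemma Rogers_class_le:
  assumes "\<nu> \<in> Pi1_numberings k S" "\<mu> \<in> Pi1_numberings k S"
  shows "num_equiv_rel k S `` {\<nu>} \<sqsubseteq>\<^bsub>Rogers k S\<^esub> num_equiv_rel k S `` {\<mu>} \<longleftrightarrow> num_reducible \<nu> \<mu>"
proof -
  have "num_equiv_rel k S `` {\<xi>} = {\<xi>'. \<xi>' \<in> Pi1_numberings k S \<and> num_equiv \<xi> \<xi>'}" if "\<xi> \<in> Pi1_numberings k S" for \<xi>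
    using that by (auto simp: num_equiv_rel_def)
  with assms have "num_equiv_rel k S `` {\<nu>} \<sqsubseteq>\<^bsub>Rogers k S\<^esub> num_equiv_rel k S `` {\<mu>} \<longleftrightarrow>
    (\<exists>\<nu>' \<mu>'. \<nu>' \<in> Pi1_numberings k S \<and> num_equiv \<nu> \<nu>' \<and> \<mu>' \<in> Pi1_numberings k S \<and> num_equiv \<mu> \<mu>' \<and> num_reducible \<nu>' \<mu>')"
    by (auto simp: Rogers_def)
  also have "\<dots> \<longleftrightarrow> num_reducible \<nu> \<mu>"
    using assms num_reducible_refl num_reducible_trans unfolding num_equiv_def by blast
  finally show ?thesis .
qed

lemma Rogers_carrier: "carrier (Rogers k S) = (\<lambda>\<nu>. num_equiv_rel k S `` {\<nu>}) ` Pi1_numberings k S"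
  by (auto simp: Rogers_def quotient_def)

lemma usl_isomorphicE:
  assumes "usl_isomorphic L M"
  obtains h where "bij_betw h (carrier L) (carrier M)"
    "\<And>x y. x \<in> carrier L \<Longrightarrow> y \<in> carrier L \<Longrightarrow> x \<sqsubseteq>\<^bsub>L\<^esub> y \<longleftrightarrow> h x \<sqsubseteq>\<^bsub>M\<^esub> h y"
  using assms unfolding usl_isomorphic_def by blast

theorem theorem1:
  fixes m n :: nat and R :: "'a usl" and Q :: "'b usl"
  assumes "0 < n" and "n < m"
    and "Rogers_Pi1_semilattice m R" and "usl_nontrivial R"
    and "Rogers_Pi1_semilattice n Q"
  shows "\<not> usl_isomorphic R Q"
proof
  assume "usl_isomorphic R Q"
  then obtain h where h: "bij_betw h (carrier R) (carrier Q)"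
    "\<And>x y. x \<in> carrier R \<Longrightarrow> y \<in> carrier R \<Longrightarrow> x \<sqsubseteq>\<^bsub>R\<^esub> y \<longleftrightarrow> h x \<sqsubseteq>\<^bsub>Q\<^esub> h y"
    by (rule usl_isomorphicE) blast
  from assms(3) obtain S where S: "Pi1_computable_family m S" "usl_isomorphic R (Rogers m S)"
    unfolding Rogers_Pi1_semilattice_def by blast
  from assms(5) obtain T where T: "usl_isomorphic Q (Rogers n T)"
    unfolding Rogers_Pi1_semilattice_def by blast
  from S(2) obtain f where f: "bij_betw f (carrier R) (carrier (Rogers m S))"
    "\<And>x y. x \<in> carrier R \<Longrightarrow> y \<in> carrier R \<Longrightarrow> x \<sqsubseteq>\<^bsub>R\<^esub> y \<longleftrightarrow> f x \<sqsubseteq>\<^bsub>Rogers m S\<^esub> f y"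
    by (rule usl_isomorphicE) blast
  from T obtain g where g: "bij_betw g (carrier Q) (carrier (Rogers n T))"
    "\<And>x y. x \<in> carrier Q \<Longrightarrow> y \<in> carrier Q \<Longrightarrow> x \<sqsubseteq>\<^bsub>Q\<^esub> y \<longleftrightarrow> g x \<sqsubseteq>\<^bsub>Rogers n T\<^esub> g y"
    by (rule usl_isomorphicE) blast
  from S(1) obtain \<pi> where \<pi>: "range \<pi> = S" "Pi1_computable m \<pi>"
    unfolding Pi1_computable_family_def numbering_of_def by blast
  \<comment> \<open>A family with a single member has a single numbering, which contradicts
    nontriviality.\<close>
  have "\<exists>iA iB. \<pi> iA \<noteq> \<pi> iB"
  proof (rule ccontr)
    assume "\<not> (\<exists>iA iB. \<pi> iA \<noteq> \<pi> iB)"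
    then have "S = {\<pi> 0}" using \<pi>(1) by auto
    then have "\<nu> = (\<lambda>_. \<pi> 0)" if "\<nu> \<in> Pi1_numberings m S" for \<nu>
      using that unfolding Pi1_numberings_def numbering_of_def by auto
    then have same: "A = B" if "A \<in> carrier (Rogers m S)" "B \<in> carrier (Rogers m S)" for A B
      using that unfolding Rogers_carrier by (metis (no_types, lifting) imageE)
    from assms(4) obtain x y where "x \<in> carrier R" "y \<in> carrier R" "x \<noteq> y" unfolding usl_nontrivial_def by blast
    then show False using same f(1) bij_betw_apply bij_betw_imp_inj_on inj_onD by metis
  qed
  then obtain iA iB where "\<pi> iA \<noteq> \<pi> iB" by blast
  obtain U where U: "Delta (Suc n) (\<lambda>\<Phi> \<rho>. U (\<rho> 0) (\<rho> 1))"
    "\<And>A. Pi1_set n A \<Longrightarrow> \<exists>u. A = {x. U u x}"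
    using universal_Pi1[OF assms(1)] by blast
  \<comment> \<open>\<open>i\<close> is read as a code of the top of an interval together with an
    index reducing its bottom to the top; \<open>Y\<close> differs at \<open>i\<close> from the set
    coded there.\<close>
  define Y where "Y = {i. \<not> decoded U (pfst i) (psnd i) i}"
  obtain k where k: "m = Suc k" using assms(2) by (cases m) auto
  have "Delta (Suc n) (\<lambda>\<Phi> \<rho>. \<rho> 0 \<in> Y)"
    unfolding Y_def mem_Collect_eq by (intro Delta_not Delta_decoded U)
  then have Y: "Delta (Suc k) (\<lambda>\<Phi> \<rho>. \<rho> 0 \<in> Y)"
    by (rule Delta_mono[rotated]) (use assms(2) k in simp)
  interpret coding Y \<pi> iA iB by unfold_locales fact
  have "Pi1_computable m mu"
    unfolding mu_def[abs_def] using Pi1_computable_comp[OF \<pi>(2)] Dfun_gsel[OF Y] k by blast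
  moreover have "range mu = S"
  proof
    show "range mu \<subseteq> S" using \<pi>(1) by (auto simp: mu_def)
    show "S \<subseteq> range mu" using \<pi>(1) nu0_item unfolding nu0_def by (metis (no_types, lifting) image_subset_iff rangeI)
  qed
  ultimately have mu: "mu \<in> Pi1_numberings m S" by (simp add: Pi1_numberings_def numbering_of_def)
  have "Pi1_computable m nu0"
    unfolding nu0_def[abs_def] using Pi1_computable_comp[OF \<open>Pi1_computable m mu\<close> Dfun_computable[OF computable_pr0]] .
  moreover have "range nu0 = S"
  proof
    show "range nu0 \<subseteq> S" using \<open>range mu = S\<close> by (auto simp: nu0_def)
    show "S \<subseteq> range nu0" using \<pi>(1) nu0_item by (metis (no_types, lifting) image_subset_iff rangeI)
  qed
  ultimately have nu0: "nu0 \<in> Pi1_numberings m S" by (simp add: Pi1_numberings_def numbering_of_def)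
  \<comment> \<open>The isomorphism, composed with the presentations of both semilattices, as a
    correspondence between numberings.\<close>
  define E where "E \<nu> \<nu>' \<longleftrightarrow> \<nu> \<in> Pi1_numberings m S \<and> \<nu>' \<in> Pi1_numberings n T \<and>
    (\<exists>x\<in>carrier R. f x = num_equiv_rel m S `` {\<nu>} \<and> g (h x) = num_equiv_rel n T `` {\<nu>'})" for \<nu> \<nu>'
  have hQ: "h x \<in> carrier Q" if "x \<in> carrier R" for x using h(1) that bij_betw_apply by metis
  have E1: "\<exists>\<nu>'. E \<nu> \<nu>'" if \<nu>: "\<nu> \<in> Pi1_numberings m S" for \<nu>
  proof -
    have "num_equiv_rel m S `` {\<nu>} \<in> carrier (Rogers m S)" using \<nu> by (simp add: Rogers_carrier)
    then obtain x where x: "x \<in> carrier R" "f x = num_equiv_rel m S `` {\<nu>}"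
      using f(1) by (metis bij_betw_imp_surj_on imageE)
    have "g (h x) \<in> carrier (Rogers n T)" using g(1) hQ[OF x(1)] bij_betw_apply by metis
    then show ?thesis using x \<nu> unfolding E_def Rogers_carrier by blast
  qed
  have E2: "\<exists>\<nu>. E \<nu> \<nu>'" if \<nu>': "\<nu>' \<in> Pi1_numberings n T" for \<nu>'
  proof -
    have "num_equiv_rel n T `` {\<nu>'} \<in> carrier (Rogers n T)" using \<nu>' by (simp add: Rogers_carrier)
    then obtain y where y: "y \<in> carrier Q" "g y = num_equiv_rel n T `` {\<nu>'}"
      using g(1) by (metis bij_betw_imp_surj_on imageE)
    then obtain x where x: "x \<in> carrier R" "h x = y" using h(1) by (metis bij_betw_imp_surj_on imageE)
    have "f x \<in> carrier (Rogers m S)" using f(1) x(1) bij_betw_apply by metis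
    then show ?thesis using x y \<nu>' unfolding E_def Rogers_carrier by blast
  qed
  have E_ord: "num_reducible \<nu> \<xi> \<longleftrightarrow> num_reducible \<nu>' \<xi>'" if "E \<nu> \<nu>'" "E \<xi> \<xi>'" for \<nu> \<nu>' \<xi> \<xi>'
  proof -
    from that obtain x y where x: "x \<in> carrier R" "f x = num_equiv_rel m S `` {\<nu>}" "g (h x) = num_equiv_rel n T `` {\<nu>'}"
      and y: "y \<in> carrier R" "f y = num_equiv_rel m S `` {\<xi>}" "g (h y) = num_equiv_rel n T `` {\<xi>'}"
      and in_Pi: "\<nu> \<in> Pi1_numberings m S" "\<xi> \<in> Pi1_numberings m S" "\<nu>' \<in> Pi1_numberings n T" "\<xi>' \<in> Pi1_numberings n T"
      unfolding E_def by blast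
    have "num_reducible \<nu> \<xi> \<longleftrightarrow> x \<sqsubseteq>\<^bsub>R\<^esub> y"
      using f(2)[OF x(1) y(1)] Rogers_class_le[OF in_Pi(1,2)] x y by simp
    also have "\<dots> \<longleftrightarrow> num_reducible \<nu>' \<xi>'"
      using h(2)[OF x(1) y(1)] g(2)[OF hQ[OF x(1)] hQ[OF y(1)]] Rogers_class_le[OF in_Pi(3,4)] x y by simp
    finally show ?thesis .
  qed
  obtain \<sigma> \<tau> where \<sigma>: "E nu0 \<sigma>" and \<tau>: "E mu \<tau>" using E1 nu0 mu by blast
  then have in_T: "\<sigma> \<in> Pi1_numberings n T" "\<tau> \<in> Pi1_numberings n T" unfolding E_def by blast+
  have "num_reducible \<sigma> \<tau>" using E_ord[OF \<sigma> \<tau>] nu0_le_mu by simp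
  then obtain s where s: "\<sigma> = (\<lambda>z. \<tau> (phi s z))"
    unfolding num_reducible_def by (metis computable_ex_phi ext)
  have "Pi1_set n (num_graph \<tau>)" using in_T(2) by (simp add: Pi1_numberings_def Pi1_computable_def)
  from U(2)[OF this] obtain u where u: "num_graph \<tau> = {x. U u x}" by blast
  have \<tau>_eq: "\<tau> x = {v. U u (pr x v)}" for x
  proof -
    have "v \<in> \<tau> x \<longleftrightarrow> pr x v \<in> num_graph \<tau>" for v unfolding num_graph_def by auto
    then show ?thesis unfolding u by auto
  qed
  have red: "red_idx U u = (\<lambda>d e. num_reducible (\<lambda>z. \<tau> (phi d z)) (\<lambda>z. \<tau> (phi e z)))"
    using red_idx_iff[of \<tau> U u, OF \<tau>_eq] by (simp add: fun_eq_iff)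
  define i where "i = pr u s"
  have int1: "interval = num_interval m S nu0 mu"
    unfolding interval_def num_interval_eq[OF nu0 mu] ..
  have "i \<in> Y \<longleftrightarrow> codes (num_interval m S nu0 mu) num_reducible nu0 i"
    using codes_interval int1 by simp
  also have "\<dots> \<longleftrightarrow> codes (num_interval n T \<sigma> \<tau>) num_reducible \<sigma> i"
  proof (rule codes_transfer_iff[where E = "\<lambda>\<nu> \<nu>'. E \<nu> \<nu>' \<and> num_reducible nu0 \<nu> \<and> num_reducible \<nu> mu"])
    show "\<nu> \<in> num_interval m S nu0 mu \<and> \<nu>' \<in> num_interval n T \<sigma> \<tau>"
      if "E \<nu> \<nu>' \<and> num_reducible nu0 \<nu> \<and> num_reducible \<nu> mu" for \<nu> \<nu>'
      using that E_ord[OF \<sigma>] E_ord[OF _ \<tau>] unfolding num_interval_def E_def by blast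
    show "\<exists>\<nu>'. E \<nu> \<nu>' \<and> num_reducible nu0 \<nu> \<and> num_reducible \<nu> mu" if "\<nu> \<in> num_interval m S nu0 mu" for \<nu>
      using that E1 unfolding num_interval_def by blast
    show "\<exists>\<nu>. E \<nu> \<nu>' \<and> num_reducible nu0 \<nu> \<and> num_reducible \<nu> mu" if \<nu>': "\<nu>' \<in> num_interval n T \<sigma> \<tau>" for \<nu>'
    proof -
      from \<nu>' obtain \<nu> where "E \<nu> \<nu>'" using E2 unfolding num_interval_def by blast
      with \<nu>' E_ord[OF \<sigma> this] E_ord[OF this \<tau>] show ?thesis unfolding num_interval_def by blast
    qed
    show "num_reducible \<nu> \<xi> \<longleftrightarrow> num_reducible \<nu>' \<xi>'"
      if "E \<nu> \<nu>' \<and> num_reducible nu0 \<nu> \<and> num_reducible \<nu> mu" "E \<xi> \<xi>' \<and> num_reducible nu0 \<xi> \<and> num_reducible \<xi> mu"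
      for \<nu> \<nu>' \<xi> \<xi>' using E_ord that by blast
    show "E nu0 \<sigma> \<and> num_reducible nu0 nu0 \<and> num_reducible nu0 mu"
      using \<sigma> num_reducible_refl nu0_le_mu by blast
  qed
  also have "\<dots> \<longleftrightarrow> decoded U u s i"
    unfolding num_interval_eq[OF in_T] codes_indices[OF s] decoded_def
    by (simp only: red)
  also have "\<dots> \<longleftrightarrow> i \<notin> Y" by (simp add: Y_def i_def)
  finally show False by simp
qed

end
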